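(* There exist constants $C,C_{low},C_{up},\varepsilon_0>0$, depending only on the geometric and analytic data of $M$, such that for every $0<\varepsilon<\varepsilon_0$, every $\delta\in(0,1)$, every starting point $z\in M$, and every $$T\ge C\Big(s_0+\kappa_d(\varepsilon)^{-1}\big(\log N_\varepsilon(M)+\log\tfrac1\delta\big)\Big),$$ one has, for every radius $r$ with $C_{low}\,\varepsilon\le r\le C_{up}\,\operatorname{reach}(M)$, $$\mathbb P_z\Big(H_q(\Gamma_T^r)\cong H_q(M)\ \text{for every } q=0,\ldots,d\Big)\ge 1-\delta .$$
   Context: Setting. $d\ge2$; homology has coefficients in a fixed field. $M\subset\mathbb R^d$ is the closure of a bounded connected open set. $d_M(x,y)$ is the infimum of the lengths of rectifiable curves in $M$ joining $x$ to $y$; $B_M(x,\varepsilon)=\{y\in M:d_M(x,y)<\varepsilon\}$; $\mu(A)=|A|/|M|$ is normalized Lebesgue measure on $M$. $M$ satisfies the following assumptions. (1) Positive reach: $\operatorname{reach}(M)>0$, i.e. every $z$ with $0<\operatorname{dist}(z,M)<\operatorname{reach}(M)$ has a unique nearest point in $M$. (2) There are $c_{ie}\ge1$, $\rho_{ie}>0$ with $d_M(x,y)\le c_{ie}|x-y|$ whenever $x,y\in M$, $|x-y|<\rho_{ie}$. (3) There are $c_{vol},C_{vol},\rho_{vol}>0$ with $c_{vol}\varepsilon^d\le\mu(B_M(x,\varepsilon))\le C_{vol}\varepsilon^d$ for all $x\in M$, $0<\varepsilon<\rho_{vol}$. (4) $M$ is an admissible reflecting domain: its boundary is regular enough that reflected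 Brownian motion in $M$ exists and is unique in law, has a symmetric Neumann heat kernel, the Neumann semigroup on $L^2(M,\mu)$ is compact, the Neumann spectrum is discrete with positive spectral gap, and there are $\rho_{ch}>0$, $L_{ch}\ge1$ such that every $x\in M$ has a neighbourhood $U_x\subset M$ and a chart $\Psi_x$ on $U_x$, bi-Lipschitz with constant $L_{ch}$ and with Jacobian determinants of $\Psi_x,\Psi_x^{-1}$ uniformly bounded above and below, mapping $U_x$ onto a Euclidean ball if $\operatorname{dist}(x,\partial M)\ge\rho_{ch}$ and onto a half-ball with $\partial M$ carried into the flat face if $\operatorname{dist}(x,\partial M)<\rho_{ch}$. (A compact connected Lipschitz domain with uniform chart constants suffices for (4).) (5) Heat-kernel domination: there are $s_0>0$, $a_{hk}\ge1$ such that the transition density $p_t(x,y)$ of the process below with respect to $\mu$ satisfies $p_t(x,y)\le a_{hk}$ for all $t\ge s_0$, $x,y\in M$. Process. $X=(X_t)_{t\ge0}$ is reflected Brownian motion in $M$: the conservative $\mu$-symmetric Hunt process with continuous paths associated with the Dirichlet form $\mathcal E(f,g)=\frac12\int_M\nabla f\cdot\nabla g\,d\mu$, $f,g\in H^1(M)$ (generator $\frac12\Delta$ with Neumann boundary condition). $\mathbb P_z$ is its law started at $z$. Notation. $\Gamma_T=\{X_t:0\le t\le T\}$; for compact $S\subset\mathbb R^d$, $S^r=\{x\in\mathbb R^d:\operatorname{dist}(x,S)\le r\}$, so $\Gamma_T^r$ is the ambient Euclidean $r$-offset of the trace. $N_\varepsilon(M)$ is the least $N$ for which there are $x_1,\dots,x_N\in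 M$ with $M\subseteq\bigcup_iB_M(x_i,\varepsilon)$. $\kappa_2(\varepsilon)=(\log\varepsilon^{-1})^{-1}$ and $\kappa_d(\varepsilon)=\varepsilon^{d-2}$ for $d\ge3$. Constants may depend on $d$, $M$, $\operatorname{reach}(M)$ and the constants in (1)-(5), but not on $T,\delta,\varepsilon,r$ or the starting point. *)

theory Defs
  imports "HOL-Probability.Probability" "HOL-Homology.Homology"
begin

section \<open>Metric and measure geometry of a subset of Euclidean space\<close>

text \<open>The reach of a closed convex set is \<open>\<infinity>\<close>.\<close>

definition reach :: "'a::euclidean_space set \<Rightarrow> ennreal" where
  "reach M = Sup {ennreal r | r. 0 \<le> r \<and>
     (\<forall>z. 0 < infdist z M \<and> infdist z M < r \<longrightarrow> (\<exists>!p. p \<in> M \<and> dist z p = infdist z M))}"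

definition curve_length :: "(real \<Rightarrow> 'a::metric_space) \<Rightarrow> ennreal" where
  "curve_length \<gamma> = (SUP (n, t) \<in> {(n, t). mono t \<and> range t \<subseteq> {0..1}}.
     ennreal (\<Sum>i<n::nat. dist (\<gamma> (t i)) (\<gamma> (t (Suc i)))))"

text \<open>Non-rectifiable curves have length \<open>\<infinity>\<close> and do not affect the infimum; the value is
  \<open>\<infinity>\<close> if no rectifiable curve in \<open>M\<close> joins the two points.\<close>

definition intrinsic_dist :: "'a::real_normed_vector set \<Rightarrow> 'a \<Rightarrow> 'a \<Rightarrow> ennreal" where
  "intrinsic_dist M x y = (INF \<gamma> \<in> {\<gamma>. path \<gamma> \<and> path_image \<gamma> \<subseteq> M \<and>
     pathstart \<gamma> = x \<and> pathfinish \<gamma> = y}. curve_length \<gamma>)"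

definition intrinsic_ball :: "'a::real_normed_vector set \<Rightarrow> 'a \<Rightarrow> real \<Rightarrow> 'a set" where
  "intrinsic_ball M x \<epsilon> = {y \<in> M. intrinsic_dist M x y < ennreal \<epsilon>}"

definition covering_number :: "'a::real_normed_vector set \<Rightarrow> real \<Rightarrow> nat" where
  "covering_number M \<epsilon> = (LEAST n. \<exists>S. finite S \<and> card S = n \<and> S \<subseteq> M \<and>
     M \<subseteq> (\<Union>x\<in>S. intrinsic_ball M x \<epsilon>))"

definition norm_lebesgue :: "'a::euclidean_space set \<Rightarrow> 'a measure" where
  "norm_lebesgue M = uniform_measure (restrict_space lborel M) M"

definition offset :: "real \<Rightarrow> 'a::metric_space set \<Rightarrow> 'a set" where
  "offset r S = {x. infdist x S \<le> r}"

definition kappa :: "nat \<Rightarrow> real \<Rightarrow> real" where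
  "kappa d \<epsilon> = (if d = 2 then inverse (ln (inverse \<epsilon>)) else \<epsilon> ^ (d - 2))"

section \<open>The Neumann Dirichlet form\<close>

definition L2 :: "'a::euclidean_space set \<Rightarrow> ('a \<Rightarrow> real) set" where
  "L2 M = {f \<in> borel_measurable (norm_lebesgue M). integrable (norm_lebesgue M) (\<lambda>x. (f x)\<^sup>2)}"

definition l2_inner :: "'a::euclidean_space set \<Rightarrow> ('a \<Rightarrow> real) \<Rightarrow> ('a \<Rightarrow> real) \<Rightarrow> real" where
  "l2_inner M f g = (\<integral>x. f x * g x \<partial>norm_lebesgue M)"

definition l2_norm :: "'a::euclidean_space set \<Rightarrow> ('a \<Rightarrow> real) \<Rightarrow> real" where
  "l2_norm M f = sqrt (l2_inner M f f)"

text \<open>By mollification it makes no difference whether the test functions are \<open>C\<^sup>1\<close> or \<open>C\<^sup>\<infinity>\<close>.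
  The weak gradient is that of \<open>f\<close> on the open set \<open>interior M\<close>.\<close>

definition has_weak_gradient :: "'a::euclidean_space set \<Rightarrow> ('a \<Rightarrow> real) \<Rightarrow> ('a \<Rightarrow> 'a) \<Rightarrow> bool" where
  "has_weak_gradient M f G \<longleftrightarrow>
     G \<in> borel_measurable (norm_lebesgue M) \<and>
     integrable (norm_lebesgue M) (\<lambda>x. (norm (G x))\<^sup>2) \<and>
     (\<forall>\<phi> D. (\<forall>x. GDERIV \<phi> x :> D x) \<and> continuous_on UNIV D \<and>
        compact (closure {x. \<phi> x \<noteq> 0}) \<and> closure {x. \<phi> x \<noteq> 0} \<subseteq> interior M \<longrightarrow>
        (LINT x:interior M|lborel. f x *\<^sub>R D x) = - (LINT x:interior M|lborel. \<phi> x *\<^sub>R G x))"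

definition H1 :: "'a::euclidean_space set \<Rightarrow> ('a \<Rightarrow> real) set" where
  "H1 M = {f \<in> L2 M. \<exists>G. has_weak_gradient M f G}"

definition weak_gradient :: "'a::euclidean_space set \<Rightarrow> ('a \<Rightarrow> real) \<Rightarrow> 'a \<Rightarrow> 'a" where
  "weak_gradient M f = (SOME G. has_weak_gradient M f G)"

text \<open>Weak gradients are determined only almost everywhere on \<open>interior M\<close>, so the integral is
  taken there; the boundary of a set of positive reach is Lebesgue-null.\<close>

definition dirichlet_form :: "'a::euclidean_space set \<Rightarrow> ('a \<Rightarrow> real) \<Rightarrow> ('a \<Rightarrow> real) \<Rightarrow> real" where
  "dirichlet_form M f g =
     (LINT x:interior M|norm_lebesgue M. weak_gradient M f x \<bullet> weak_gradient M g x) / 2"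

text \<open>\<open>neumann_generator M f h\<close>: \<open>f\<close> lies in the domain of the self-adjoint operator \<open>A = - \<Delta> / 2\<close>
  (Neumann boundary condition) of the form, and \<open>A f = h\<close>. The operator acts on real \<open>L\<^sup>2\<close> and its
  spectrum is real, so only real spectral parameters are considered.\<close>

definition neumann_generator :: "'a::euclidean_space set \<Rightarrow> ('a \<Rightarrow> real) \<Rightarrow> ('a \<Rightarrow> real) \<Rightarrow> bool" where
  "neumann_generator M f h \<longleftrightarrow> f \<in> H1 M \<and> h \<in> L2 M \<and>
     (\<forall>g \<in> H1 M. dirichlet_form M f g = l2_inner M h g)"

definition neumann_resolvent_set :: "'a::euclidean_space set \<Rightarrow> real set" where
  "neumann_resolvent_set M = {l.
     (\<forall>h \<in> L2 M. \<exists>f. neumann_generator M f (\<lambda>x. l * f x + h x)) \<and>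
     (\<exists>K. \<forall>h \<in> L2 M. \<forall>f. neumann_generator M f (\<lambda>x. l * f x + h x) \<longrightarrow>
        l2_norm M f \<le> K * l2_norm M h)}"

definition neumann_spectrum :: "'a::euclidean_space set \<Rightarrow> real set" where
  "neumann_spectrum M = - neumann_resolvent_set M"

definition neumann_eigenspace :: "'a::euclidean_space set \<Rightarrow> real \<Rightarrow> ('a \<Rightarrow> real) set" where
  "neumann_eigenspace M l = {f. neumann_generator M f (\<lambda>x. l * f x)}"

definition discrete_neumann_spectrum :: "'a::euclidean_space set \<Rightarrow> bool" where
  "discrete_neumann_spectrum M \<longleftrightarrow> (\<forall>l \<in> neumann_spectrum M.
     \<not> l islimpt neumann_spectrum M \<and>
     (\<exists>f \<in> neumann_eigenspace M l. l2_norm M f \<noteq> 0) \<and>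
     (\<exists>B \<subseteq> neumann_eigenspace M l. finite B \<and> (\<forall>f \<in> neumann_eigenspace M l.
        \<exists>c. AE x in norm_lebesgue M. f x = (\<Sum>b\<in>B. c b * b x))))"

text \<open>The eigenvalue \<open>0\<close> is simple and the rest of the spectrum is bounded away from it.\<close>

definition neumann_spectral_gap :: "'a::euclidean_space set \<Rightarrow> bool" where
  "neumann_spectral_gap M \<longleftrightarrow>
     (\<exists>\<gamma>>0. neumann_spectrum M \<inter> {..<\<gamma>} = {0}) \<and>
     (\<forall>f \<in> neumann_eigenspace M 0. \<exists>c. AE x in norm_lebesgue M. f x = c)"

section \<open>Reflected Brownian motion\<close>

text \<open>The canonical space of continuous paths \<open>[0,\<infinity>) \<rightarrow> M\<close> (extended by \<open>undefined\<close> at negative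
  times), with the \<open>\<sigma>\<close>-algebra generated by the coordinates \<open>X\<^sub>t(\<omega>) = \<omega> t\<close>. A process is given by the
  family \<open>P\<close> of its laws \<open>P z\<close>, \<open>z \<in> M\<close>; infinite lifetime in \<open>M\<close> expresses conservativeness.\<close>

definition path_space :: "'a::euclidean_space set \<Rightarrow> (real \<Rightarrow> 'a) measure" where
  "path_space M = restrict_space (\<Pi>\<^sub>M t\<in>{0..}. borel)
     {\<omega>. continuous_on {0..} \<omega> \<and> \<omega> ` {0..} \<subseteq> M}"

definition path_shift :: "real \<Rightarrow> (real \<Rightarrow> 'a) \<Rightarrow> (real \<Rightarrow> 'a)" where
  "path_shift s \<omega> = (\<lambda>t\<in>{0..}. \<omega> (s + t))"

definition natural_filtration :: "'a::euclidean_space set \<Rightarrow> ennreal \<Rightarrow> (real \<Rightarrow> 'a) measure" where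
  "natural_filtration M t = sigma (space (path_space M))
     {(\<lambda>\<omega>. \<omega> s) -` B \<inter> space (path_space M) | s B. 0 \<le> s \<and> ennreal s \<le> t \<and> B \<in> sets borel}"

text \<open>At \<open>t = \<infinity>\<close> the intersection over \<open>u > t\<close> is empty, hence the first conjunct.\<close>

definition right_filtration :: "'a::euclidean_space set \<Rightarrow> ennreal \<Rightarrow> (real \<Rightarrow> 'a) measure" where
  "right_filtration M t = sigma (space (path_space M))
     {A. A \<in> sets (natural_filtration M \<infinity>) \<and> (\<forall>u>t. A \<in> sets (natural_filtration M u))}"

text \<open>Quasi-left-continuity of a Hunt process is automatic since the paths are continuous.\<close>

definition hunt_process :: "'a::euclidean_space set \<Rightarrow> ('a \<Rightarrow> (real \<Rightarrow> 'a) measure) \<Rightarrow> bool" where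
  "hunt_process M P \<longleftrightarrow>
     P \<in> restrict_space borel M \<rightarrow>\<^sub>M prob_algebra (path_space M) \<and>
     (\<forall>z\<in>M. AE \<omega> in P z. \<omega> 0 = z) \<and>
     (\<forall>\<tau>. stopping_time (right_filtration M) \<tau> \<longrightarrow>
       (\<forall>z\<in>M.
        \<forall>A \<in> sets (filtration.pre_sigma (space (path_space M)) (right_filtration M) \<tau>).
        \<forall>B \<in> sets (path_space M).
          emeasure (P z) {\<omega>\<in>A. \<tau> \<omega> < \<infinity> \<and> path_shift (enn2real (\<tau> \<omega>)) \<omega> \<in> B} =
          (\<integral>\<^sup>+\<omega>. emeasure (P (\<omega> (enn2real (\<tau> \<omega>)))) B * indicator {\<omega>\<in>A. \<tau> \<omega> < \<infinity>} \<omega> \<partial>P z)))"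

definition symmetric_process :: "'a::euclidean_space set \<Rightarrow> ('a \<Rightarrow> (real \<Rightarrow> 'a) measure) \<Rightarrow> bool" where
  "symmetric_process M P \<longleftrightarrow>
     (\<forall>t\<ge>0. \<forall>f \<in> borel_measurable (norm_lebesgue M). \<forall>g \<in> borel_measurable (norm_lebesgue M).
        (\<integral>\<^sup>+x. f x * (\<integral>\<^sup>+\<omega>. g (\<omega> t) \<partial>P x) \<partial>norm_lebesgue M) =
        (\<integral>\<^sup>+x. (\<integral>\<^sup>+\<omega>. f (\<omega> t) \<partial>P x) * g x \<partial>norm_lebesgue M))"

definition transition_op ::
  "('a \<Rightarrow> (real \<Rightarrow> 'a) measure) \<Rightarrow> real \<Rightarrow> ('a \<Rightarrow> real) \<Rightarrow> 'a \<Rightarrow> real" where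
  "transition_op P t f x = (\<integral>\<omega>. f (\<omega> t) \<partial>P x)"

text \<open>The Dirichlet form of a symmetric semigroup \<open>T\<close> is the limit of \<open>\<langle>f - T\<^sub>t f, g\<rangle> / t\<close> as
  \<open>t \<down> 0\<close>; its domain consists of those \<open>f \<in> L\<^sup>2\<close> for which the limit with \<open>g = f\<close> is finite.\<close>

definition dirichlet_associated :: "'a::euclidean_space set \<Rightarrow> ('a \<Rightarrow> (real \<Rightarrow> 'a) measure) \<Rightarrow> bool" where
  "dirichlet_associated M P \<longleftrightarrow>
     (\<forall>f \<in> L2 M. f \<in> H1 M \<longleftrightarrow>
        (\<exists>l. ((\<lambda>t. l2_inner M (\<lambda>x. f x - transition_op P t f x) f / t) \<longlongrightarrow> l) (at_right 0))) \<and>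
     (\<forall>f \<in> H1 M. \<forall>g \<in> H1 M.
        ((\<lambda>t. l2_inner M (\<lambda>x. f x - transition_op P t f x) g / t) \<longlongrightarrow> dirichlet_form M f g)
          (at_right 0))"

definition reflected_brownian_motion ::
  "'a::euclidean_space set \<Rightarrow> ('a \<Rightarrow> (real \<Rightarrow> 'a) measure) \<Rightarrow> bool" where
  "reflected_brownian_motion M P \<longleftrightarrow>
     hunt_process M P \<and> symmetric_process M P \<and> dirichlet_associated M P"

text \<open>\<open>p t x y\<close> is a transition density from \<^emph>\<open>every\<close> starting point. The Dirichlet form alone
  determines the laws \<open>P z\<close> only outside an exceptional set of starting points (one could freeze
  the process started at one given point); the heat kernel removes this ambiguity. Symmetry and
  the pointwise semigroup identity determine \<open>p\<close> at every pair of points.\<close>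

definition neumann_heat_kernel ::
  "'a::euclidean_space set \<Rightarrow> ('a \<Rightarrow> (real \<Rightarrow> 'a) measure) \<Rightarrow> (real \<Rightarrow> 'a \<Rightarrow> 'a \<Rightarrow> real) \<Rightarrow> bool" where
  "neumann_heat_kernel M P p \<longleftrightarrow>
     (\<forall>t>0.
        (\<lambda>(x, y). p t x y) \<in> borel_measurable (norm_lebesgue M \<Otimes>\<^sub>M norm_lebesgue M) \<and>
        (\<forall>x\<in>M. \<forall>y\<in>M. 0 \<le> p t x y \<and> p t x y = p t y x) \<and>
        (\<forall>x\<in>M. distr (P x) (norm_lebesgue M) (\<lambda>\<omega>. \<omega> t) =
                density (norm_lebesgue M) (\<lambda>y. ennreal (p t x y)))) \<and>
     (\<forall>s>0. \<forall>t>0. \<forall>x\<in>M. \<forall>y\<in>M.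
        ennreal (p (s + t) x y) = (\<integral>\<^sup>+w. ennreal (p s x w) * ennreal (p t w y) \<partial>norm_lebesgue M))"

definition compact_semigroup :: "'a::euclidean_space set \<Rightarrow> ('a \<Rightarrow> (real \<Rightarrow> 'a) measure) \<Rightarrow> bool" where
  "compact_semigroup M P \<longleftrightarrow>
     (\<forall>t>0. \<forall>f :: nat \<Rightarrow> 'a \<Rightarrow> real. (\<forall>n. f n \<in> L2 M \<and> l2_norm M (f n) \<le> 1) \<longrightarrow>
        (\<exists>k g. strict_mono k \<and> g \<in> L2 M \<and>
           (\<lambda>n. l2_norm M (\<lambda>x. transition_op P t (f (k n)) x - g x)) \<longlonglongrightarrow> 0))"

section \<open>Admissible reflecting domains\<close>

definition jacobian_bounds :: "real \<Rightarrow> (real^'n::finite \<Rightarrow> real^'n) \<Rightarrow> (real^'n) set \<Rightarrow> bool" where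
  "jacobian_bounds J \<Psi> U \<longleftrightarrow> (AE y in lebesgue. y \<in> interior U \<longrightarrow>
     \<Psi> differentiable (at y) \<and>
     \<bar>det (matrix (frechet_derivative \<Psi> (at y)))\<bar> \<in> {1 / J..J})"

definition uniform_charts :: "(real^'n::finite) set \<Rightarrow> bool" where
  "uniform_charts M \<longleftrightarrow> (\<exists>\<rho> L J. 0 < \<rho> \<and> 1 \<le> L \<and> 1 \<le> J \<and>
     (\<forall>x\<in>M. \<exists>U \<Psi>.
        U \<subseteq> M \<and> (\<exists>V. open V \<and> x \<in> V \<and> M \<inter> V \<subseteq> U) \<and>
        (\<forall>a\<in>U. \<forall>b\<in>U. dist a b / L \<le> dist (\<Psi> a) (\<Psi> b) \<and> dist (\<Psi> a) (\<Psi> b) \<le> L * dist a b) \<and>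
        jacobian_bounds J \<Psi> U \<and> jacobian_bounds J (inv_into U \<Psi>) (\<Psi> ` U) \<and>
        (\<exists>c R. 0 < R \<and>
          (if \<rho> \<le> infdist x (frontier M) then \<Psi> ` U = ball c R
           else (\<exists>e. norm e = 1 \<and> \<Psi> ` U = {y \<in> ball c R. 0 \<le> e \<bullet> (y - c)} \<and>
                  \<Psi> ` (U \<inter> frontier M) \<subseteq> {y. e \<bullet> (y - c) = 0})))))"

definition admissible_reflecting_domain :: "(real^'n::finite) set \<Rightarrow> bool" where
  "admissible_reflecting_domain M \<longleftrightarrow>
     (\<exists>P p. reflected_brownian_motion M P \<and> neumann_heat_kernel M P p) \<and>
     (\<forall>P p P' p'. reflected_brownian_motion M P \<and> neumann_heat_kernel M P p \<and>
        reflected_brownian_motion M P' \<and> neumann_heat_kernel M P' p' \<longrightarrow> (\<forall>z\<in>M. P z = P' z)) \<and>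
     (\<forall>P p. reflected_brownian_motion M P \<and> neumann_heat_kernel M P p \<longrightarrow> compact_semigroup M P) \<and>
     discrete_neumann_spectrum M \<and> neumann_spectral_gap M \<and> uniform_charts M"

section \<open>Singular homology with coefficients in a field\<close>

text \<open>The library's homology has integer coefficients; its singular simplices and face maps are
  reused here with chains that have coefficients in \<open>'k\<close>.\<close>

type_synonym ('a, 'k) coeff_chain = "((nat \<Rightarrow> real) \<Rightarrow> 'a) \<Rightarrow>\<^sub>0 'k"

definition coeff_chains :: "nat \<Rightarrow> 'a topology \<Rightarrow> ('a, 'k::field) coeff_chain set" where
  "coeff_chains p X = {c. Poly_Mapping.keys c \<subseteq> singular_simplex_set p X}"

definition coeff_boundary :: "nat \<Rightarrow> ('a, 'k::field) coeff_chain \<Rightarrow> ('a, 'k) coeff_chain" where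
  "coeff_boundary p c = (if p = 0 then 0 else
     (\<Sum>f \<in> Poly_Mapping.keys c. \<Sum>k\<le>p.
        Poly_Mapping.single (singular_face p k f) ((-1) ^ k * Poly_Mapping.lookup c f)))"

definition coeff_cycles :: "nat \<Rightarrow> 'a topology \<Rightarrow> ('a, 'k::field) coeff_chain set" where
  "coeff_cycles p X = {c \<in> coeff_chains p X. coeff_boundary p c = 0}"

definition coeff_boundaries :: "nat \<Rightarrow> 'a topology \<Rightarrow> ('a, 'k::field) coeff_chain set" where
  "coeff_boundaries p X = coeff_boundary (Suc p) ` coeff_chains (Suc p) X"

text \<open>The quotient of cycles by boundaries. The boundaries are added again in the scalar
  multiplication because \<open>a = 0\<close> would otherwise not map cosets to cosets.\<close>

definition homology_space ::
  "'k::field itself \<Rightarrow> nat \<Rightarrow> 'a topology \<Rightarrow> ('k, ('a, 'k) coeff_chain set) module" where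
  "homology_space _ p X = \<lparr>
     carrier = (\<lambda>c. (+) c ` coeff_boundaries p X) ` coeff_cycles p X,
     mult = undefined, one = undefined,
     zero = coeff_boundaries p X,
     add = (\<lambda>U V. {u + v | u v. u \<in> U \<and> v \<in> V}),
     smult = (\<lambda>a U. {Poly_Mapping.map ((*) a) u + b | u b. u \<in> U \<and> b \<in> coeff_boundaries p X})\<rparr>"

definition linearly_isomorphic :: "('k, 'u, 'x) module_scheme \<Rightarrow> ('k, 'v, 'y) module_scheme \<Rightarrow> bool" where
  "linearly_isomorphic V W \<longleftrightarrow> (\<exists>h. bij_betw h (carrier V) (carrier W) \<and>
     (\<forall>u \<in> carrier V. \<forall>v \<in> carrier V. h (u \<oplus>\<^bsub>V\<^esub> v) = h u \<oplus>\<^bsub>W\<^esub> h v) \<and>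
     (\<forall>a. \<forall>u \<in> carrier V. h (a \<odot>\<^bsub>V\<^esub> u) = a \<odot>\<^bsub>W\<^esub> h u))"

end

theory Submission
  imports Defs
begin

text \<open>If the trace \<open>S\<close> of the path comes within \<open>2 \<epsilon> \<le> r / 2\<close> of every point of \<open>M\<close>, then its \<open>r\<close>-offset has
the homotopy type of \<open>M\<close>. The proof therefore has a deterministic half, which turns density of a sample
into homology, and a probabilistic half, which bounds the time at which all balls of a minimal
\<open>\<epsilon>\<close>-covering have been visited. A union bound over the covering joins them.

Below the reach the nearest-point map \<open>\<pi>\<close> is continuous, and if \<open>x\<close> is close to \<open>M\<close>
then the segment from \<open>\<pi> x\<close> to \<open>x\<close> can be prolonged to length \<open>t < reach M\<close> with \<open>\<pi> x\<close> still nearest to its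
end (\<open>nearest_point_normal_ray\<close>, a consequence of Brouwer's theorem). The open ball of radius \<open>t\<close> about that end
misses \<open>M\<close>, so the component of \<open>s - \<pi> x\<close> along the normal is at most quadratic in the distance, for \<open>s\<close> in \<open>M\<close>
(\<open>normal_inequality\<close>). Consequently the straight line from a point of the offset to its nearest point in
\<open>M\<close> does not leave the offset, and the offset deforms onto \<open>M\<close>
(\<open>offset_of_dense_sample_homotopy_equivalent\<close>). Homotopy invariance of homology over the field \<open>'k\<close>
comes from integral chains: the prism over a simplex is the image of one chain in the cylinder over the
standard simplex, these universal chains exist because the cylinder is contractible, and the resulting
identities pass to \<open>'k\<close> by change of coefficients (\<open>homotopic_imp_coeff_homologous\<close>).

It suffices to look at the process at the times \<open>s0 + k h\<close> with \<open>h = \<epsilon> ^ (2 * d)\<close>. At time \<open>s0\<close>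
its law is at most \<open>a_hk\<close> times the stationary one, so the probability of avoiding a set \<open>D\<close> for \<open>n\<close>
further steps is at most \<open>a_hk * \<rho> ^ n\<close>, where \<open>\<rho>\<close> is the norm of the transition operator \<open>K\<^sub>h\<close> compressed to
the functions that vanish on \<open>D\<close> (\<open>killed_integral_le\<close>, \<open>emeasure_avoid_le\<close>). The analytic core is
\<open>\<rho> \<le> 1 - \<kappa> h / C\<close> for a suitable ball \<open>D\<close> inside the given \<open>\<epsilon>\<close>-ball (\<open>hole_estimate\<close>), in other words
\<open>\<parallel>f\<parallel>\<^sup>2 \<le> C / \<kappa> * E\<^sub>h(f)\<close> for \<open>f\<close> vanishing on \<open>D\<close>, with \<open>E\<^sub>h(f) = \<langle>f - K\<^sub>h f, f\<rangle> / h\<close>.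

The function \<open>f\<close> is replaced by \<open>g = K\<^sub>h f\<close>. Convexity of \<open>t \<mapsto> \<langle>K\<^sub>t f, f\<rangle>\<close> shows that \<open>g\<close> lies in the
form domain with Dirichlet energy at most \<open>E\<^sub>h(f)\<close>, and that \<open>\<parallel>f - g\<parallel>\<^sup>2 \<le> h E\<^sub>h(f)\<close>. Averages of \<open>g\<close> against
smooth bumps are followed along a cone inside \<open>M\<close>, from the hole up to a fixed scale, through a geometric
sequence of scales \<open>t\<close>. Two neighbouring bumps differ by a divergence, so the definition of the weak
gradient bounds the change of the average by the gradient of \<open>g\<close> on a cube of size \<open>t\<close>. By the Cauchy-Schwarz
inequality with weights \<open>t ^ 2 / t ^ d\<close> and by the bounded overlap of the cubes, the total change squared is at most the
Dirichlet energy times the sum of the weights; that sum is a multiple of \<open>1 / \<kappa>\<close>, logarithmic for \<open>d = 2\<close>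
and dominated by the smallest scale for \<open>d \<ge> 3\<close> (\<open>chain_estimate\<close>, \<open>scale_sum_le\<close>). At the hole the average of
\<open>g\<close> is that of \<open>g - f\<close>; the tiny step \<open>h\<close> makes it negligible against the normalisation of the bump. At the fixed scale
the Poincare inequality takes over; it follows from compactness of the semigroup and from simplicity
of the eigenvalue zero (\<open>Poincare\<close>).

Returning to the whole covering: about \<open>T / h\<close> steps fit into the available time, so the step size cancels in
\<open>(1 - \<kappa> h / C) ^ n \<le> exp (- \<kappa> n h / C)\<close>, and the hypothesis on \<open>T\<close> makes the union bound smaller than \<open>\<delta>\<close>
(\<open>decay_time\<close>).\<close>

section \<open>Sets of positive reach\<close>

text \<open>The condition on \<open>\<tau>\<close> under the supremum that defines \<open>reach M\<close>.\<close>

definition unique_nearest :: "'a::euclidean_space set \<Rightarrow> real \<Rightarrow> bool" where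
  "unique_nearest M \<tau> \<longleftrightarrow> (\<forall>z. 0 < infdist z M \<and> infdist z M < \<tau> \<longrightarrow> (\<exists>!p. p \<in> M \<and> dist z p = infdist z M))"

lemma infdist_eq_dist_closest_point:
  assumes "closed M" "M \<noteq> {}"
  shows "infdist z M = dist z (closest_point M z)"
proof -
  obtain y where "y \<in> M" "infdist z M = dist z y" using infdist_attains_inf[OF assms] by blast
  then show ?thesis
    using closest_point_le[OF assms(1), of y z] infdist_le[OF closest_point_in_set[OF assms], of z z] by simp
qed

lemma closest_point_unique_nearest:
  assumes "closed M" "M \<noteq> {}" "unique_nearest M \<tau>" "infdist z M < \<tau>" "p \<in> M" "dist z p = infdist z M"
  shows "closest_point M z = p"
proof (cases "infdist z M = 0")
  case True
  then have "dist z (closest_point M z) = 0" "dist z p = 0"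
    using assms infdist_eq_dist_closest_point[OF assms(1,2), of z] by auto
  then show ?thesis by simp
next
  case False
  then have "0 < infdist z M" using infdist_nonneg[of z M] by simp
  then show ?thesis
    using assms closest_point_in_set[OF assms(1,2), of z] infdist_eq_dist_closest_point[OF assms(1,2), of z]
    unfolding unique_nearest_def by metis
qed

text \<open>The graph of the nearest-point map is cut out of the tube times \<open>M\<close> by the closed condition
  \<open>dist z m = infdist z M\<close>, and a map into a compact space with closed graph is continuous.\<close>

lemma continuous_on_closest_point_tube:
  assumes M: "compact M" "M \<noteq> {}" and U: "unique_nearest M \<tau>"
  shows "continuous_on {z. infdist z M < \<tau>} (closest_point M)"
proof -
  have cl: "closed M" using M by (simp add: compact_imp_closed)
  have "closedin (top_of_set ({z. infdist z M < \<tau>} \<times> M)) ((\<lambda>z. (z, closest_point M z)) ` {z. infdist z M < \<tau>})"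
  proof -
    have "(\<lambda>z. (z, closest_point M z)) ` {z. infdist z M < \<tau>} =
        ({z. infdist z M < \<tau>} \<times> M) \<inter> {w. dist (fst w) (snd w) = infdist (fst w) M}"
    proof (rule subset_antisym; rule subsetI)
      fix w assume "w \<in> (\<lambda>z. (z, closest_point M z)) ` {z. infdist z M < \<tau>}"
      then obtain z where "w = (z, closest_point M z)" "infdist z M < \<tau>" by blast
      then show "w \<in> ({z. infdist z M < \<tau>} \<times> M) \<inter> {w. dist (fst w) (snd w) = infdist (fst w) M}"
        using closest_point_in_set[OF cl M(2), of z] infdist_eq_dist_closest_point[OF cl M(2), of z] by simp
    next
      fix w assume "w \<in> ({z. infdist z M < \<tau>} \<times> M) \<inter> {w. dist (fst w) (snd w) = infdist (fst w) M}"
      then obtain z m where w: "w = (z, m)" "infdist z M < \<tau>" "m \<in> M" "dist z m = infdist z M"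
        by (cases w) auto
      have "closest_point M z = m" using closest_point_unique_nearest[OF cl M(2) U w(2-4)] .
      then show "w \<in> (\<lambda>z. (z, closest_point M z)) ` {z. infdist z M < \<tau>}" using w(1,2) by blast
    qed
    moreover have "closed {w::'a\<times>'a. dist (fst w) (snd w) = infdist (fst w) M}"
      by (intro closed_Collect_eq continuous_intros)
    ultimately show ?thesis by (simp add: closedin_closed_Int)
  qed
  then show ?thesis
    by (intro iffD2[OF continuous_closed_graph_eq[OF M(1)]]) (use closest_point_in_set[OF cl M(2)] in auto)
qed

text \<open>Moving away from \<open>M\<close> along the normal direction keeps the nearest point: a Brouwer fixed point
  of \<open>y \<mapsto> c + \<eta> (c - \<pi> y) / |c - \<pi> y|\<close> lies on the prolongation of the segment from \<open>\<pi> y\<close> to \<open>c\<close>.\<close>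

lemma nearest_point_prolongation:
  assumes M: "compact M" "M \<noteq> {}" and U: "unique_nearest M \<tau>"
    and c: "0 < infdist c M" and \<eta>: "0 < \<eta>" "infdist c M + \<eta> < \<tau>"
  defines "p \<equiv> closest_point M c"
  shows "infdist (c + (\<eta> / dist c p) *\<^sub>R (c - p)) M = infdist c M + \<eta>"
proof -
  have cl: "closed M" using M by (simp add: compact_imp_closed)
  define g where "g = (\<lambda>y. c + (\<eta> / dist c (closest_point M y)) *\<^sub>R (c - closest_point M y))"
  have far: "infdist c M \<le> dist c m" if "m \<in> M" for m using infdist_le that by blast
  have pm: "closest_point M y \<in> M" for y using closest_point_in_set[OF cl M(2)] .
  have pos: "0 < dist c (closest_point M y)" for y using far[OF pm[of y]] c by linarith
  have tube: "cball c \<eta> \<subseteq> {z. infdist z M < \<tau>}"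
  proof
    fix z assume "z \<in> cball c \<eta>"
    then show "z \<in> {z. infdist z M < \<tau>}"
      using infdist_triangle[of z M c] \<eta> by (auto simp: dist_commute)
  qed
  have cont: "continuous_on (cball c \<eta>) (closest_point M)"
    using continuous_on_closest_point_tube[OF M U] tube continuous_on_subset by blast
  have "continuous_on (cball c \<eta>) g"
    unfolding g_def using pos by (intro continuous_intros cont) (metis less_irrefl)
  moreover have "g ` cball c \<eta> \<subseteq> cball c \<eta>"
  proof
    fix w assume "w \<in> g ` cball c \<eta>"
    then obtain y where "w = g y" by auto
    then have "dist c w = \<eta>"
      using pos[of y] \<eta> unfolding g_def by (simp add: dist_norm)
    then show "w \<in> cball c \<eta>" by simp
  qed
  ultimately obtain y where y: "y \<in> cball c \<eta>" "g y = y"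
    using brouwer[of "cball c \<eta>" g] \<eta> by (auto simp: image_subset_iff_funcset)
  let ?q = "closest_point M y"
  have yq: "dist y ?q = \<eta> + dist c ?q"
  proof -
    let ?D = "dist c ?q"
    have "y - ?q = (1 + \<eta> / ?D) *\<^sub>R (c - ?q)"
    proof -
      have "y - ?q = (c - ?q) + (\<eta> / ?D) *\<^sub>R (c - ?q)"
        using arg_cong[OF y(2), of "\<lambda>w. w - ?q"] unfolding g_def by simp
      then show ?thesis by (simp add: scaleR_add_left)
    qed
    then have "dist y ?q = (1 + \<eta> / ?D) * ?D"
      using \<eta> pos[of y] by (simp add: dist_norm)
    then show ?thesis using pos[of y] by (simp add: field_simps)
  qed
  have "dist c ?q \<le> dist c m" if "m \<in> M" for m
  proof -
    have "dist y ?q \<le> dist y m" using closest_point_le[OF cl that] .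
    also have "\<dots> \<le> \<eta> + dist c m" using y(1) dist_triangle[of y m c] by (simp add: dist_commute)
    finally show ?thesis using yq by simp
  qed
  from this[OF pm[of c]] have "dist c ?q = infdist c M"
    using far[OF pm[of y]] infdist_eq_dist_closest_point[OF cl M(2), of c] by simp
  then have qp: "?q = p" unfolding p_def using closest_point_unique_nearest[OF cl M(2) U _ pm] \<eta> by fastforce
  have "infdist y M = dist y p" using infdist_eq_dist_closest_point[OF cl M(2), of y] qp by simp
  moreover have "y = c + (\<eta> / dist c p) *\<^sub>R (c - p)" using y(2) qp by (simp add: g_def)
  ultimately show ?thesis using yq qp infdist_eq_dist_closest_point[OF cl M(2), of c] by (simp add: p_def)
qed

text \<open>The lengths \<open>s\<close> for which the point at distance \<open>s\<close> on the ray is at distance \<open>s\<close> from \<open>M\<close> form a closed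
  set, and the prolongation lemma forbids a largest one below \<open>t\<close>.\<close>

lemma nearest_point_normal_ray:
  assumes M: "compact M" "M \<noteq> {}" and U: "unique_nearest M \<tau>"
    and x: "0 < infdist x M" "infdist x M < \<tau>" and t: "0 \<le> t" "t < \<tau>"
  defines "p \<equiv> closest_point M x"
  shows "infdist (p + (t / dist x p) *\<^sub>R (x - p)) M = t"
proof -
  have cl: "closed M" using M by (simp add: compact_imp_closed)
  define u where "u = (1 / dist x p) *\<^sub>R (x - p)"
  have dx: "infdist x M = dist x p" unfolding p_def by (rule infdist_eq_dist_closest_point[OF cl M(2)])
  have nu: "norm u = 1" using x dx by (simp add: u_def dist_norm)
  have pM: "p \<in> M" unfolding p_def using closest_point_in_set[OF cl M(2)] .
  have ray: "p + (t / dist x p) *\<^sub>R (x - p) = p + t *\<^sub>R u" for t by (simp add: u_def)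
  have up: "infdist (p + t *\<^sub>R u) M \<le> t" if "0 \<le> t" for t
    using infdist_le[OF pM, of "p + t *\<^sub>R u"] nu that by (simp add: dist_norm)
  have shrink: "infdist (p + s *\<^sub>R u) M = s" if "0 \<le> s" "s \<le> t" "infdist (p + t *\<^sub>R u) M = t" for s t
  proof -
    have "dist (p + t *\<^sub>R u) (p + s *\<^sub>R u) = t - s"
      using nu that by (simp add: dist_norm flip: scaleR_diff_left)
    then have "t \<le> infdist (p + s *\<^sub>R u) M + (t - s)"
      using infdist_triangle[of "p + t *\<^sub>R u" M "p + s *\<^sub>R u"] that by linarith
    then show ?thesis using up[OF that(1)] by linarith
  qed
  have xr: "p + dist x p *\<^sub>R u = x" using x dx by (simp add: u_def)
  show ?thesis unfolding ray
  proof (cases "t \<le> dist x p")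
    case True
    then show "infdist (p + t *\<^sub>R u) M = t"
      using shrink[of t "dist x p"] t xr dx by simp
  next
    case False
    define A where "A = {s \<in> {dist x p..t}. infdist (p + s *\<^sub>R u) M = s}"
    have "A = {dist x p..t} \<inter> {s. infdist (p + s *\<^sub>R u) M = s}" by (auto simp: A_def)
    moreover have "closed {s. infdist (p + s *\<^sub>R u) M = s}"
      by (intro closed_Collect_eq continuous_intros)
    ultimately have cA: "compact A" by (simp add: compact_Int_closed)
    have "dist x p \<in> A" using False xr dx by (simp add: A_def)
    then obtain s where s: "s \<in> A" "\<And>s'. s' \<in> A \<Longrightarrow> s' \<le> s"
      using compact_attains_sup[OF cA] by blast
    have "s = t"
    proof (rule ccontr)
      assume "s \<noteq> t"
      then have st: "s < t" "dist x p \<le> s" and near: "infdist (p + s *\<^sub>R u) M = s" using s(1) by (auto simp: A_def)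
      let ?c = "p + s *\<^sub>R u"
      have s0: "0 < s" using st x dx by linarith
      have dcp: "dist ?c p = s" using nu s0 by (simp add: dist_norm)
      have cp: "closest_point M ?c = p"
        using closest_point_unique_nearest[OF cl M(2) U _ pM, of ?c] near dcp st t by simp
      have far: "infdist (?c + ((t - s) / s) *\<^sub>R (?c - p)) M = s + (t - s)"
        using nearest_point_prolongation[OF M U, of ?c "t - s"] near cp dcp s0 st t by simp
      have ray_point: "?c + ((t - s) / s) *\<^sub>R (?c - p) = p + t *\<^sub>R u"
        using s0 by (simp add: add.assoc flip: scaleR_add_left)
      have "infdist (p + t *\<^sub>R u) M = t" using far unfolding ray_point by simp
      then have "t \<in> A" using st by (simp add: A_def)
      then show False using s(2)[of t] st by simp
    qed
    then show "infdist (p + t *\<^sub>R u) M = t" using s(1) by (simp add: A_def)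
  qed
qed

text \<open>The point at distance \<open>t\<close> from \<open>p\<close> in direction \<open>x - p\<close> has distance at least \<open>t\<close> from \<open>s\<close>. Expanding the
  square of that distance and multiplying by \<open>norm (x - p)\<close> gives the inequality.\<close>

lemma normal_inequality:
  assumes M: "compact M" "M \<noteq> {}" and U: "unique_nearest M \<tau>"
    and x: "infdist x M < \<tau>" and t: "0 \<le> t" "t < \<tau>" and s: "s \<in> M"
  defines "p \<equiv> closest_point M x"
  shows "2 * t * ((x - p) \<bullet> (s - p)) \<le> (norm (s - p))\<^sup>2 * norm (x - p)"
proof (cases "infdist x M = 0")
  case True
  then have "x = p" using infdist_eq_dist_closest_point[of M x] M by (simp add: p_def compact_imp_closed)
  then show ?thesis by simp
next
  case False
  then have x0: "0 < infdist x M" using infdist_nonneg[of x M] by simp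
  define D where "D = norm (x - p)"
  have D: "0 < D" using x0 infdist_eq_dist_closest_point[of M x] M by (simp add: p_def compact_imp_closed D_def dist_norm)
  have "t \<le> dist (p + (t / D) *\<^sub>R (x - p)) s"
    using infdist_le[OF s, of "p + (t / D) *\<^sub>R (x - p)"] nearest_point_normal_ray[OF M U x0 x t]
    by (simp add: p_def D_def dist_norm)
  then have "t\<^sup>2 \<le> (norm ((t / D) *\<^sub>R (x - p) - (s - p)))\<^sup>2"
    using t by (intro power_mono) (simp_all add: dist_norm algebra_simps)
  also have "\<dots> = t\<^sup>2 - 2 * (t / D) * ((x - p) \<bullet> (s - p)) + (norm (s - p))\<^sup>2"
  proof -
    have *: "((t / D) *\<^sub>R (x - p)) \<bullet> ((t / D) *\<^sub>R (x - p)) = t\<^sup>2"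
      using D unfolding D_def by (simp add: dot_square_norm power2_eq_square)
    have "(norm (v - w))\<^sup>2 = v \<bullet> v - 2 * (v \<bullet> w) + (norm w)\<^sup>2" for v w :: 'a
      by (simp add: power2_norm_eq_inner inner_diff_left inner_diff_right inner_commute)
    from this[of "(t / D) *\<^sub>R (x - p)" "s - p"] show ?thesis unfolding * by simp
  qed
  finally have "2 * (t / D) * ((x - p) \<bullet> (s - p)) \<le> (norm (s - p))\<^sup>2" by simp
  then have "2 * (t / D) * ((x - p) \<bullet> (s - p)) * D \<le> (norm (s - p))\<^sup>2 * D"
    using D by (intro mult_right_mono) auto
  then show ?thesis using D by (simp add: D_def field_simps)
qed

text \<open>The straight-line homotopy to the nearest point stays in the offset of \<open>S\<close>: near \<open>M\<close> the sample is
  dense enough, and far from \<open>M\<close> moving towards \<open>M\<close> does not increase the distance to the sample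
  point, by the normal inequality.\<close>

lemma segment_to_nearest_point_in_offset:
  assumes M: "compact M" "M \<noteq> {}" and U: "unique_nearest M \<tau>"
    and S: "compact S" "S \<noteq> {}" "S \<subseteq> M" and r: "0 < r" "8 * r < \<tau>"
    and dense: "\<And>y. y \<in> M \<Longrightarrow> infdist y S \<le> r / 2"
    and x: "x \<in> offset r S" and a: "0 \<le> a" "a \<le> 1"
  shows "(1 - a) *\<^sub>R x + a *\<^sub>R closest_point M x \<in> offset r S"
proof -
  have cl: "closed M" using M by (simp add: compact_imp_closed)
  define p where "p = closest_point M x"
  define y where "y = (1 - a) *\<^sub>R x + a *\<^sub>R p"
  define D where "D = norm (x - p)"
  obtain s where s: "s \<in> S" "infdist x S = dist x s"
    using infdist_attains_inf[OF compact_imp_closed[OF S(1)] S(2)] by blast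
  have xs: "dist x s \<le> r" using x s by (simp add: offset_def)
  have sM: "s \<in> M" using s S by auto
  have pM: "p \<in> M" unfolding p_def using closest_point_in_set[OF cl M(2)] .
  have dx: "infdist x M = D" unfolding p_def D_def using infdist_eq_dist_closest_point[OF cl M(2)] by (simp add: dist_norm)
  have Dr: "D \<le> r" using infdist_le[OF sM, of x] xs dx by simp
  have yp: "y - p = (1 - a) *\<^sub>R (x - p)" by (simp add: y_def algebra_simps)
  have nyp: "dist y p = (1 - a) * D" using a by (simp add: dist_norm yp D_def)
  have "infdist y S \<le> r"
  proof (cases "(1 - a) * D \<le> r / 2")
    case True
    have "infdist y S \<le> infdist p S + dist y p" by (rule infdist_triangle)
    then show ?thesis using dense[OF pM] True nyp by simp
  next
    case False
    define v where "v = s - p"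
    have D0: "0 < D" using False r a by (cases "D = 0") (auto simp: D_def)
    have nv: "norm v \<le> 2 * r"
      using norm_triangle_ineq[of "s - x" "x - p"] xs Dr by (simp add: v_def D_def dist_norm norm_minus_commute)
    \<comment> \<open>The normal inequality with \<open>t = 8 r\<close> and \<open>norm v \<le> 2 r\<close> makes the inner product at most \<open>r D / 4\<close>, which is
      the precision needed while the moving point is farther than \<open>r / 2\<close> from \<open>p\<close>.\<close>
    have "2 * (8 * r) * ((x - p) \<bullet> v) \<le> (norm v)\<^sup>2 * D"
      unfolding v_def D_def p_def using normal_inequality[OF M U _ _ _ sM, of x "8 * r"] r dx Dr by simp
    also have "\<dots> \<le> (2 * r)\<^sup>2 * D" using nv D0 by (intro mult_right_mono power_mono) auto
    finally have "r * ((x - p) \<bullet> v) \<le> r * (r * D / 4)" by (simp add: power2_eq_square mult_ac)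
    then have nin: "(x - p) \<bullet> v \<le> r * D / 4" using r by (metis mult_le_cancel_left_pos)
    have sq: "(dist (p + c *\<^sub>R (x - p)) s)\<^sup>2 = c\<^sup>2 * D\<^sup>2 - 2 * c * ((x - p) \<bullet> v) + (norm v)\<^sup>2" for c
    proof -
      have "(norm (w - v))\<^sup>2 = (norm w)\<^sup>2 - 2 * (w \<bullet> v) + (norm v)\<^sup>2" for w :: 'a
        by (simp add: power2_norm_eq_inner inner_diff_left inner_diff_right inner_commute)
      from this[of "c *\<^sub>R (x - p)"] have "(norm (c *\<^sub>R (x - p) - v))\<^sup>2 = c\<^sup>2 * D\<^sup>2 - 2 * c * ((x - p) \<bullet> v) + (norm v)\<^sup>2"
        by (simp add: D_def power_mult_distrib)
      moreover have "p + c *\<^sub>R (x - p) - s = c *\<^sub>R (x - p) - v" by (simp add: v_def)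
      ultimately show ?thesis by (simp only: dist_norm)
    qed
    let ?i = "(x - p) \<bullet> v"
    have "(dist x s)\<^sup>2 = D\<^sup>2 - 2 * ?i + (norm v)\<^sup>2" using sq[of 1] by simp
    moreover have "(dist y s)\<^sup>2 = (1 - a)\<^sup>2 * D\<^sup>2 - 2 * (1 - a) * ?i + (norm v)\<^sup>2"
      using sq[of "1 - a"] yp by (metis add.commute diff_add_cancel)
    ultimately have diff: "(dist x s)\<^sup>2 - (dist y s)\<^sup>2 = a * ((2 - a) * D\<^sup>2 - 2 * ?i)"
      by (simp add: algebra_simps power2_eq_square)
    have "r / 2 * D \<le> (2 - a) * D * D"
    proof (rule mult_right_mono)
      have "(1 - a) * D \<le> (2 - a) * D" using D0 by (intro mult_right_mono) auto
      then show "r / 2 \<le> (2 - a) * D" using False by linarith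
    qed (use D0 in simp)
    then have "0 \<le> (2 - a) * D\<^sup>2 - 2 * ?i" using nin by (simp add: power2_eq_square mult.assoc)
    then have "(dist y s)\<^sup>2 \<le> (dist x s)\<^sup>2" using diff a by (metis diff_ge_0_iff_ge mult_nonneg_nonneg)
    then have "dist y s \<le> dist x s" by (rule power2_le_imp_le) simp
    then show ?thesis using infdist_le[OF s(1), of y] xs by simp
  qed
  then show ?thesis by (simp add: offset_def y_def p_def)
qed

theorem offset_of_dense_sample_homotopy_equivalent:
  assumes M: "compact M" "M \<noteq> {}" and U: "unique_nearest M \<tau>"
    and S: "compact S" "S \<noteq> {}" "S \<subseteq> M" and r: "0 < r" "8 * r < \<tau>"
    and dense: "\<And>y. y \<in> M \<Longrightarrow> infdist y S \<le> r / 2"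
  shows "top_of_set (offset r S) homotopy_equivalent_space top_of_set M"
proof -
  let ?O = "offset r S" and ?\<pi> = "closest_point M"
  have cl: "closed M" using M by (simp add: compact_imp_closed)
  have MO: "M \<subseteq> ?O"
  proof
    fix y assume "y \<in> M"
    then show "y \<in> ?O" using dense[of y] r(1) by (simp add: offset_def)
  qed
  have tube: "?O \<subseteq> {z. infdist z M < \<tau>}"
  proof
    fix x assume "x \<in> ?O"
    moreover obtain s where "s \<in> S" "infdist x S = dist x s"
      using infdist_attains_inf[OF compact_imp_closed[OF S(1)] S(2)] by blast
    ultimately show "x \<in> {z. infdist z M < \<tau>}"
      using infdist_le[of s M x] S(3) r by (auto simp: offset_def)
  qed
  have cont: "continuous_on ?O ?\<pi>"
    using continuous_on_closest_point_tube[OF M U] tube continuous_on_subset by blast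
  have \<pi>: "continuous_map (top_of_set ?O) (top_of_set M) ?\<pi>"
    using cont closest_point_in_set[OF cl M(2)] by auto
  have i: "continuous_map (top_of_set M) (top_of_set ?O) id"
    using MO by auto
  have "homotopic_with_canon (\<lambda>_. True) ?O ?O id ?\<pi>"
  proof (rule homotopic_with_linear[where f = id])
    show "continuous_on ?O id" "continuous_on ?O ?\<pi>" using cont by auto
    fix x assume x: "x \<in> ?O"
    show "closed_segment (id x) (?\<pi> x) \<subseteq> ?O"
      using segment_to_nearest_point_in_offset[OF M U S r dense x] by (auto simp: closed_segment_def)
  qed
  from homotopic_with_symD[OF this]
  have 1: "homotopic_with (\<lambda>_. True) (top_of_set ?O) (top_of_set ?O) (id \<circ> ?\<pi>) id"
    by simp
  have "homotopic_with (\<lambda>_. True) (top_of_set M) (top_of_set M) (?\<pi> \<circ> id) id"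
    using closest_point_self by (intro homotopic_with_equal) (auto intro: continuous_on_eq[OF continuous_on_id])
  then show ?thesis unfolding homotopy_equivalent_space_def
    by (intro exI[of _ ?\<pi>] exI[of _ id] conjI \<pi> i 1)
qed

lemma unique_nearest_below_reach:
  assumes "ennreal \<tau> < reach M"
  shows "unique_nearest M \<tau>"
proof -
  obtain r where r: "ennreal \<tau> < ennreal r" "0 \<le> r"
     "\<forall>z. 0 < infdist z M \<and> infdist z M < r \<longrightarrow> (\<exists>!p. p \<in> M \<and> dist z p = infdist z M)"
    using assms unfolding reach_def less_Sup_iff by auto
  then have "\<tau> < r" using ennreal_leI[of r \<tau>] by (auto simp: not_less[symmetric])
  then show ?thesis unfolding unique_nearest_def using r(3) by auto
qed

section \<open>Universal homotopy prisms\<close>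

definition simplex_cylinder :: "nat \<Rightarrow> ((nat \<Rightarrow> real) \<times> real) topology" where
  "simplex_cylinder p =
     prod_topology (subtopology (powertop_real UNIV) (standard_simplex p)) (top_of_set {0..1})"

lemma standard_simplex_contract:
  assumes "a \<in> standard_simplex p" "x \<in> standard_simplex p" "0 \<le> s" "s \<le> 1"
  shows "(\<lambda>i. (1 - s) * x i + s * a i) \<in> standard_simplex p"
  using convex_standard_simplex assms by blast

lemma contractible_cylinder:
  "contractible_space (simplex_cylinder p)"
proof -
  let ?S = "subtopology (powertop_real UNIV) (standard_simplex p)" and ?I = "top_of_set {0..1::real}"
  define a where "a = (\<lambda>j::nat. if j = 0 then 1 else (0::real))"
  have a: "a \<in> standard_simplex p" by (auto simp: a_def standard_simplex_def)
  let ?h = "\<lambda>(s::real, x::nat\<Rightarrow>real, t::real). ((\<lambda>i. (1 - s) * x i + s * a i), (1 - s) * t)"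
  have *: "continuous_map (prod_topology (top_of_set {0..1}) (prod_topology ?S ?I)) (prod_topology ?S ?I) ?h"
    unfolding continuous_map_pairwise
  proof
    have X: "continuous_map (prod_topology (top_of_set {0..1::real}) (prod_topology ?S ?I)) (powertop_real UNIV) (\<lambda>u. fst (snd u))"
      by (rule continuous_map_into_fulltopology[OF continuous_map_compose[OF continuous_map_snd continuous_map_fst, unfolded o_def]])
    have X': "continuous_map (prod_topology (top_of_set {0..1::real}) (prod_topology ?S ?I)) euclideanreal (\<lambda>u. fst (snd u) i)" for i
      using X by (simp add: continuous_map_componentwise_UNIV)
    have S: "continuous_map (prod_topology (top_of_set {0..1::real}) (prod_topology ?S ?I)) euclideanreal fst"
      using continuous_map_into_fulltopology continuous_map_fst by blast
    have T: "continuous_map (prod_topology (top_of_set {0..1::real}) (prod_topology ?S ?I)) euclideanreal (\<lambda>u. snd (snd u))"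
      by (rule continuous_map_into_fulltopology[OF continuous_map_compose[OF continuous_map_snd continuous_map_snd, unfolded o_def]])
    show "continuous_map (prod_topology (top_of_set {0..1}) (prod_topology ?S ?I)) ?S (fst \<circ> ?h)"
      unfolding continuous_map_in_subtopology continuous_map_componentwise_UNIV
      using standard_simplex_contract[OF a]
      by (auto simp: o_def case_prod_unfold intro!: continuous_intros X' S)
    show "continuous_map (prod_topology (top_of_set {0..1}) (prod_topology ?S ?I)) ?I (snd \<circ> ?h)"
      unfolding continuous_map_in_subtopology
      by (auto simp: o_def case_prod_unfold mult_le_one intro!: continuous_intros T S)
  qed
  have "homotopic_with (\<lambda>x. True) (prod_topology ?S ?I) (prod_topology ?S ?I) id (\<lambda>x. (a, 0))"
    unfolding homotopic_with_def
    by (rule exI[of _ ?h]) (use * in \<open>auto\<close>)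
  then show ?thesis unfolding contractible_space_def simplex_cylinder_def by blast
qed

text \<open>The cycle is homologous to its image under the constant map, a cycle of positive degree in a
  one-point space.\<close>

lemma cycle_is_boundary_contractible:
  assumes X: "contractible_space X" and c: "singular_chain p X c" "chain_boundary p c = 0" and p: "1 \<le> p"
  shows "\<exists>d. singular_chain (Suc p) X d \<and> chain_boundary (Suc p) d = c"
proof -
  obtain a where hom: "homotopic_with (\<lambda>x. True) X X id (\<lambda>x. a)"
    using X unfolding contractible_space_def by blast
  have cyc: "singular_relcycle p X {} c" using c by (simp add: singular_cycle)
  have 1: "homologous_rel p X {} (chain_map p id c) (chain_map p (\<lambda>x. a) c)"
    using homotopic_imp_homologous_rel_chain_maps[OF _ cyc, of "{}" X id "\<lambda>x. a"] hom
    by simp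
  show ?thesis
  proof (cases "topspace X = {}")
    case True
    then show ?thesis using c by (auto simp: singular_chain_empty)
  next
    case False
    have aX: "a \<in> topspace X" using homotopic_with_imp_continuous_maps[OF hom] False
      by (auto simp: continuous_map_def)
    let ?Y = "subtopology X {a}"
    have tY: "topspace ?Y = {a}" using aX by auto
    have "continuous_map X ?Y (\<lambda>x. a)" using aX by (auto simp: continuous_map_in_subtopology)
    then have "singular_relcycle p ?Y {} (chain_map p (\<lambda>x. a) c)"
      using singular_relcycle_chain_map[OF cyc, of ?Y "\<lambda>x. a" "{}"] by auto
    then have "singular_relboundary p ?Y {} (chain_map p (\<lambda>x. a) c)"
      using singular_boundary_eq_cycle_singleton[OF tY p] by auto
    then have "singular_relboundary p X {} (chain_map p (\<lambda>x. a) c)"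
      unfolding singular_boundary using singular_chain_subtopology by blast
    moreover have "chain_map p id c = c" using c by (simp add: chain_map_ident)
    ultimately have "singular_relboundary p X {} c"
      using 1 unfolding homologous_rel_def by (metis diff_add_cancel singular_relboundary_add)
    then show ?thesis by (simp add: singular_boundary)
  qed
qed

abbreviation model_simplex :: "nat \<Rightarrow> (nat \<Rightarrow> real) \<Rightarrow> (nat \<Rightarrow> real)" where
  "model_simplex p \<equiv> restrict id (standard_simplex p)"

text \<open>The prism over \<open>\<sigma>\<close> swept out by the homotopy \<open>h\<close>, as the image of a universal chain \<open>d p\<close> in the cylinder
  over the standard \<open>p\<close>-simplex.\<close>

definition prism_map ::
  "(nat \<Rightarrow> ((nat \<Rightarrow> real) \<times> real) chain) \<Rightarrow> nat \<Rightarrow> ('a \<times> real \<Rightarrow> 'b) \<Rightarrow> ((nat \<Rightarrow> real) \<Rightarrow> 'a) \<Rightarrow> 'b chain"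
  where "prism_map d p h \<sigma> = chain_map (Suc p) (\<lambda>(x, t). h (\<sigma> x, t)) (d p)"

text \<open>The chain homotopy identity for the universal simplex: top minus bottom minus the prism over the
  faces. For \<open>p = 0\<close> the last term vanishes, so that \<open>p - 1\<close> does no harm.\<close>

definition prism_model :: "(nat \<Rightarrow> ((nat \<Rightarrow> real) \<times> real) chain) \<Rightarrow> nat \<Rightarrow> bool" where
  "prism_model d p \<longleftrightarrow> singular_chain (Suc p) (simplex_cylinder p) (d p) \<and>
     chain_boundary (Suc p) (d p) =
       frag_of (simplex_map p (\<lambda>x. (x, 1)) (model_simplex p)) -
       frag_of (simplex_map p (\<lambda>x. (x, 0)) (model_simplex p)) -
       frag_extend (prism_map d (p - 1) id) (chain_boundary p (frag_of (model_simplex p)))"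

lemma singular_simplex_model: "singular_simplex p (subtopology (powertop_real UNIV) (standard_simplex p)) (model_simplex p)"
  unfolding singular_simplex_def by (auto simp: continuous_map_in_subtopology
      intro: continuous_map_from_subtopology  continuous_map_eq[OF continuous_map_from_subtopology[OF continuous_map_id]])

lemma continuous_map_cylinder:
  assumes "singular_simplex p X \<sigma>" "continuous_map (prod_topology X (top_of_set {0..1})) Y h"
  shows "continuous_map (simplex_cylinder p) Y (\<lambda>(x, t). h (\<sigma> x, t))"
proof -
  have "continuous_map (simplex_cylinder p) (prod_topology X (top_of_set {0..1})) (\<lambda>(x, t). (\<sigma> x, t))"
    using assms(1) unfolding simplex_cylinder_def singular_simplex_def
    by (simp add: continuous_map_prod_top)
  from continuous_map_compose[OF this assms(2)] show ?thesis
    by (simp add: o_def case_prod_unfold)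
qed

lemma singular_chain_prism_map:
  assumes "singular_chain (Suc p) (simplex_cylinder p) (d p)"
    "singular_simplex p X \<sigma>" "continuous_map (prod_topology X (top_of_set {0..1})) Y h"
  shows "singular_chain (Suc p) Y (prism_map d p h \<sigma>)"
  unfolding prism_map_def
  by (rule singular_chain_chain_map[OF assms(1) continuous_map_cylinder[OF assms(2,3)]])

text \<open>Naturality of the prism: it is obtained from the universal cylinder by substitution.\<close>

lemma chain_map_prism_map:
  assumes "singular_chain (Suc q) (simplex_cylinder q) (d q)"
    "\<And>x. x \<in> standard_simplex q \<Longrightarrow> \<sigma> (\<tau> x) = \<rho> x"
  shows "chain_map (Suc q) (\<lambda>(x, t). h (\<sigma> x, t)) (prism_map d q id \<tau>) = prism_map d q h \<rho>"
proof -
  have "chain_map (Suc q) (\<lambda>(x, t). h (\<sigma> x, t)) (prism_map d q id \<tau>) =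
      chain_map (Suc q) ((\<lambda>(x, t). h (\<sigma> x, t)) \<circ> (\<lambda>(x, t). (\<tau> x, t))) (d q)"
    by (simp add: chain_map_compose prism_map_def)
  also have "\<dots> = prism_map d q h \<rho>"
    unfolding prism_map_def
    by (rule chain_map_eq[OF assms(1)]) (auto simp: simplex_cylinder_def assms(2))
  finally show ?thesis .
qed

text \<open>The universal identity is pushed forward along \<open>(x, t) \<mapsto> h (\<sigma> x, t)\<close>; by naturality its last term
  becomes the prism over the faces of \<open>\<sigma>\<close>.\<close>

lemma chain_boundary_prism_map:
  assumes m: "prism_model d p" "0 < p \<Longrightarrow> prism_model d (p - 1)"
    and s: "singular_simplex p X \<sigma>" and h: "continuous_map (prod_topology X (top_of_set {0..1})) Y h"
  shows "chain_boundary (Suc p) (prism_map d p h \<sigma>) =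
    frag_of (simplex_map p (\<lambda>x. h (x, 1)) \<sigma>) - frag_of (simplex_map p (\<lambda>x. h (x, 0)) \<sigma>) -
    frag_extend (prism_map d (p - 1) h) (chain_boundary p (frag_of \<sigma>))"
proof -
  let ?g = "\<lambda>(x, t). h (\<sigma> x, t)"
  have ch: "singular_chain (Suc p) (simplex_cylinder p) (d p)"
    using m(1) by (simp add: prism_model_def)
  have bd: "chain_boundary (Suc p) (d p) =
       frag_of (simplex_map p (\<lambda>x. (x, 1)) (model_simplex p)) -
       frag_of (simplex_map p (\<lambda>x. (x, 0)) (model_simplex p)) -
       frag_extend (prism_map d (p - 1) id) (chain_boundary p (frag_of (model_simplex p)))"
    using m(1) by (simp add: prism_model_def)
  have end_face: "simplex_map p ?g (simplex_map p (\<lambda>x. (x, t)) (model_simplex p)) = simplex_map p (\<lambda>x. h (x, t)) \<sigma>" for t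
    by (auto simp: simplex_map_def fun_eq_iff restrict_def)
  have side: "chain_map p ?g (frag_extend (prism_map d (p - 1) id) (chain_boundary p (frag_of (model_simplex p))))
      = frag_extend (prism_map d (p - 1) h) (chain_boundary p (frag_of \<sigma>))"
  proof (cases "p = 0")
    case True
    then show ?thesis by (simp add: chain_boundary_def)
  next
    case False
    then have p: "Suc (p - 1) = p" by simp
    have ch': "singular_chain (Suc (p-1)) (simplex_cylinder (p-1)) (d (p-1))"
      using m(2) False by (simp add: prism_model_def)
    have "chain_map p ?g (prism_map d (p - 1) id (singular_face p k (model_simplex p))) =
       prism_map d (p - 1) h (singular_face p k \<sigma>)" if "k \<le> p" for k
      using chain_map_prism_map[where q="p-1" and d=d, OF ch', of \<sigma> "singular_face p k (model_simplex p)" "singular_face p k \<sigma>" h]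
        that False p by (auto simp: singular_face_def simplical_face_in_standard_simplex)
    then show ?thesis using False
      by (simp add: chain_boundary_of frag_extend_sum chain_map_sum frag_extend_cmul o_def)
  qed
  have "chain_boundary (Suc p) (prism_map d p h \<sigma>) = chain_map p ?g (chain_boundary (Suc p) (d p))"
    unfolding prism_map_def using chain_boundary_chain_map[OF ch, of ?g] by simp
  also have "\<dots> = frag_of (simplex_map p (\<lambda>x. h (x, 1)) \<sigma>) - frag_of (simplex_map p (\<lambda>x. h (x, 0)) \<sigma>) -
    frag_extend (prism_map d (p - 1) h) (chain_boundary p (frag_of \<sigma>))"
    unfolding bd chain_map_diff side chain_map_of end_face ..
  finally show ?thesis .
qed

lemma chain_boundary_prism_extend:
  assumes m: "prism_model d p" "0 < p \<Longrightarrow> prism_model d (p - 1)"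
    and c: "singular_chain p X c" and h: "continuous_map (prod_topology X (top_of_set {0..1})) Y h"
  shows "chain_boundary (Suc p) (frag_extend (prism_map d p h) c) =
    chain_map p (\<lambda>x. h (x, 1)) c - chain_map p (\<lambda>x. h (x, 0)) c -
    frag_extend (prism_map d (p - 1) h) (chain_boundary p c)"
  using c unfolding singular_chain_def
proof (induction c rule: frag_induction)
  case (one x)
  then show ?case using chain_boundary_prism_map[OF m _ h, of x] by simp
next
  case (diff a b)
  then show ?case by (simp add: frag_extend_diff chain_boundary_diff chain_map_diff)
qed auto

text \<open>The right-hand side of the defining equation of \<open>d p\<close> is a cycle in the contractible cylinder
  once \<open>d (p - 1)\<close> has been chosen, hence a boundary.\<close>

lemma prism_model_step:
  assumes m: "0 < p \<Longrightarrow> prism_model d (p - 1)" "1 < p \<Longrightarrow> prism_model d (p - 2)"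
  shows "\<exists>e. prism_model (d(p := e)) p"
proof -
  let ?S = "subtopology (powertop_real UNIV) (standard_simplex p)"
  let ?i = "\<lambda>t x. (x, t)"
  define \<iota> where "\<iota> = frag_of (model_simplex p)"
  have \<iota>: "singular_chain p ?S \<iota>" unfolding \<iota>_def singular_chain_of by (rule singular_simplex_model)
  have cont: "continuous_map ?S (simplex_cylinder p) (?i t)" if "t \<in> {0..1}" for t
    using that unfolding simplex_cylinder_def continuous_map_pairwise
    by (auto simp: o_def id_def[symmetric] intro: continuous_map_from_subtopology)
  have hid: "continuous_map (prod_topology ?S (top_of_set {0..1})) (simplex_cylinder p) id"
    by (simp add: simplex_cylinder_def)
  define c where "c = chain_map p (?i 1) \<iota> - chain_map p (?i 0) \<iota> -
      frag_extend (prism_map d (p - 1) id) (chain_boundary p \<iota>)"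
  have "\<exists>e. singular_chain (Suc p) (simplex_cylinder p) e \<and> chain_boundary (Suc p) e = c"
  proof (cases "p = 0")
    case True
    \<comment> \<open>In degree zero not every cycle bounds; here the two ends of the cylinder are homotopic.\<close>
    have hom: "homotopic_with (\<lambda>h. True) ?S (simplex_cylinder p) (?i 0) (?i 1)"
      unfolding homotopic_with_def simplex_cylinder_def
      by (rule exI[of _ "\<lambda>u. (snd u, fst u)"])
         (auto simp: continuous_map_pairwise o_def intro: continuous_map_fst continuous_map_snd)
    have "singular_relcycle p ?S {} \<iota>" using \<iota> True by (simp add: singular_cycle chain_boundary_def)
    then have "homologous_rel p (simplex_cylinder p) {} (chain_map p (?i 1) \<iota>) (chain_map p (?i 0) \<iota>)"
      using homotopic_imp_homologous_rel_chain_maps[of "{}" "{}" ?S "simplex_cylinder p" "?i 0" "?i 1" p \<iota>] hom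
      by (simp add: homologous_rel_sym)
    then show ?thesis using True
      by (simp add: homologous_rel_def singular_boundary c_def chain_boundary_def)
  next
    case False
    have b: "singular_chain (p - 1) ?S (chain_boundary p \<iota>)"
      using singular_chain_boundary[OF \<iota>] by simp
    have pr: "singular_chain p (simplex_cylinder p) (frag_extend (prism_map d (p - 1) id) (chain_boundary p \<iota>))"
    proof (rule singular_chain_extend)
      fix \<sigma> assume "\<sigma> \<in> Poly_Mapping.keys (chain_boundary p \<iota>)"
      then have "singular_simplex (p - 1) ?S \<sigma>" using b by (auto simp: singular_chain_def)
      moreover have "singular_chain (Suc (p-1)) (simplex_cylinder (p-1)) (d (p-1))"
        using m(1) False by (simp add: prism_model_def)
      ultimately show "singular_chain p (simplex_cylinder p) (prism_map d (p - 1) id \<sigma>)"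
        using singular_chain_prism_map[of "p-1" d ?S \<sigma> "simplex_cylinder p" id] hid False by simp
    qed
    have cc: "singular_chain p (simplex_cylinder p) c"
      unfolding c_def using pr cont by (intro singular_chain_diff singular_chain_chain_map[OF \<iota>]) auto
    have pp: "p - Suc 0 - 1 = p - 2" "Suc (p - Suc 0) = p" using False by auto
    have "chain_boundary p (frag_extend (prism_map d (p - 1) id) (chain_boundary p \<iota>)) =
       chain_map (p-1) (?i 1) (chain_boundary p \<iota>) - chain_map (p-1) (?i 0) (chain_boundary p \<iota>)"
      using chain_boundary_prism_extend[of d "p-1" ?S "chain_boundary p \<iota>" "simplex_cylinder p" id, OF _ _ b hid] m False pp
        chain_boundary_boundary[OF \<iota>]
      by (simp add: numeral_2_eq_2)
    then have "chain_boundary p c = 0"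
      unfolding c_def by (simp add: chain_boundary_diff chain_boundary_chain_map[OF \<iota>])
    then show ?thesis
      using cycle_is_boundary_contractible[OF contractible_cylinder cc] False by auto
  qed
  then obtain e where e: "singular_chain (Suc p) (simplex_cylinder p) e" "chain_boundary (Suc p) e = c" by blast
  have "frag_extend (prism_map (d(p := e)) (p - 1) id) (chain_boundary p \<iota>) =
        frag_extend (prism_map d (p - 1) id) (chain_boundary p \<iota>)"
  proof (cases "p = 0")
    case True
    then show ?thesis by (simp add: chain_boundary_def)
  next
    case False
    then have "(d(p := e)) (p - 1) = d (p - 1)" by auto
    then show ?thesis unfolding prism_map_def[abs_def] by (simp only:)
  qed
  then have "prism_model (d(p := e)) p"
    using e unfolding prism_model_def c_def \<iota>_def by simp
  then show ?thesis by blast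
qed

lemma prism_model_cong:
  assumes "\<And>q. q \<le> p \<Longrightarrow> d q = d' q"
  shows "prism_model d p = prism_model d' p"
proof -
  have "d p = d' p" "d (p - 1) = d' (p - 1)" using assms by auto
  then show ?thesis by (simp add: prism_model_def prism_map_def[abs_def])
qed

text \<open>The chains are chosen one degree at a time. The condition in degree \<open>p\<close> only involves degrees \<open>p\<close> and
  \<open>p - 1\<close>, so it survives all later choices.\<close>

lemma prism_model_exists: "\<exists>d. \<forall>p. prism_model d p"
proof -
  have "\<exists>D. \<forall>n. (\<forall>p<n. prism_model (D n) p) \<and> (\<forall>p<n. D (Suc n) p = D n p)"
  proof (rule dependent_nat_choice)
    fix x n assume x: "\<forall>p<n. prism_model x p"
    obtain e where e: "prism_model (x(n := e)) n" using prism_model_step[of n x] x by auto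
    have "prism_model (x(n := e)) p" if "p < Suc n" for p
    proof (cases "p = n")
      case False
      then show ?thesis using x that prism_model_cong[of p x "x(n := e)"] by auto
    qed (use e in auto)
    then show "\<exists>y. (\<forall>p<Suc n. prism_model y p) \<and> (\<forall>p<n. y p = x p)"
      by (intro exI[of _ "x(n := e)"]) auto
  qed auto
  then obtain D where D: "\<And>n p. p < n \<Longrightarrow> prism_model (D n) p" "\<And>n p. p < n \<Longrightarrow> D (Suc n) p = D n p" by blast
  have stab: "D (Suc p + k) p = D (Suc p) p" for p k
    by (induction k) (auto simp: D(2))
  have "prism_model (\<lambda>p. D (Suc p) p) p" for p
  proof -
    have "D (Suc q) q = D (Suc p) q" if "q \<le> p" for q
      using stab[of q "p - q"] that by simp
    then show ?thesis using D(1)[of p "Suc p"] prism_model_cong[of p "\<lambda>p. D (Suc p) p" "D (Suc p)"] by simp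
  qed
  then show ?thesis by blast
qed

section \<open>Homotopy invariance with field coefficients\<close>

abbreviation scale_chain :: "'k::field \<Rightarrow> ('b \<Rightarrow>\<^sub>0 'k) \<Rightarrow> ('b \<Rightarrow>\<^sub>0 'k)" where
  "scale_chain a u \<equiv> Poly_Mapping.map ((*) a) u"

definition coeff_extend :: "('b \<Rightarrow> 'a \<Rightarrow>\<^sub>0 'k::field) \<Rightarrow> ('b \<Rightarrow>\<^sub>0 'k) \<Rightarrow> 'a \<Rightarrow>\<^sub>0 'k" where
  "coeff_extend F c = (\<Sum>f \<in> Poly_Mapping.keys c. scale_chain (Poly_Mapping.lookup c f) (F f))"

definition base_change :: "('b \<Rightarrow>\<^sub>0 int) \<Rightarrow> ('b \<Rightarrow>\<^sub>0 'k::field)" where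
  "base_change c = Poly_Mapping.map of_int c"

lemma lookup_scale_chain [simp]: "Poly_Mapping.lookup (scale_chain a u) x = a * Poly_Mapping.lookup u x"
  by transfer (simp add: when_def)

lemma lookup_base_change [simp]: "Poly_Mapping.lookup (base_change c) x = of_int (Poly_Mapping.lookup c x)"
  unfolding base_change_def by transfer (simp add: when_def)

lemma lookup_coeff_extend:
  assumes "finite A" "Poly_Mapping.keys c \<subseteq> A"
  shows "Poly_Mapping.lookup (coeff_extend F c) x = (\<Sum>f\<in>A. Poly_Mapping.lookup c f * Poly_Mapping.lookup (F f) x)"
  unfolding coeff_extend_def lookup_sum lookup_scale_chain
  by (rule sum.mono_neutral_left[OF assms]) (auto simp: in_keys_iff)

lemma scale_chain_0 [simp]: "scale_chain k 0 = 0"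
  by (rule poly_mapping_eqI) simp

lemma coeff_extend_0 [simp]: "coeff_extend F 0 = 0"
  by (simp add: coeff_extend_def)

lemma coeff_extend_add: "coeff_extend F (a + b) = coeff_extend F a + coeff_extend F b"
proof (rule poly_mapping_eqI)
  fix x
  let ?A = "Poly_Mapping.keys a \<union> Poly_Mapping.keys b"
  have "Poly_Mapping.keys (a + b) \<subseteq> ?A" by (rule keys_add)
  then show "Poly_Mapping.lookup (coeff_extend F (a + b)) x = Poly_Mapping.lookup (coeff_extend F a + coeff_extend F b) x"
    by (simp add: lookup_add lookup_coeff_extend[of ?A] distrib_right sum.distrib)
qed

lemma keys_scale_chain: "Poly_Mapping.keys (scale_chain a u) \<subseteq> Poly_Mapping.keys u"
  by (auto simp: in_keys_iff)

lemma coeff_extend_scale: "coeff_extend F (scale_chain k a) = scale_chain k (coeff_extend F a)"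
  by (rule poly_mapping_eqI)
     (simp add: lookup_coeff_extend[OF finite_keys keys_scale_chain] lookup_coeff_extend[OF finite_keys order_refl, of F a]
        sum_distrib_left mult_ac)

lemma coeff_extend_sum: "coeff_extend F (sum g I) = (\<Sum>i\<in>I. coeff_extend F (g i))"
  by (induction I rule: infinite_finite_induct) (auto simp: coeff_extend_add)

lemma coeff_extend_coeff_extend: "coeff_extend F (coeff_extend G c) = coeff_extend (\<lambda>f. coeff_extend F (G f)) c"
  by (simp only: coeff_extend_def[of G] coeff_extend_sum coeff_extend_scale) (simp add: coeff_extend_def)

lemma coeff_extend_cong:
  "(\<And>f. f \<in> Poly_Mapping.keys c \<Longrightarrow> F f = G f) \<Longrightarrow> coeff_extend F c = coeff_extend G c"
  unfolding coeff_extend_def by (rule sum.cong) auto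

lemma coeff_extend_diff_fun: "coeff_extend (\<lambda>f. F f - G f) c = coeff_extend F c - coeff_extend G c"
  by (rule poly_mapping_eqI)
     (simp add: lookup_minus lookup_coeff_extend[OF finite_keys order_refl] right_diff_distrib sum_subtractf)

lemma coeff_extend_single: "coeff_extend F (Poly_Mapping.single f 1) = F f"
  by (rule poly_mapping_eqI) (simp add: lookup_coeff_extend[of "{f}"])

lemma coeff_extend_id: "coeff_extend (\<lambda>f. Poly_Mapping.single f 1) c = c"
proof (rule poly_mapping_eqI)
  fix x
  have "Poly_Mapping.lookup (coeff_extend (\<lambda>f. Poly_Mapping.single f 1) c) x =
     (\<Sum>f\<in>insert x (Poly_Mapping.keys c). Poly_Mapping.lookup c f * (if f = x then 1 else 0))"
    by (subst lookup_coeff_extend[of "insert x (Poly_Mapping.keys c)"]) (auto simp: lookup_single when_def)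
  also have "\<dots> = Poly_Mapping.lookup c x"
    by (simp add: if_distrib[of "\<lambda>u. _ * u"] cong: if_cong)
  finally show "Poly_Mapping.lookup (coeff_extend (\<lambda>f. Poly_Mapping.single f 1) c) x = Poly_Mapping.lookup c x" .
qed

lemma base_change_0 [simp]: "base_change 0 = 0"
  by (rule poly_mapping_eqI) simp

lemma base_change_diff: "base_change (a - b) = base_change a - base_change b"
  by (rule poly_mapping_eqI) (simp add: lookup_minus)

lemma base_change_frag_of: "base_change (frag_of f) = Poly_Mapping.single f 1"
  by (rule poly_mapping_eqI) (simp add: lookup_single when_def)

lemma keys_base_change: "Poly_Mapping.keys (base_change c :: _ \<Rightarrow>\<^sub>0 'k::field) \<subseteq> Poly_Mapping.keys c"
  by (auto simp: in_keys_iff)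

lemma base_change_extend: "base_change (frag_extend F c) = coeff_extend (\<lambda>f. base_change (F f)) (base_change c)"
proof (rule poly_mapping_eqI)
  fix x
  show "Poly_Mapping.lookup (base_change (frag_extend F c)) x =
      Poly_Mapping.lookup (coeff_extend (\<lambda>f. base_change (F f)) (base_change c)) x"
    by (simp add: lookup_coeff_extend[OF finite_keys keys_base_change] frag_extend_def lookup_sum)
qed

text \<open>Over the field the boundary is the linear extension of the integral boundary of single simplices.
  Identities between integral chains therefore carry over simplex by simplex, although not every
  chain over the field comes from an integral one.\<close>

lemma coeff_boundary_eq_extend:
  fixes c :: "('a, 'k::field) coeff_chain"
  shows "coeff_boundary p c = coeff_extend (\<lambda>f. base_change (chain_boundary p (frag_of f))) c"
proof (cases "p = 0")
  case True
  then show ?thesis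
    by (simp add: coeff_boundary_def chain_boundary_def coeff_extend_def)
next
  case False
  have "scale_chain a (base_change (\<Sum>k\<le>p. frag_cmul ((-1) ^ k) (frag_of (singular_face p k f)))) =
     (\<Sum>k\<le>p. Poly_Mapping.single (singular_face p k f) ((-1) ^ k * a))" for a :: 'k and f :: "(nat \<Rightarrow> real) \<Rightarrow> 'a"
    by (rule poly_mapping_eqI)
       (auto simp: lookup_sum sum_distrib_left lookup_single when_def intro!: sum.cong)
  then show ?thesis using False
    by (simp add: coeff_boundary_def chain_boundary_of coeff_extend_def)
qed

lemma coeff_boundary_base_change: "coeff_boundary p (base_change c) = base_change (chain_boundary p c)"
proof -
  have "chain_boundary p c = frag_extend (\<lambda>f. chain_boundary p (frag_of f)) c"
    by (simp add: chain_boundary_def frag_extend_eq_0)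
  then show ?thesis by (simp add: coeff_boundary_eq_extend base_change_extend)
qed

definition coeff_map :: "nat \<Rightarrow> ('a \<Rightarrow> 'b) \<Rightarrow> ('a, 'k::field) coeff_chain \<Rightarrow> ('b, 'k) coeff_chain" where
  "coeff_map p g c = coeff_extend (\<lambda>f. Poly_Mapping.single (simplex_map p g f) 1) c"

lemma coeff_map_base_change: "coeff_map p g (base_change c) = base_change (chain_map p g c)"
  by (simp add: coeff_map_def chain_map_def base_change_extend base_change_frag_of o_def)

lemma coeff_boundary_coeff_map:
  assumes "c \<in> coeff_chains p X"
  shows "coeff_boundary p (coeff_map p g c) = coeff_map (p - 1) g (coeff_boundary p c)"
proof -
  have "coeff_boundary p (coeff_map p g c) =
      coeff_extend (\<lambda>f. base_change (chain_boundary p (chain_map p g (frag_of f)))) c"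
    by (simp add: coeff_map_def coeff_boundary_eq_extend coeff_extend_coeff_extend coeff_extend_single)
  also have "\<dots> = coeff_extend (\<lambda>f. base_change (chain_map (p - 1) g (chain_boundary p (frag_of f)))) c"
    by (intro coeff_extend_cong arg_cong[where f=base_change])
      (use assms in \<open>simp add: coeff_chains_def subset_iff singular_chain_of chain_boundary_chain_map[of p X] del: chain_map_of\<close>)
  also have "\<dots> = coeff_map (p - 1) g (coeff_boundary p c)"
    unfolding coeff_map_base_change[symmetric]
    by (simp add: coeff_map_def coeff_boundary_eq_extend coeff_extend_coeff_extend)
  finally show ?thesis .
qed

lemma coeff_extend_in_chains:
  assumes "\<And>f. f \<in> Poly_Mapping.keys c \<Longrightarrow> F f \<in> coeff_chains p X"
  shows "coeff_extend F c \<in> coeff_chains p X"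
proof -
  have "Poly_Mapping.keys (coeff_extend F c) \<subseteq> (\<Union>f\<in>Poly_Mapping.keys c. Poly_Mapping.keys (F f))"
    unfolding coeff_extend_def using keys_sum keys_scale_chain by (fastforce simp: subset_iff)
  then show ?thesis using assms unfolding coeff_chains_def by blast
qed

lemma coeff_map_in_chains:
  assumes "c \<in> coeff_chains p X" "continuous_map X Y g"
  shows "coeff_map p g c \<in> coeff_chains p Y"
  unfolding coeff_map_def using assms
  by (intro coeff_extend_in_chains) (auto simp: coeff_chains_def intro: singular_simplex_simplex_map)

lemma coeff_chains_add: "a \<in> coeff_chains p X \<Longrightarrow> b \<in> coeff_chains p X \<Longrightarrow> a + b \<in> coeff_chains p X"
  unfolding coeff_chains_def using keys_add[of a b] by blast

lemma coeff_chains_scale: "a \<in> coeff_chains p X \<Longrightarrow> scale_chain k a \<in> coeff_chains p X"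
  unfolding coeff_chains_def using keys_scale_chain[of k a] by blast

lemma coeff_boundary_add: "coeff_boundary p (a + b) = coeff_boundary p a + coeff_boundary p b"
  by (simp add: coeff_boundary_eq_extend coeff_extend_add)

lemma coeff_boundary_scale: "coeff_boundary p (scale_chain k a) = scale_chain k (coeff_boundary p a)"
  by (simp add: coeff_boundary_eq_extend coeff_extend_scale)

lemma coeff_map_add: "coeff_map p g (a + b) = coeff_map p g a + coeff_map p g b"
  by (simp add: coeff_map_def coeff_extend_add)

lemma coeff_map_scale: "coeff_map p g (scale_chain k a) = scale_chain k (coeff_map p g a)"
  by (simp add: coeff_map_def coeff_extend_scale)

lemma scale_chain_add: "scale_chain k (a + b) = scale_chain k a + scale_chain k b"
  by (rule poly_mapping_eqI) (simp add: lookup_add distrib_left)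

lemma scale_chain_minus_one: "scale_chain (-1) a = - a"
  by (rule poly_mapping_eqI) (simp add: lookup_uminus)

lemma coeff_boundaries_add:
  "a \<in> coeff_boundaries p X \<Longrightarrow> b \<in> coeff_boundaries p X \<Longrightarrow> a + b \<in> coeff_boundaries p X"
  unfolding coeff_boundaries_def image_iff
  by (metis coeff_boundary_add coeff_chains_add)

lemma coeff_boundaries_scale: "a \<in> coeff_boundaries p X \<Longrightarrow> scale_chain k a \<in> coeff_boundaries p X"
  unfolding coeff_boundaries_def image_iff
  by (metis coeff_boundary_scale coeff_chains_scale)

lemma coeff_boundaries_uminus: "a \<in> coeff_boundaries p X \<Longrightarrow> - a \<in> coeff_boundaries p X"
  using coeff_boundaries_scale[of a p X "-1"] by (simp add: scale_chain_minus_one)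

lemma coeff_boundaries_0: "0 \<in> coeff_boundaries p X"
proof -
  have "(0 :: ('a,'b::field) coeff_chain) \<in> coeff_chains (Suc p) X" by (simp add: coeff_chains_def)
  then show ?thesis unfolding coeff_boundaries_def
    by (rule rev_image_eqI) (simp add: coeff_boundary_eq_extend)
qed

lemma coeff_map_boundaries:
  assumes "b \<in> coeff_boundaries p X" "continuous_map X Y g"
  shows "coeff_map p g b \<in> coeff_boundaries p Y"
proof -
  obtain c where c: "c \<in> coeff_chains (Suc p) X" "b = coeff_boundary (Suc p) c"
    using assms(1) by (auto simp: coeff_boundaries_def)
  have "coeff_map p g b = coeff_boundary (Suc p) (coeff_map (Suc p) g c)"
    using coeff_boundary_coeff_map[OF c(1), of g] c(2) by simp
  then show ?thesis unfolding coeff_boundaries_def using coeff_map_in_chains[OF c(1) assms(2)] by blast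
qed

lemma coeff_map_cycles:
  assumes "c \<in> coeff_cycles p X" "continuous_map X Y g"
  shows "coeff_map p g c \<in> coeff_cycles p Y"
  using assms coeff_map_in_chains[of c p X Y g] coeff_boundary_coeff_map[of c p X g]
  by (auto simp: coeff_cycles_def coeff_map_def)

lemma coeff_map_compose: "coeff_map p (h \<circ> g) c = coeff_map p h (coeff_map p g c)"
  by (simp add: coeff_map_def coeff_extend_coeff_extend coeff_extend_single simplex_map_compose)

lemma coeff_map_id:
  assumes "c \<in> coeff_chains p X"
  shows "coeff_map p id c = c"
proof -
  have "coeff_map p id c = coeff_extend (\<lambda>f. Poly_Mapping.single f 1) c"
    unfolding coeff_map_def using assms
    by (intro coeff_extend_cong) (auto simp: coeff_chains_def subset_iff singular_simplex_def extensional_restrict)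
  then show ?thesis by (simp add: coeff_extend_id)
qed

text \<open>The integral prisms over the single simplices, extended linearly, form a chain homotopy between the
  two induced maps.\<close>

theorem homotopic_imp_coeff_homologous:
  fixes c :: "('a, 'k::field) coeff_chain"
  assumes hom: "homotopic_with (\<lambda>_. True) X Y f g" and c: "c \<in> coeff_cycles p X"
  shows "coeff_map p g c - coeff_map p f c \<in> coeff_boundaries p Y"
proof -
  obtain h where h: "continuous_map (prod_topology (top_of_set {0..1::real}) X) Y h"
    and h0: "\<And>x. h (0, x) = f x" and h1: "\<And>x. h (1, x) = g x"
    using hom by (fastforce simp: homotopic_with_def)
  define h' where "h' = (\<lambda>(x, t). h (t, x))"
  have h': "continuous_map (prod_topology X (top_of_set {0..1})) Y h'"
  proof -
    have "continuous_map (prod_topology X (top_of_set {0..1})) (prod_topology (top_of_set {0..1::real}) X) (\<lambda>u. (snd u, fst u))"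
      by (auto simp: continuous_map_pairwise o_def intro: continuous_map_fst continuous_map_snd)
    from continuous_map_compose[OF this h] show ?thesis by (simp add: h'_def o_def case_prod_unfold)
  qed
  obtain d where d: "\<And>p. prism_model d p" using prism_model_exists by blast
  define D :: "nat \<Rightarrow> ('a, 'k) coeff_chain \<Rightarrow> ('b, 'k) coeff_chain"
    where "D p = coeff_extend (\<lambda>f. base_change (prism_map d p h' f))" for p
  have cc: "c \<in> coeff_chains p X" and c0: "coeff_boundary p c = 0" using c by (auto simp: coeff_cycles_def)
  have s: "singular_simplex p X \<sigma>" if "\<sigma> \<in> Poly_Mapping.keys c" for \<sigma>
    using that cc by (auto simp: coeff_chains_def)
  have "D p c \<in> coeff_chains (Suc p) Y"
    unfolding D_def
  proof (rule coeff_extend_in_chains)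
    fix \<sigma> assume "\<sigma> \<in> Poly_Mapping.keys c"
    then have "singular_chain (Suc p) Y (prism_map d p h' \<sigma>)"
      using d[of p] by (intro singular_chain_prism_map[OF _ s h']) (auto simp: prism_model_def)
    then show "base_change (prism_map d p h' \<sigma>) \<in> coeff_chains (Suc p) Y"
      using keys_base_change[of "prism_map d p h' \<sigma>"] unfolding coeff_chains_def singular_chain_def by blast
  qed
  moreover have "coeff_boundary (Suc p) (D p c) = coeff_map p g c - coeff_map p f c"
  proof -
    have "coeff_boundary (Suc p) (D p c) = coeff_extend (\<lambda>\<sigma>. base_change (chain_boundary (Suc p) (prism_map d p h' \<sigma>))) c"
      unfolding D_def coeff_boundary_base_change[symmetric]
      by (simp add: coeff_boundary_eq_extend coeff_extend_coeff_extend)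
    also have "\<dots> = coeff_extend (\<lambda>\<sigma>. Poly_Mapping.single (simplex_map p g \<sigma>) 1 - Poly_Mapping.single (simplex_map p f \<sigma>) 1
        - D (p - 1) (base_change (chain_boundary p (frag_of \<sigma>)))) c"
    proof (rule coeff_extend_cong)
      fix \<sigma> assume "\<sigma> \<in> Poly_Mapping.keys c"
      from chain_boundary_prism_map[OF d d s[OF this] h']
      show "base_change (chain_boundary (Suc p) (prism_map d p h' \<sigma>)) =
          Poly_Mapping.single (simplex_map p g \<sigma>) 1 - Poly_Mapping.single (simplex_map p f \<sigma>) 1
        - D (p - 1) (base_change (chain_boundary p (frag_of \<sigma>)))"
        by (simp add: base_change_diff base_change_frag_of base_change_extend D_def h'_def h0 h1)
    qed
    also have "\<dots> = coeff_map p g c - coeff_map p f c - D (p - 1) (coeff_boundary p c)"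
      by (simp add: coeff_extend_diff_fun coeff_map_def D_def coeff_boundary_eq_extend coeff_extend_coeff_extend)
    finally show ?thesis using c0 by (simp add: D_def)
  qed
  ultimately show ?thesis unfolding coeff_boundaries_def by (metis imageI)
qed

text \<open>The boundaries are added because the image of a coset under \<open>coeff_map\<close> need not be a
  whole coset.\<close>

definition homology_map ::
  "nat \<Rightarrow> 'b topology \<Rightarrow> ('a \<Rightarrow> 'b) \<Rightarrow> ('a, 'k::field) coeff_chain set \<Rightarrow> ('b, 'k) coeff_chain set" where
  "homology_map p Y g U = {coeff_map p g u + b | u b. u \<in> U \<and> b \<in> coeff_boundaries p Y}"

abbreviation homology_coset :: "nat \<Rightarrow> 'a topology \<Rightarrow> ('a, 'k::field) coeff_chain \<Rightarrow> ('a, 'k) coeff_chain set" where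
  "homology_coset p X c \<equiv> (+) c ` coeff_boundaries p X"

lemma homology_coset_self: "a \<in> homology_coset p X a"
  using coeff_boundaries_0[of p X] by (metis add.right_neutral imageI)

lemma homology_map_coset:
  assumes "continuous_map X Y g"
  shows "homology_map p Y g (homology_coset p X c) = homology_coset p Y (coeff_map p g c)"
proof
  show "homology_map p Y g (homology_coset p X c) \<subseteq> homology_coset p Y (coeff_map p g c)"
  proof
    fix x assume "x \<in> homology_map p Y g (homology_coset p X c)"
    then obtain b b' where b: "b \<in> coeff_boundaries p X" "b' \<in> coeff_boundaries p Y"
      and x: "x = coeff_map p g (c + b) + b'" unfolding homology_map_def by auto
    have "coeff_map p g b + b' \<in> coeff_boundaries p Y"
      using coeff_map_boundaries[OF b(1) assms] b(2) by (rule coeff_boundaries_add)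
    then show "x \<in> homology_coset p Y (coeff_map p g c)" unfolding x coeff_map_add by (simp add: add.assoc)
  qed
  show "homology_coset p Y (coeff_map p g c) \<subseteq> homology_map p Y g (homology_coset p X c)"
    unfolding homology_map_def using homology_coset_self[of c p X] by blast
qed

lemma homology_coset_eq:
  assumes "c - c' \<in> coeff_boundaries p X"
  shows "homology_coset p X c = homology_coset p X c'"
proof -
  have *: "homology_coset p X c \<subseteq> homology_coset p X c'" if "c - c' \<in> coeff_boundaries p X" for c c'
  proof
    fix x assume "x \<in> homology_coset p X c"
    then obtain b where b: "b \<in> coeff_boundaries p X" "x = c + b" by auto
    then have "x = c' + ((c - c') + b)" by simp
    then show "x \<in> homology_coset p X c'" using coeff_boundaries_add[OF that b(1)] by blast
  qed
  show ?thesis using *[OF assms] *[of c' c] coeff_boundaries_uminus[OF assms] by simp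
qed

lemma homology_coset_add:
  "{u + v | u v. u \<in> homology_coset p X a \<and> v \<in> homology_coset p X b} = homology_coset p X (a + b)"
proof -
  have "\<exists>u v. a + b + x = u + v \<and> u \<in> homology_coset p X a \<and> v \<in> homology_coset p X b"
    if "x \<in> coeff_boundaries p X" for x
    by (rule exI[of _ "a + x"], rule exI[of _ b]) (use that homology_coset_self[of b p X] in \<open>auto simp: algebra_simps\<close>)
  moreover have "\<exists>z\<in>coeff_boundaries p X. a + x + (b + y) = a + b + z"
    if "x \<in> coeff_boundaries p X" "y \<in> coeff_boundaries p X" for x y
    by (rule bexI[of _ "x + y"]) (use that in \<open>auto simp: algebra_simps coeff_boundaries_add\<close>)
  ultimately show ?thesis by (auto simp: image_iff)
qed

lemma homology_coset_scale:
  "{scale_chain k u + b | u b. u \<in> homology_coset p X a \<and> b \<in> coeff_boundaries p X} = homology_coset p X (scale_chain k a)"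
proof -
  have "\<exists>u b. scale_chain k a + x = scale_chain k u + b \<and> u \<in> homology_coset p X a \<and> b \<in> coeff_boundaries p X"
    if "x \<in> coeff_boundaries p X" for x
    by (rule exI[of _ a], rule exI[of _ x]) (use that homology_coset_self[of a p X] in auto)
  moreover have "\<exists>z\<in>coeff_boundaries p X. scale_chain k (a + x) + y = scale_chain k a + z"
    if "x \<in> coeff_boundaries p X" "y \<in> coeff_boundaries p X" for x y
    by (rule bexI[of _ "scale_chain k x + y"])
      (use that in \<open>auto simp: scale_chain_add algebra_simps coeff_boundaries_add coeff_boundaries_scale\<close>)
  ultimately show ?thesis by (auto simp: image_iff)
qed

theorem homotopy_equivalent_imp_homology_isomorphic:
  assumes "X homotopy_equivalent_space Y"
  shows "linearly_isomorphic (homology_space TYPE('k::field) q X) (homology_space TYPE('k) q Y)"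
proof -
  obtain f g where f: "continuous_map X Y f" and g: "continuous_map Y X g"
    and gf: "homotopic_with (\<lambda>_. True) X X (g \<circ> f) id" and fg: "homotopic_with (\<lambda>_. True) Y Y (f \<circ> g) id"
    using assms unfolding homotopy_equivalent_space_def by blast
  let ?V = "homology_space TYPE('k) q X" and ?W = "homology_space TYPE('k) q Y"
  let ?h = "homology_map q Y f :: ('a, 'k) coeff_chain set \<Rightarrow> _"
  let ?k = "homology_map q X g :: ('b, 'k) coeff_chain set \<Rightarrow> _"
  have "bij_betw ?h (carrier ?V) (carrier ?W)"
  proof (rule bij_betwI[where g = ?k])
    show "?h \<in> carrier ?V \<rightarrow> carrier ?W"
      by (auto simp: homology_space_def homology_map_coset[OF f] intro: imageI coeff_map_cycles[OF _ f])
    show "?k \<in> carrier ?W \<rightarrow> carrier ?V"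
      by (auto simp: homology_space_def homology_map_coset[OF g] intro: imageI coeff_map_cycles[OF _ g])
    show "?k (?h U) = U" if U: "U \<in> carrier ?V" for U
    proof -
      obtain c where c: "c \<in> coeff_cycles q X" "U = homology_coset q X c"
        using U by (auto simp: homology_space_def)
      have cc: "coeff_map q id c = c" using c(1) coeff_map_id by (auto simp: coeff_cycles_def)
      have "?k (?h U) = homology_coset q X (coeff_map q (g \<circ> f) c)"
        by (simp add: c(2) homology_map_coset[OF f] homology_map_coset[OF g] coeff_map_compose)
      also have "\<dots> = U" unfolding c(2)
        using homotopic_imp_coeff_homologous[OF gf c(1)] cc by (intro homology_coset_eq[symmetric]) simp
      finally show ?thesis .
    qed
    show "?h (?k U) = U" if U: "U \<in> carrier ?W" for U
    proof -
      obtain c where c: "c \<in> coeff_cycles q Y" "U = homology_coset q Y c"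
        using U by (auto simp: homology_space_def)
      have cc: "coeff_map q id c = c" using c(1) coeff_map_id by (auto simp: coeff_cycles_def)
      have "?h (?k U) = homology_coset q Y (coeff_map q (f \<circ> g) c)"
        by (simp add: c(2) homology_map_coset[OF f] homology_map_coset[OF g] coeff_map_compose)
      also have "\<dots> = U" unfolding c(2)
        using homotopic_imp_coeff_homologous[OF fg c(1)] cc by (intro homology_coset_eq[symmetric]) simp
      finally show ?thesis .
    qed
  qed
  moreover have "?h (U \<oplus>\<^bsub>?V\<^esub> V) = ?h U \<oplus>\<^bsub>?W\<^esub> ?h V" if "U \<in> carrier ?V" "V \<in> carrier ?V" for U V
  proof -
    obtain a b where "U = homology_coset q X a" "V = homology_coset q X b"
      using \<open>U \<in> carrier ?V\<close> \<open>V \<in> carrier ?V\<close> by (auto simp: homology_space_def)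
    then show ?thesis
      by (simp only: homology_space_def ring.simps homology_coset_add homology_map_coset[OF f] coeff_map_add)
  qed
  moreover have "?h (a \<odot>\<^bsub>?V\<^esub> U) = a \<odot>\<^bsub>?W\<^esub> ?h U" if "U \<in> carrier ?V" for U a
  proof -
    obtain c where "U = homology_coset q X c"
      using \<open>U \<in> carrier ?V\<close> by (auto simp: homology_space_def)
    then show ?thesis
      by (simp only: homology_space_def module.simps homology_coset_scale homology_map_coset[OF f] coeff_map_scale)
  qed
  ultimately show ?thesis unfolding linearly_isomorphic_def by blast
qed

section \<open>Bounded midpoint-convex functions\<close>

text \<open>Let \<open>\<psi>\<close> be the function minus its chord over \<open>{x..y}\<close>. Reflecting the nearer end point in \<open>t\<close> shows that
  \<open>\<psi> t\<close> is at most half the supremum \<open>S\<close> of \<open>\<psi>\<close>, and \<open>S \<le> S / 2\<close> forces \<open>S \<le> 0\<close>; this is where boundedness is needed.\<close>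

lemma midpoint_convex_imp_convex_on:
  fixes \<phi> :: "real \<Rightarrow> real"
  assumes mid: "\<And>s t. 0 \<le> s \<Longrightarrow> 0 \<le> t \<Longrightarrow> \<phi> ((s + t) / 2) \<le> (\<phi> s + \<phi> t) / 2"
    and bdd: "\<And>t. 0 \<le> t \<Longrightarrow> \<phi> t \<le> B"
  shows "convex_on {0..} \<phi>"
proof (rule convex_on_linorderI)
  fix l x y :: real
  assume l: "0 < l" "l < 1" and xy: "x \<in> {0..}" "y \<in> {0..}" "x < y"
  define k where "k = (\<phi> y - \<phi> x) / (y - x)"
  define L where "L = (\<lambda>t. \<phi> x + (t - x) * k)"
  define \<psi> where "\<psi> = (\<lambda>t. \<phi> t - L t)"
  have L2: "L ((s + t) / 2) = (L s + L t) / 2" for s t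
    by (simp add: L_def algebra_simps)
  have mid': "\<psi> ((s + t) / 2) \<le> (\<psi> s + \<psi> t) / 2" if "0 \<le> s" "0 \<le> t" for s t
    using mid[OF that] L2[of s t] by (simp add: \<psi>_def field_simps)
  have ends: "\<psi> x = 0" "\<psi> y = 0" using xy by (auto simp: \<psi>_def L_def k_def)
  have bd: "\<psi> t \<le> B + \<bar>\<phi> x\<bar> + \<bar>\<phi> y - \<phi> x\<bar>" if "t \<in> {x..y}" for t
  proof -
    have "0 \<le> (t - x) / (y - x)" "(t - x) / (y - x) \<le> 1" using that xy by auto
    then have "\<bar>(t - x) / (y - x) * (\<phi> y - \<phi> x)\<bar> \<le> 1 * \<bar>\<phi> y - \<phi> x\<bar>"
      unfolding abs_mult using that xy by (intro mult_right_mono) auto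
    moreover have "(t - x) / (y - x) * (\<phi> y - \<phi> x) = (t - x) * k" by (simp add: k_def)
    ultimately have "\<bar>(t - x) * k\<bar> \<le> \<bar>\<phi> y - \<phi> x\<bar>" by (simp only: mult_1)
    then show ?thesis using bdd[of t] that xy by (auto simp: \<psi>_def L_def)
  qed
  have bdd': "bdd_above (\<psi> ` {x..y})" using bd by (rule bdd_aboveI2)
  define S where "S = (SUP t\<in>{x..y}. \<psi> t)"
  have le: "\<psi> t \<le> S" if "t \<in> {x..y}" for t unfolding S_def by (rule cSUP_upper[OF that bdd'])
  have "\<psi> t \<le> S / 2" if t: "t \<in> {x..y}" for t
  proof (cases "t \<le> (x + y) / 2")
    case True
    then have "2 * t - x \<in> {x..y}" using t by auto
    then show ?thesis using mid'[of x "2 * t - x"] le[of "2 * t - x"] ends t xy by simp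
  next
    case False
    then have "2 * t - y \<in> {x..y}" using t by auto
    then show ?thesis using mid'[of y "2 * t - y"] le[of "2 * t - y"] ends t xy by simp
  qed
  then have "S \<le> S / 2" unfolding S_def using xy by (intro cSUP_least) auto
  then have nonpos: "\<psi> t \<le> 0" if "t \<in> {x..y}" for t using le[OF that] by simp
  have m: "(1 - l) * x + l * y - x = l * (y - x)" by (simp add: algebra_simps)
  have "(1 - l) * x + l * y \<in> {x..y}"
  proof -
    have "0 \<le> l * (y - x)" "l * (y - x) \<le> 1 * (y - x)" using l xy by (auto intro: mult_right_mono)
    then show ?thesis using m by simp
  qed
  then show "\<phi> ((1 - l) *\<^sub>R x + l *\<^sub>R y) \<le> (1 - l) * \<phi> x + l * \<phi> y"
  proof -
    have "(y - x) * k = \<phi> y - \<phi> x" using xy by (simp add: k_def)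
    then have "L ((1 - l) * x + l * y) = \<phi> x + l * (\<phi> y - \<phi> x)" unfolding L_def m by (simp add: mult.assoc)
    then show ?thesis using nonpos[OF \<open>(1 - l) * x + l * y \<in> {x..y}\<close>] by (simp add: \<psi>_def algebra_simps)
  qed
qed auto

lemma convex_chord_slopes:
  fixes \<phi> :: "real \<Rightarrow> real"
  assumes "convex_on {0..} \<phi>" and "0 < h" "0 < t" "h \<le> a"
  shows "(\<phi> a - \<phi> (a + t)) / t \<le> (\<phi> 0 - \<phi> h) / h"
proof -
  have sl: "(\<phi> x - \<phi> u) / (x - u) \<le> (\<phi> u - \<phi> y) / (u - y)" if "0 \<le> x" "x < u" "u < y" for x u y
    using convex_on_slope_le[OF assms(1), of x y u] that by auto
  have "(\<phi> 0 - \<phi> h) / (0 - h) \<le> (\<phi> a - \<phi> (a + t)) / (a - (a + t))"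
  proof (cases "h = a")
    case True
    then show ?thesis using sl[of 0 h "h + t"] assms by simp
  next
    case False
    then show ?thesis using sl[of 0 h a] sl[of h a "a + t"] assms by simp
  qed
  then show ?thesis using assms by (simp add: field_simps)
qed

lemma convex_initial_slope_antimono:
  fixes \<phi> :: "real \<Rightarrow> real"
  assumes "convex_on {0..} \<phi>" and "0 < s" "s \<le> t"
  shows "(\<phi> 0 - \<phi> t) / t \<le> (\<phi> 0 - \<phi> s) / s"
proof (cases "s = t")
  case False
  then have "(\<phi> 0 - \<phi> s) / (0 - s) \<le> (\<phi> 0 - \<phi> t) / (0 - t)"
    using convex_on_slope_le(1)[OF assms(1), of 0 t s] assms by simp
  then show ?thesis using assms by (simp add: field_simps)
qed simp

lemma antimono_bounded_tendsto_at_right_0: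
  fixes E :: "real \<Rightarrow> real"
  assumes anti: "\<And>s t. 0 < s \<Longrightarrow> s \<le> t \<Longrightarrow> E t \<le> E s" and bdd: "\<And>t. 0 < t \<Longrightarrow> E t \<le> K"
  shows "\<exists>l\<le>K. (E \<longlongrightarrow> l) (at_right 0) \<and> (\<forall>t>0. E t \<le> l)"
proof -
  define l where "l = (SUP t\<in>{0<..}. E t)"
  have bd: "bdd_above (E ` {0<..})" using bdd by (intro bdd_aboveI2[where M = K]) auto
  have le: "E t \<le> l" if "0 < t" for t unfolding l_def using that by (intro cSUP_upper bd) auto
  have "l \<le> K" unfolding l_def using bdd by (intro cSUP_least) auto
  moreover have "(E \<longlongrightarrow> l) (at_right 0)"
  proof (rule order_tendstoI)
    fix a assume "a < l"
    then obtain t where t: "0 < t" "a < E t" unfolding l_def using less_cSUP_iff[OF _ bd] by auto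
    have "a < E s" if "0 < s" "s < t" for s using anti[of s t] t that by simp
    then show "\<forall>\<^sub>F s in at_right 0. a < E s"
      unfolding eventually_at_right_field using t by (intro exI[of _ t]) auto
  next
    fix a assume "l < a"
    then have "E s < a" if "0 < s" for s using le[OF that] by simp
    then show "\<forall>\<^sub>F s in at_right 0. E s < a"
      unfolding eventually_at_right_field by (intro exI[of _ 1]) auto
  qed
  ultimately show ?thesis using le by blast
qed

section \<open>Square-integrable functions\<close>

text \<open>Functions, not classes, over an arbitrary measure: the Cauchy-Schwarz inequality is used both for the
  normalised measure and for Lebesgue measure on boxes.\<close>

definition sqint :: "'a measure \<Rightarrow> ('a \<Rightarrow> real) set" where
  "sqint N = {f \<in> borel_measurable N. integrable N (\<lambda>x. (f x)\<^sup>2)}"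

definition ip :: "'a measure \<Rightarrow> ('a \<Rightarrow> real) \<Rightarrow> ('a \<Rightarrow> real) \<Rightarrow> real" where
  "ip N f g = (\<integral>x. f x * g x \<partial>N)"

lemma sqint_measurable [measurable_dest]: "f \<in> sqint N \<Longrightarrow> f \<in> borel_measurable N"
  by (simp add: sqint_def)

lemma sqint_integrable_square: "f \<in> sqint N \<Longrightarrow> integrable N (\<lambda>x. (f x)\<^sup>2)"
  by (simp add: sqint_def)

lemma abs_mult_le_squares: "\<bar>a * b\<bar> \<le> a\<^sup>2 + (b::real)\<^sup>2"
proof -
  have "0 \<le> (\<bar>a\<bar> - \<bar>b\<bar>)\<^sup>2" by simp
  moreover have "0 \<le> \<bar>a\<bar> * \<bar>b\<bar>" by simp
  ultimately show ?thesis unfolding power2_diff abs_mult power2_abs by linarith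
qed

lemma sqint_integrable_mult:
  assumes "f \<in> sqint N" "g \<in> sqint N"
  shows "integrable N (\<lambda>x. f x * g x)"
proof (rule Bochner_Integration.integrable_bound)
  show "integrable N (\<lambda>x. (f x)\<^sup>2 + (g x)\<^sup>2)"
    using assms by (intro Bochner_Integration.integrable_add sqint_integrable_square)
  show "(\<lambda>x. f x * g x) \<in> borel_measurable N" using assms by measurable
  show "AE x in N. norm (f x * g x) \<le> norm ((f x)\<^sup>2 + (g x)\<^sup>2)"
    by (intro AE_I2) (simp add: order_trans[OF abs_mult_le_squares])
qed

lemma sqint_scale: "f \<in> sqint N \<Longrightarrow> (\<lambda>x. c * f x) \<in> sqint N"
  unfolding sqint_def by (auto simp: power_mult_distrib)

lemma sqint_add:
  assumes "f \<in> sqint N" "g \<in> sqint N" shows "(\<lambda>x. f x + g x) \<in> sqint N"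
proof -
  have "integrable N (\<lambda>x. (f x)\<^sup>2 + (g x)\<^sup>2 + 2 * (f x * g x))"
    using assms by (intro Bochner_Integration.integrable_add integrable_mult_right sqint_integrable_square sqint_integrable_mult)
  moreover have "(\<lambda>x. f x + g x) \<in> borel_measurable N" using assms by measurable
  ultimately show ?thesis by (simp add: sqint_def power2_sum mult.assoc)
qed

lemma sqint_diff:
  assumes "f \<in> sqint N" "g \<in> sqint N" shows "(\<lambda>x. f x - g x) \<in> sqint N"
  using sqint_add[OF assms(1) sqint_scale[OF assms(2), of "-1"]] by simp

lemma sqint_indicator_mult:
  assumes "f \<in> sqint N" "A \<in> sets N" shows "(\<lambda>x. indicator A x * f x) \<in> sqint N"
proof -
  have "integrable N (\<lambda>x. indicator A x *\<^sub>R (f x)\<^sup>2)"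
    using assms by (intro integrable_mult_indicator sqint_integrable_square)
  moreover have "(indicator A x * f x)\<^sup>2 = indicator A x *\<^sub>R (f x)\<^sup>2" for x by (simp add: indicator_def)
  moreover have "(\<lambda>x. indicator A x * f x) \<in> borel_measurable N" using assms by measurable
  ultimately show ?thesis by (simp add: sqint_def)
qed

lemma ip_commute: "ip N f g = ip N g f"
  by (simp add: ip_def mult.commute)

lemma ip_nonneg: "0 \<le> ip N f f"
  unfolding ip_def by (intro integral_nonneg_AE) auto

lemma ip_add_left: "f \<in> sqint N \<Longrightarrow> g \<in> sqint N \<Longrightarrow> h \<in> sqint N \<Longrightarrow>
    ip N (\<lambda>x. f x + g x) h = ip N f h + ip N g h"
  by (simp add: ip_def distrib_right sqint_integrable_mult)

lemma ip_diff_left: "f \<in> sqint N \<Longrightarrow> g \<in> sqint N \<Longrightarrow> h \<in> sqint N \<Longrightarrow>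
    ip N (\<lambda>x. f x - g x) h = ip N f h - ip N g h"
  by (simp add: ip_def left_diff_distrib sqint_integrable_mult)

lemma ip_diff_diff:
  assumes "f \<in> sqint N" "g \<in> sqint N"
  shows "ip N (\<lambda>x. f x - g x) (\<lambda>x. f x - g x) = ip N f f - 2 * ip N f g + ip N g g"
  using assms ip_commute[of N f "\<lambda>x. f x - g x"] ip_commute[of N g "\<lambda>x. f x - g x"] ip_commute[of N g f]
  by (simp add: ip_diff_left sqint_diff)

lemma ip_add_le:
  assumes "f \<in> sqint N" "g \<in> sqint N"
  shows "ip N (\<lambda>x. f x + g x) (\<lambda>x. f x + g x) \<le> 2 * ip N f f + 2 * ip N g g"
proof -
  have "ip N (\<lambda>x. f x + g x) (\<lambda>x. f x + g x) = ip N f f + 2 * ip N f g + ip N g g"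
    using assms ip_commute[of N f "\<lambda>x. f x + g x"] ip_commute[of N g "\<lambda>x. f x + g x"] ip_commute[of N g f]
    by (simp add: ip_add_left sqint_add)
  moreover have "0 \<le> ip N f f - 2 * ip N f g + ip N g g"
    using ip_nonneg[of N "\<lambda>x. f x - g x"] ip_diff_diff[OF assms] by simp
  ultimately show ?thesis by simp
qed

lemma ip_Cauchy_Schwarz:
  assumes "f \<in> sqint N" "g \<in> sqint N"
  shows "(ip N f g)\<^sup>2 \<le> ip N f f * ip N g g"
proof -
  have quad: "0 \<le> ip N f f - 2 * c * ip N f g + c\<^sup>2 * ip N g g" for c
  proof -
    have "ip N f (\<lambda>x. c * g x) = c * ip N f g" "ip N (\<lambda>x. c * g x) (\<lambda>x. c * g x) = c\<^sup>2 * ip N g g"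
      by (simp_all add: ip_def mult_ac power2_eq_square flip: integral_mult_right_zero)
    then show ?thesis
      using ip_nonneg[of N "\<lambda>x. f x - c * g x"] ip_diff_diff[OF assms(1) sqint_scale[OF assms(2), of c]] by simp
  qed
  show ?thesis
  proof (cases "ip N g g = 0")
    case True
    have "ip N f g = 0"
    proof (rule ccontr)
      assume "ip N f g \<noteq> 0"
      then show False using quad[of "(ip N f f + 1) / (2 * ip N f g)"] True by simp
    qed
    then show ?thesis using True by simp
  next
    case False
    then have "0 < ip N g g" using ip_nonneg[of N g] by simp
    then show ?thesis using quad[of "ip N f g / ip N g g"] by (simp add: power2_eq_square field_simps)
  qed
qed

lemma (in prob_space) sqint_const: "(\<lambda>x. c) \<in> sqint M"
  by (simp add: sqint_def)

lemma (in prob_space) sqint_integrable: "f \<in> sqint M \<Longrightarrow> integrable M f"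
  using sqint_integrable_mult[OF _ sqint_const, of f 1] by simp

lemma (in prob_space) ip_const: "ip M (\<lambda>x. c) (\<lambda>x. c) = c\<^sup>2"
  by (simp add: ip_def prob_space power2_eq_square)

lemma (in prob_space) square_integral_le:
  assumes "f \<in> sqint M" shows "(\<integral>x. f x \<partial>M)\<^sup>2 \<le> ip M f f"
  using ip_Cauchy_Schwarz[OF assms sqint_const[of 1]] by (simp add: ip_const ip_def[of M f "\<lambda>x. 1"])

section \<open>Normalised Lebesgue measure\<close>

locale body =
  fixes M :: "'a::euclidean_space set"
  assumes compact_M: "compact M" and interior_nonempty: "interior M \<noteq> {}"
begin

abbreviation "N \<equiv> norm_lebesgue M"

definition V :: real where "V = measure lborel M"

lemma M_borel [measurable]: "M \<in> sets borel"
  using compact_M by (simp add: borel_compact)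

lemma emeasure_M_finite: "emeasure lborel M < \<infinity>"
  using emeasure_lborel_cbox_finite bounded_subset_cbox_symmetric[OF compact_imp_bounded[OF compact_M]]
  by (metis emeasure_mono sets_lborel borel_closed closed_cbox order_le_less_trans)

lemma emeasure_M: "emeasure lborel M = ennreal V" 
  using emeasure_M_finite by (simp add: V_def emeasure_eq_ennreal_measure)

lemma V_pos: "0 < V"
proof -
  obtain x e where e: "0 < e" "ball x e \<subseteq> interior M"
    using interior_nonempty open_interior by (meson all_not_in_conv open_contains_ball)
  have "0 < measure lborel (ball x e)" using content_ball_pos[of e x] e by (simp add: measure_completion)
  also have "\<dots> \<le> V"
    unfolding V_def using e interior_subset emeasure_M_finite
    by (intro measure_mono_fmeasurable) (auto simp: fmeasurable_def)
  finally show ?thesis .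
qed

lemma space_N: "space N = M"
  by (simp add: norm_lebesgue_def space_restrict_space)

lemma sets_N: "sets N = sets (restrict_space borel M)"
  unfolding norm_lebesgue_def sets_uniform_measure by (intro sets_restrict_space_cong) simp

lemma N_density: "N = density (restrict_space lborel M) (\<lambda>x. ennreal (1 / V))"
  unfolding norm_lebesgue_def uniform_measure_def
proof (rule density_cong)
  show "AE x in restrict_space lborel M. indicator M x / emeasure (restrict_space lborel M) M = ennreal (1 / V)"
    using V_pos by (intro AE_I2) (auto simp: space_restrict_space emeasure_restrict_space emeasure_M divide_ennreal simp flip: ennreal_1)
  have "M \<in> sets (restrict_space lborel M)" by (simp add: sets_restrict_space) (metis M_borel Int_absorb image_eqI)
  then show "(\<lambda>x. indicator M x / emeasure (restrict_space lborel M) M) \<in> borel_measurable (restrict_space lborel M)"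
    by measurable
qed simp

lemma prob_space_N: "prob_space N"
  unfolding norm_lebesgue_def using V_pos
  by (intro prob_space_uniform_measure) (auto simp: emeasure_restrict_space emeasure_M)

lemma measurable_N: "f \<in> borel_measurable N \<longleftrightarrow> f \<in> borel_measurable (restrict_space lborel M)"
proof -
  have "sets N = sets (restrict_space lborel M)" by (simp add: norm_lebesgue_def)
  from measurable_cong_sets[OF this refl] show ?thesis by (rule arg_cong)
qed

lemma integrable_N:
  fixes f :: "'a \<Rightarrow> 'b::{banach, second_countable_topology}"
  shows "integrable N f \<longleftrightarrow> set_integrable lborel M f"
proof -
  have "integrable N f \<longleftrightarrow> integrable (restrict_space lborel M) f" if "f \<in> borel_measurable N"
  proof -
    have "integrable N f \<longleftrightarrow> integrable (restrict_space lborel M) (\<lambda>x. (1 / V) *\<^sub>R f x)"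
      using that[unfolded measurable_N] V_pos unfolding N_density by (subst integrable_density) auto
    moreover have "integrable (restrict_space lborel M) f"
      if "integrable (restrict_space lborel M) (\<lambda>x. (1 / V) *\<^sub>R f x)"
      using integrable_scaleR_right[OF that, of V] V_pos by simp
    ultimately show ?thesis by auto
  qed
  moreover have "f \<in> borel_measurable N" if "integrable (restrict_space lborel M) f"
    using that unfolding measurable_N by measurable
  moreover have "integrable (restrict_space lborel M) f \<longleftrightarrow> set_integrable lborel M f"
    unfolding set_integrable_def by (rule integrable_restrict_space) simp
  ultimately show ?thesis using borel_measurable_integrable by blast
qed

lemma integral_N:
  fixes f :: "'a \<Rightarrow> 'b::{banach, second_countable_topology}"
  assumes "f \<in> borel_measurable N"
  shows "(\<integral>x. f x \<partial>N) = (1 / V) *\<^sub>R (LINT x:M|lborel. f x)"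
proof -
  have "(\<integral>x. f x \<partial>N) = (\<integral>x. (1 / V) *\<^sub>R f x \<partial>restrict_space lborel M)"
    using assms[unfolded measurable_N] V_pos unfolding N_density by (subst integral_density) auto
  also have "\<dots> = (1 / V) *\<^sub>R (\<integral>x. f x \<partial>restrict_space lborel M)" by simp
  also have "(\<integral>x. f x \<partial>restrict_space lborel M) = (LINT x:M|lborel. f x)"
    unfolding set_lebesgue_integral_def by (rule integral_restrict_space) simp
  finally show ?thesis .
qed

lemma interior_sets_N: "interior M \<in> sets N"
  unfolding sets_N sets_restrict_space using interior_subset[of M]
  by (intro image_eqI[of _ _ "interior M"]) (auto simp: borel_open)

lemma integrable_interior:
  fixes f :: "'a \<Rightarrow> 'b::{banach, second_countable_topology}"
  assumes "integrable N f"
  shows "set_integrable lborel (interior M) f"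
  using set_integrable_subset[OF assms[unfolded integrable_N], of "interior M"] interior_subset[of M]
  by (simp add: borel_open)

lemma integral_interior_le:
  fixes f :: "'a \<Rightarrow> real"
  assumes f: "integrable N f" and nn: "\<And>x. 0 \<le> f x"
  shows "(LINT x:interior M|lborel. f x) \<le> V * (\<integral>x. f x \<partial>N)"
proof -
  have "(LINT x:interior M|lborel. f x) \<le> (LINT x:M|lborel. f x)"
    unfolding set_lebesgue_integral_def
    using f[unfolded integrable_N] integrable_interior[OF f] interior_subset[of M] nn
    by (intro integral_mono) (auto simp: set_integrable_def indicator_def)
  also have "\<dots> = V * (\<integral>x. f x \<partial>N)"
    using integral_N[of f] f V_pos by auto
  finally show ?thesis .
qed

lemma set_integral_interior_N:
  fixes f :: "'a \<Rightarrow> real"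
  assumes "f \<in> borel_measurable N"
  shows "(LINT x:interior M|N. f x) = (LINT x:interior M|lborel. f x) / V"
proof -
  have "(\<lambda>x. indicator M x * (indicator (interior M) x * f x)) = (\<lambda>x. indicator (interior M) x * f x)"
    using interior_subset[of M] by (auto simp: indicator_def fun_eq_iff)
  moreover have "(\<lambda>x. indicator (interior M) x *\<^sub>R f x) \<in> borel_measurable N"
    using assms interior_sets_N by measurable
  ultimately show ?thesis
    unfolding set_lebesgue_integral_def by (simp add: integral_N set_lebesgue_integral_def)
qed

end

section \<open>Symmetric Markov kernels\<close>

locale symmetric_markov_kernel = prob_space N for N :: "'a measure" +
  fixes p :: "real \<Rightarrow> 'a \<Rightarrow> 'a \<Rightarrow> real"
  assumes kernel_measurable: "0 < t \<Longrightarrow> (\<lambda>(x, y). p t x y) \<in> borel_measurable (N \<Otimes>\<^sub>M N)"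
    and kernel_nonneg: "0 < t \<Longrightarrow> x \<in> space N \<Longrightarrow> y \<in> space N \<Longrightarrow> 0 \<le> p t x y"
    and kernel_sym: "0 < t \<Longrightarrow> x \<in> space N \<Longrightarrow> y \<in> space N \<Longrightarrow> p t x y = p t y x"
    and kernel_mass: "0 < t \<Longrightarrow> x \<in> space N \<Longrightarrow> (\<integral>\<^sup>+y. ennreal (p t x y) \<partial>N) = 1"
    and kernel_semigroup: "0 < s \<Longrightarrow> 0 < t \<Longrightarrow> x \<in> space N \<Longrightarrow> y \<in> space N \<Longrightarrow>
      ennreal (p (s + t) x y) = (\<integral>\<^sup>+w. ennreal (p s x w) * ennreal (p t w y) \<partial>N)"
begin

sublocale pair: pair_sigma_finite N N ..

definition K :: "real \<Rightarrow> ('a \<Rightarrow> real) \<Rightarrow> 'a \<Rightarrow> real" where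
  "K t f x = (\<integral>y. p t x y * f y \<partial>N)"

lemma kernel_measurable2: "0 < t \<Longrightarrow> x \<in> space N \<Longrightarrow> (\<lambda>y. p t x y) \<in> borel_measurable N"
  using measurable_compose[OF measurable_Pair1' kernel_measurable] by simp

lemma kernel_integrable: "0 < t \<Longrightarrow> x \<in> space N \<Longrightarrow> integrable N (\<lambda>y. p t x y)"
  using kernel_nonneg kernel_mass[of t x]
  by (intro integrableI_nonneg kernel_measurable2 AE_I2) auto

lemma kernel_integral: "0 < t \<Longrightarrow> x \<in> space N \<Longrightarrow> (\<integral>y. p t x y \<partial>N) = 1"
  using kernel_mass[of t x] nn_integral_eq_integral[OF kernel_integrable, of t x] kernel_nonneg
  by (subst integral_eq_nn_integral) (auto intro: kernel_measurable2)

text \<open>By symmetry and the semigroup property the square of \<open>p t x\<close> integrates to \<open>p (2 * t) x x\<close>. Hence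
  \<open>K t f x\<close> is a convergent integral for square-integrable \<open>f\<close> at every point \<open>x\<close>, not only almost everywhere.\<close>

lemma kernel_sqint:
  assumes t: "0 < t" and x: "x \<in> space N"
  shows "(\<lambda>y. p t x y) \<in> sqint N"
proof -
  have "(\<integral>\<^sup>+y. ennreal ((p t x y)\<^sup>2) \<partial>N) = (\<integral>\<^sup>+y. ennreal (p t x y) * ennreal (p t y x) \<partial>N)"
    using t x kernel_nonneg kernel_sym
    by (intro nn_integral_cong) (auto simp: power2_eq_square ennreal_mult)
  also have "\<dots> < \<infinity>"
    using kernel_semigroup[of t t x x] t x by (metis ennreal_less_top infinity_ennreal_def)
  finally show ?thesis
    unfolding sqint_def using kernel_measurable2[OF t x] by (auto intro!: integrableI_nonneg)
qed

lemma K_integrable: "0 < t \<Longrightarrow> x \<in> space N \<Longrightarrow> f \<in> sqint N \<Longrightarrow> integrable N (\<lambda>y. p t x y * f y)"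
  by (rule sqint_integrable_mult[OF kernel_sqint])

lemma kernel_mult_measurable:
  assumes "0 < t" and [measurable]: "f \<in> borel_measurable N"
  shows "(\<lambda>(x, y). p t x y * f y) \<in> borel_measurable (N \<Otimes>\<^sub>M N)"
proof -
  note [measurable] = kernel_measurable[OF assms(1)]
  have "(\<lambda>z. (case z of (x, y) \<Rightarrow> p t x y) * f (snd z)) \<in> borel_measurable (N \<Otimes>\<^sub>M N)"
    by measurable
  then show ?thesis by (simp add: case_prod_unfold)
qed

lemma K_measurable:
  assumes "0 < t" "f \<in> borel_measurable N"
  shows "K t f \<in> borel_measurable N"
  unfolding K_def[abs_def] using kernel_mult_measurable[OF assms] by (rule borel_measurable_lebesgue_integral)

lemma kernel_square_integrable_pair:
  assumes t: "0 < t" and f: "f \<in> sqint N"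
  shows "integrable (N \<Otimes>\<^sub>M N) (\<lambda>(x, y). p t x y * (f y)\<^sup>2)"
proof (rule integrableI_bounded)
  have fm: "(\<lambda>y. (f y)\<^sup>2) \<in> borel_measurable N" using f by measurable
  show m: "(\<lambda>(x, y). p t x y * (f y)\<^sup>2) \<in> borel_measurable (N \<Otimes>\<^sub>M N)"
    using kernel_mult_measurable[OF t fm] .
  have "(\<integral>\<^sup>+z. ennreal (norm (case z of (x, y) \<Rightarrow> p t x y * (f y)\<^sup>2)) \<partial>(N \<Otimes>\<^sub>M N)) =
      (\<integral>\<^sup>+y. (\<integral>\<^sup>+x. ennreal (norm (p t x y * (f y)\<^sup>2)) \<partial>N) \<partial>N)"
    using m by (subst pair.nn_integral_snd[symmetric]) (auto intro: measurable_compose[OF _ measurable_ennreal])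
  also have "\<dots> = (\<integral>\<^sup>+y. ennreal ((f y)\<^sup>2) \<partial>N)"
  proof (rule nn_integral_cong)
    fix y assume y: "y \<in> space N"
    have "(\<integral>\<^sup>+x. ennreal (norm (p t x y * (f y)\<^sup>2)) \<partial>N) = (\<integral>\<^sup>+x. ennreal (p t y x) * ennreal ((f y)\<^sup>2) \<partial>N)"
      using t y kernel_nonneg kernel_sym by (intro nn_integral_cong) (auto simp: abs_mult ennreal_mult)
    also have "\<dots> = ennreal ((f y)\<^sup>2)"
      using kernel_mass[OF t y] kernel_measurable2[OF t y] by (subst nn_integral_multc) auto
    finally show "(\<integral>\<^sup>+x. ennreal (norm (p t x y * (f y)\<^sup>2)) \<partial>N) = ennreal ((f y)\<^sup>2)" .
  qed
  also have "\<dots> < \<infinity>"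
    using f by (subst nn_integral_eq_integral) (auto simp: sqint_def)
  finally show "(\<integral>\<^sup>+z. ennreal (norm (case z of (x, y) \<Rightarrow> p t x y * (f y)\<^sup>2)) \<partial>(N \<Otimes>\<^sub>M N)) < \<infinity>" .
qed

lemma kernel_square_integral:
  assumes t: "0 < t" and f: "f \<in> sqint N"
  shows "(\<integral>x. (\<integral>y. p t x y * (f y)\<^sup>2 \<partial>N) \<partial>N) = ip N f f"
proof -
  have "(\<integral>x. (\<integral>y. p t x y * (f y)\<^sup>2 \<partial>N) \<partial>N) = (\<integral>y. (\<integral>x. p t x y * (f y)\<^sup>2 \<partial>N) \<partial>N)"
    using pair.Fubini_integral[OF kernel_square_integrable_pair[OF assms]] by simp
  also have "\<dots> = (\<integral>y. (f y)\<^sup>2 \<partial>N)"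
  proof (rule Bochner_Integration.integral_cong[OF refl])
    fix y assume y: "y \<in> space N"
    have "(\<integral>x. p t x y * (f y)\<^sup>2 \<partial>N) = (\<integral>x. p t y x * (f y)\<^sup>2 \<partial>N)"
      using t y kernel_sym by (intro Bochner_Integration.integral_cong) auto
    then show "(\<integral>x. p t x y * (f y)\<^sup>2 \<partial>N) = (f y)\<^sup>2" using kernel_integral[OF t y] by simp
  qed
  finally show ?thesis by (simp add: ip_def power2_eq_square)
qed

text \<open>The variance of \<open>f\<close> under the probability density \<open>p t x\<close> is nonnegative.\<close>

lemma K_square_le:
  assumes t: "0 < t" and f: "f \<in> sqint N"
  shows "AE x in N. (K t f x)\<^sup>2 \<le> (\<integral>y. p t x y * (f y)\<^sup>2 \<partial>N)"
  using pair.AE_integrable_fst[OF kernel_square_integrable_pair[OF assms]] AE_space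
proof eventually_elim
  case (elim x)
  define c where "c = K t f x"
  have "0 \<le> (\<integral>y. p t x y * (f y - c)\<^sup>2 \<partial>N)"
    using elim kernel_nonneg[OF t] by (intro integral_nonneg_AE AE_I2) auto
  also have "(\<integral>y. p t x y * (f y - c)\<^sup>2 \<partial>N) = (\<integral>y. p t x y * (f y)\<^sup>2 - (2 * c) * (p t x y * f y) + c\<^sup>2 * p t x y \<partial>N)"
    by (intro Bochner_Integration.integral_cong refl) (simp add: power2_diff algebra_simps)
  also have "\<dots> = (\<integral>y. p t x y * (f y)\<^sup>2 \<partial>N) - (2 * c) * c + c\<^sup>2 * 1"
    using elim K_integrable[OF t _ f] kernel_integrable[OF t] kernel_integral[OF t]
    by (simp add: c_def K_def)
  finally show ?case by (simp add: c_def power2_eq_square)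
qed

lemma K_sqint:
  assumes t: "0 < t" and f: "f \<in> sqint N"
  shows "K t f \<in> sqint N"
proof -
  have m: "K t f \<in> borel_measurable N" using K_measurable[OF t] f by measurable
  have "integrable N (\<lambda>x. (K t f x)\<^sup>2)"
  proof (rule Bochner_Integration.integrable_bound)
    show "integrable N (\<lambda>x. \<integral>y. p t x y * (f y)\<^sup>2 \<partial>N)"
      using pair.integrable_fst[OF kernel_square_integrable_pair[OF assms]] .
    show "AE x in N. norm ((K t f x)\<^sup>2) \<le> norm (\<integral>y. p t x y * (f y)\<^sup>2 \<partial>N)"
      using K_square_le[OF assms] by eventually_elim auto
  qed (use m in measurable)
  then show ?thesis using m by (simp add: sqint_def)
qed

lemma K_contraction:
  assumes t: "0 < t" and f: "f \<in> sqint N"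
  shows "ip N (K t f) (K t f) \<le> ip N f f"
proof -
  have "(\<integral>x. (K t f x)\<^sup>2 \<partial>N) \<le> (\<integral>x. (\<integral>y. p t x y * (f y)\<^sup>2 \<partial>N) \<partial>N)"
    using K_sqint[OF assms] K_square_le[OF assms] pair.integrable_fst[OF kernel_square_integrable_pair[OF assms]]
    by (intro integral_mono_AE) (auto simp: sqint_def)
  then show ?thesis using kernel_square_integral[OF assms] by (simp add: ip_def power2_eq_square)
qed

lemma K_symmetric:
  assumes t: "0 < t" and f: "f \<in> sqint N" and g: "g \<in> sqint N"
  shows "ip N (K t f) g = ip N f (K t g)"
proof -
  have fm: "f \<in> borel_measurable N" and gm: "g \<in> borel_measurable N" using f g by measurable
  have m: "(\<lambda>(x, y). p t x y * f y * g x) \<in> borel_measurable (N \<Otimes>\<^sub>M N)"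
  proof -
    note [measurable] = kernel_mult_measurable[OF t fm] gm
    have "(\<lambda>z. (case z of (x, y) \<Rightarrow> p t x y * f y) * g (fst z)) \<in> borel_measurable (N \<Otimes>\<^sub>M N)"
      by measurable
    then show ?thesis by (simp add: case_prod_unfold)
  qed
  have swap: "integrable (N \<Otimes>\<^sub>M N) (\<lambda>(x, y). p t y x * (g x)\<^sup>2)"
    using kernel_square_integrable_pair[OF t g] pair.integrable_product_swap_iff[of "\<lambda>(x, y). p t x y * (g y)\<^sup>2"]
    by (simp add: case_prod_unfold)
  have int: "integrable (N \<Otimes>\<^sub>M N) (\<lambda>(x, y). p t x y * f y * g x)"
  proof (rule Bochner_Integration.integrable_bound[OF _ m])
    show "integrable (N \<Otimes>\<^sub>M N) (\<lambda>z. (case z of (x, y) \<Rightarrow> p t x y * (f y)\<^sup>2) + (case z of (x, y) \<Rightarrow> p t y x * (g x)\<^sup>2))"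
      using kernel_square_integrable_pair[OF t f] swap by (rule Bochner_Integration.integrable_add)
    show "AE z in N \<Otimes>\<^sub>M N. norm (case z of (x, y) \<Rightarrow> p t x y * f y * g x) \<le>
        norm ((case z of (x, y) \<Rightarrow> p t x y * (f y)\<^sup>2) + (case z of (x, y) \<Rightarrow> p t y x * (g x)\<^sup>2))"
    proof (rule AE_I2)
      fix z assume z: "z \<in> space (N \<Otimes>\<^sub>M N)"
      obtain x y where xy: "z = (x, y)" "x \<in> space N" "y \<in> space N"
        using z by (auto simp: space_pair_measure)
      have p0: "0 \<le> p t x y" using kernel_nonneg[OF t xy(2,3)] .
      have "\<bar>p t x y * f y * g x\<bar> = p t x y * \<bar>f y * g x\<bar>"
        using p0 by (simp add: abs_mult mult.assoc)
      also have "\<dots> \<le> p t x y * ((f y)\<^sup>2 + (g x)\<^sup>2)"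
        using p0 abs_mult_le_squares by (rule mult_left_mono[rotated])
      finally show "norm (case z of (x, y) \<Rightarrow> p t x y * f y * g x) \<le>
        norm ((case z of (x, y) \<Rightarrow> p t x y * (f y)\<^sup>2) + (case z of (x, y) \<Rightarrow> p t y x * (g x)\<^sup>2))"
        using xy kernel_sym[OF t xy(2,3)] by (simp add: distrib_left)
    qed
  qed
  have "ip N (K t f) g = (\<integral>x. (\<integral>y. p t x y * f y * g x \<partial>N) \<partial>N)"
    by (simp add: ip_def K_def)
  also have "\<dots> = (\<integral>y. (\<integral>x. p t x y * f y * g x \<partial>N) \<partial>N)"
    using pair.Fubini_integral[OF int] by simp
  also have "\<dots> = (\<integral>y. f y * (\<integral>x. p t y x * g x \<partial>N) \<partial>N)"
    using kernel_sym[OF t]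
    by (intro Bochner_Integration.integral_cong refl) (auto simp flip: integral_mult_right_zero intro!: Bochner_Integration.integral_cong)
  finally show ?thesis by (simp add: ip_def K_def)
qed

lemma K_K:
  assumes s: "0 < s" and t: "0 < t" and f: "f \<in> sqint N" and x: "x \<in> space N"
  shows "K s (K t f) x = K (s + t) f x"
proof -
  have fm: "f \<in> borel_measurable N" using f by measurable
  note [measurable] = kernel_mult_measurable[OF t fm] kernel_measurable2[OF s x]
  have m: "(\<lambda>(w, y). p s x w * (p t w y * f y)) \<in> borel_measurable (N \<Otimes>\<^sub>M N)"
  proof -
    have "(\<lambda>z. p s x (fst z) * (case z of (w, y) \<Rightarrow> p t w y * f y)) \<in> borel_measurable (N \<Otimes>\<^sub>M N)"
      by measurable
    then show ?thesis by (simp add: case_prod_unfold)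
  qed
  have km: "(\<lambda>w. p t w y) \<in> borel_measurable N" if "y \<in> space N" for y
    using kernel_measurable2[OF t that] kernel_sym[OF t _ that] by (simp cong: measurable_cong)
  have ck: "(\<integral>\<^sup>+w. ennreal (norm (p s x w * (p t w y * f y))) \<partial>N) = ennreal (p (s + t) x y * \<bar>f y\<bar>)"
    if y: "y \<in> space N" for y
  proof -
    have "(\<integral>\<^sup>+w. ennreal (norm (p s x w * (p t w y * f y))) \<partial>N) =
        (\<integral>\<^sup>+w. (ennreal (p s x w) * ennreal (p t w y)) * ennreal \<bar>f y\<bar> \<partial>N)"
      using kernel_nonneg[OF s x] kernel_nonneg[OF t _ y]
      by (intro nn_integral_cong) (auto simp: abs_mult ennreal_mult mult.assoc)
    also have "\<dots> = (\<integral>\<^sup>+w. ennreal (p s x w) * ennreal (p t w y) \<partial>N) * ennreal \<bar>f y\<bar>"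
      using kernel_measurable2[OF s x] km[OF y] by (intro nn_integral_multc) auto
    also have "\<dots> = ennreal (p (s + t) x y * \<bar>f y\<bar>)"
      using kernel_semigroup[OF s t x y] kernel_nonneg[of "s + t" x y] s t x y by (simp add: ennreal_mult)
    finally show ?thesis .
  qed
  have int: "integrable (N \<Otimes>\<^sub>M N) (\<lambda>(w, y). p s x w * (p t w y * f y))"
  proof (rule integrableI_bounded[OF m])
    have "(\<integral>\<^sup>+z. ennreal (norm (case z of (w, y) \<Rightarrow> p s x w * (p t w y * f y))) \<partial>(N \<Otimes>\<^sub>M N)) =
        (\<integral>\<^sup>+y. (\<integral>\<^sup>+w. ennreal (norm (p s x w * (p t w y * f y))) \<partial>N) \<partial>N)"
      using m by (subst pair.nn_integral_snd[symmetric]) (auto intro: measurable_compose[OF _ measurable_ennreal])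
    also have "\<dots> = (\<integral>\<^sup>+y. ennreal (norm (p (s + t) x y * f y)) \<partial>N)"
      using ck kernel_nonneg[of "s + t" x] s t x by (intro nn_integral_cong) (auto simp: abs_mult)
    also have "\<dots> < \<infinity>"
      using K_integrable[of "s + t" x f] s t x f by (simp add: integrable_iff_bounded)
    finally show "(\<integral>\<^sup>+z. ennreal (norm (case z of (w, y) \<Rightarrow> p s x w * (p t w y * f y))) \<partial>(N \<Otimes>\<^sub>M N)) < \<infinity>" .
  qed
  have ck': "(\<integral>w. p s x w * p t w y \<partial>N) = p (s + t) x y" if y: "y \<in> space N" for y
  proof -
    have "(\<integral>w. p s x w * p t w y \<partial>N) = enn2real (\<integral>\<^sup>+w. ennreal (p s x w * p t w y) \<partial>N)"
      using kernel_measurable2[OF s x] km[OF y] kernel_nonneg[OF s x] kernel_nonneg[OF t _ y]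
      by (intro integral_eq_nn_integral) auto
    also have "(\<integral>\<^sup>+w. ennreal (p s x w * p t w y) \<partial>N) = ennreal (p (s + t) x y)"
      unfolding kernel_semigroup[OF s t x y] using kernel_nonneg[OF s x] kernel_nonneg[OF t _ y]
      by (intro nn_integral_cong) (auto simp: ennreal_mult)
    finally show ?thesis using kernel_nonneg[of "s + t" x y] s t x y by simp
  qed
  have "K s (K t f) x = (\<integral>w. (\<integral>y. p s x w * (p t w y * f y) \<partial>N) \<partial>N)"
    by (simp add: K_def)
  also have "\<dots> = (\<integral>y. (\<integral>w. p s x w * (p t w y * f y) \<partial>N) \<partial>N)"
    using pair.Fubini_integral[OF int] by simp
  also have "\<dots> = (\<integral>y. (\<integral>w. p s x w * p t w y \<partial>N) * f y \<partial>N)"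
    by (simp flip: integral_mult_left_zero add: mult.assoc)
  also have "\<dots> = (\<integral>y. p (s + t) x y * f y \<partial>N)"
    using ck' by (intro Bochner_Integration.integral_cong) auto
  finally show ?thesis by (simp add: K_def)
qed

lemma K_const: "0 < t \<Longrightarrow> x \<in> space N \<Longrightarrow> K t (\<lambda>y. c) x = c"
  using kernel_integral[of t x] by (simp add: K_def)

lemma K_diff: "0 < t \<Longrightarrow> x \<in> space N \<Longrightarrow> f \<in> sqint N \<Longrightarrow> g \<in> sqint N \<Longrightarrow>
    K t (\<lambda>y. f y - g y) x = K t f x - K t g x"
  by (simp add: K_def right_diff_distrib K_integrable)

lemma K_scale: "K t (\<lambda>y. c * f y) x = c * K t f x"
  by (simp add: K_def mult.left_commute)

lemma ip_cong: "(\<And>x. x \<in> space N \<Longrightarrow> f x = f' x) \<Longrightarrow> (\<And>x. x \<in> space N \<Longrightarrow> g x = g' x) \<Longrightarrow> ip N f g = ip N f' g'"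
  unfolding ip_def by (intro Bochner_Integration.integral_cong) auto

text \<open>The autocorrelation \<open>t \<mapsto> \<langle>K\<^sub>t f, f\<rangle>\<close>, with \<open>K\<^sub>0\<close> the identity.\<close>

definition corr :: "('a \<Rightarrow> real) \<Rightarrow> real \<Rightarrow> real" where
  "corr f t = (if t = 0 then ip N f f else ip N (K t f) f)"

text \<open>The approximating Dirichlet form at time scale \<open>t\<close>.\<close>

definition energy :: "real \<Rightarrow> ('a \<Rightarrow> real) \<Rightarrow> real" where
  "energy t f = (ip N f f - ip N (K t f) f) / t"

lemma ip_K_K:
  assumes "0 < a" "0 < b" "f \<in> sqint N"
  shows "ip N (K a f) (K b f) = corr f (a + b)"
proof -
  have "ip N (K a f) (K b f) = ip N f (K a (K b f))"
    using K_symmetric[OF assms(1,3) K_sqint[OF assms(2,3)]] .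
  also have "\<dots> = ip N f (K (a + b) f)"
    using K_K[OF assms] by (intro ip_cong) auto
  finally show ?thesis using assms by (simp add: corr_def ip_commute)
qed

text \<open>This is \<open>0 \<le> \<parallel>K\<^bsub>s/2\<^esub> f - K\<^bsub>t/2\<^esub> f\<parallel>\<^sup>2\<close>, expanded by symmetry and the semigroup property.\<close>

lemma corr_midpoint:
  assumes f: "f \<in> sqint N" and "0 \<le> s" "0 \<le> t"
  shows "corr f ((s + t) / 2) \<le> (corr f s + corr f t) / 2"
proof -
  define g where "g = (\<lambda>a. if a = 0 then f else K a f)"
  have g: "g a \<in> sqint N" if "0 \<le> a" for a using that f K_sqint by (auto simp: g_def)
  have gg: "ip N (g a) (g b) = corr f (a + b)" if "0 \<le> a" "0 \<le> b" for a b
    using that ip_K_K[OF _ _ f, of a b] by (auto simp: g_def corr_def ip_commute)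
  have "0 \<le> ip N (\<lambda>x. g (s/2) x - g (t/2) x) (\<lambda>x. g (s/2) x - g (t/2) x)" by (rule ip_nonneg)
  also have "\<dots> = corr f s - 2 * corr f ((s + t) / 2) + corr f t"
    using assms by (simp add: ip_diff_diff g gg add_divide_distrib)
  finally show ?thesis by simp
qed

lemma corr_le:
  assumes f: "f \<in> sqint N" and "0 \<le> t"
  shows "corr f t \<le> ip N f f"
proof (cases "t = 0")
  case False
  then have t: "0 < t / 2" using assms by simp
  have "corr f t = ip N (K (t/2) f) (K (t/2) f)" using ip_K_K[OF t t f] by simp
  then show ?thesis using K_contraction[OF t f] by simp
qed (simp add: corr_def)

lemma convex_corr: "f \<in> sqint N \<Longrightarrow> convex_on {0..} (corr f)"
  by (rule midpoint_convex_imp_convex_on[OF corr_midpoint corr_le])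

lemma energy_corr: "0 < t \<Longrightarrow> energy t f = (corr f 0 - corr f t) / t"
  by (simp add: energy_def corr_def)

lemma energy_nonneg: "f \<in> sqint N \<Longrightarrow> 0 < t \<Longrightarrow> 0 \<le> energy t f"
  using corr_le[of f t] by (simp add: energy_def corr_def)

text \<open>Up to sign the energy at scale \<open>t\<close> is the slope of the convex function \<open>corr f\<close> between \<open>0\<close> and \<open>t\<close>.\<close>

lemma energy_antimono: "f \<in> sqint N \<Longrightarrow> 0 < s \<Longrightarrow> s \<le> t \<Longrightarrow> energy t f \<le> energy s f"
  using convex_initial_slope_antimono[OF convex_corr, of f s t] by (simp add: energy_corr)

text \<open>Smoothing by \<open>K\<^sub>h\<close> produces a function whose energies at all scales are controlled by the
  energy of \<open>f\<close> at the single scale \<open>h\<close>: they are slopes of the convex function \<open>corr f\<close> no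
  steeper than its slope over the first interval of length \<open>h\<close>.\<close>

lemma energy_K_le:
  assumes f: "f \<in> sqint N" and h: "0 < h" and t: "0 < t"
  shows "energy t (K h f) \<le> energy h f"
proof -
  have "ip N (K t (K h f)) (K h f) = ip N (K (t + h) f) (K h f)"
    using K_K[OF t h f] by (intro ip_cong) auto
  also have "\<dots> = corr f (2 * h + t)" using ip_K_K[of "t + h" h f] f h t by (simp add: algebra_simps)
  finally have "energy t (K h f) = (corr f (2 * h) - corr f (2 * h + t)) / t"
    using ip_K_K[OF h h f] by (simp add: energy_def)
  also have "\<dots> \<le> (corr f 0 - corr f h) / h"
    using convex_chord_slopes[OF convex_corr[OF f] h t, of "2 * h"] h by simp
  finally show ?thesis using h by (simp add: energy_corr)
qed

text \<open>The left side is \<open>corr f 0 - 2 * corr f h + corr f (2 * h)\<close>, and \<open>corr f\<close> decreases from \<open>h\<close> to \<open>2 * h\<close>.\<close>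

lemma ip_diff_K_le:
  assumes f: "f \<in> sqint N" and h: "0 < h"
  shows "ip N (\<lambda>x. f x - K h f x) (\<lambda>x. f x - K h f x) \<le> h * energy h f"
proof -
  have "corr f (2 * h) \<le> corr f h"
  proof -
    have h2: "0 < h / 2" using h by simp
    have "corr f (2 * h) = ip N (K h f) (K h f)" using ip_K_K[OF h h f] by simp
    also have "\<dots> = ip N (K (h/2) (K (h/2) f)) (K (h/2) (K (h/2) f))"
      using K_K[OF h2 h2 f] by (intro ip_cong) auto
    also have "\<dots> \<le> ip N (K (h/2) f) (K (h/2) f)" using K_contraction[OF h2 K_sqint[OF h2 f]] .
    also have "\<dots> = corr f h" using ip_K_K[OF h2 h2 f] by simp
    finally show ?thesis .
  qed
  moreover have "ip N (\<lambda>x. f x - K h f x) (\<lambda>x. f x - K h f x) = ip N f f - 2 * corr f h + corr f (2 * h)"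
    using ip_diff_diff[OF f K_sqint[OF h f]] ip_K_K[OF h h f] h by (simp add: corr_def ip_commute)
  ultimately show ?thesis using h by (simp add: energy_def corr_def)
qed

lemma energy_affine:
  assumes f: "f \<in> sqint N" and t: "0 < t"
  shows "energy t (\<lambda>x. a * (f x - c)) = a\<^sup>2 * energy t f"
proof -
  let ?g = "\<lambda>x. f x - c"
  have c: "(\<lambda>x. c) \<in> sqint N" by (rule sqint_const)
  have g: "?g \<in> sqint N" using sqint_diff[OF f c] .
  have "ip N (\<lambda>x. a * ?g x) (\<lambda>x. a * ?g x) = a\<^sup>2 * ip N ?g ?g"
    by (simp add: ip_def power2_eq_square mult_ac flip: integral_mult_right_zero)
  moreover have "ip N (K t (\<lambda>x. a * ?g x)) (\<lambda>x. a * ?g x) = a\<^sup>2 * ip N (K t ?g) ?g"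
    unfolding K_scale by (simp add: ip_def power2_eq_square mult_ac flip: integral_mult_right_zero)
  ultimately have "energy t (\<lambda>x. a * ?g x) = a\<^sup>2 * energy t ?g"
    by (simp add: energy_def right_diff_distrib)
  moreover have "energy t ?g = energy t f"
  proof -
    have Kg: "ip N (K t ?g) ?g = ip N (\<lambda>x. K t f x - c) ?g"
      using K_diff[OF t _ f c] K_const[OF t] by (intro ip_cong) auto
    have Kf: "K t f \<in> sqint N" using K_sqint[OF t f] .
    have "ip N (K t f) (\<lambda>x. c) = ip N f (\<lambda>x. c)"
      using K_symmetric[OF t f c] K_const[OF t] ip_cong[of f f "K t (\<lambda>x. c)" "\<lambda>x. c"] by simp
    moreover have "ip N ?g ?g - ip N (\<lambda>x. K t f x - c) ?g = ip N (\<lambda>x. f x - K t f x) ?g"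
      using ip_diff_left[OF g sqint_diff[OF Kf c] g] by (simp add: algebra_simps)
    moreover have "ip N (\<lambda>x. f x - K t f x) ?g = ip N (\<lambda>x. f x - K t f x) f - ip N (\<lambda>x. f x - K t f x) (\<lambda>x. c)"
      using ip_diff_left[OF f c sqint_diff[OF f Kf]] ip_commute[of N ?g "\<lambda>x. f x - K t f x"]
        ip_commute[of N f "\<lambda>x. f x - K t f x"] ip_commute[of N "\<lambda>x. c" "\<lambda>x. f x - K t f x"] by simp
    ultimately show ?thesis
      using ip_diff_left[OF f Kf f] ip_diff_left[OF f Kf c] by (simp add: energy_def Kg)
  qed
  ultimately show ?thesis by simp
qed

lemma energy_parallelogram:
  assumes f: "f \<in> sqint N" and g: "g \<in> sqint N" and t: "0 < t"
  shows "energy t (\<lambda>x. f x + g x) + energy t (\<lambda>x. f x - g x) = 2 * energy t f + 2 * energy t g"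
proof -
  have K: "K t f \<in> sqint N" "K t g \<in> sqint N" using K_sqint[OF t] f g by auto
  have Kp: "ip N (K t (\<lambda>x. f x + g x)) w = ip N (\<lambda>x. K t f x + K t g x) w" for w
    using K_integrable[OF t _ f] K_integrable[OF t _ g] by (intro ip_cong) (simp_all add: K_def distrib_left)
  have Km: "ip N (K t (\<lambda>x. f x - g x)) w = ip N (\<lambda>x. K t f x - K t g x) w" for w
    using K_diff[OF t _ f g] by (intro ip_cong) simp_all
  have pl: "ip N (\<lambda>x. u x + v x) (\<lambda>x. f x + g x) + ip N (\<lambda>x. u x - v x) (\<lambda>x. f x - g x) = 2 * ip N u f + 2 * ip N v g"
    if "u \<in> sqint N" "v \<in> sqint N" for u v
  proof -
    have "ip N (\<lambda>x. u x + v x) (\<lambda>x. f x + g x) + ip N (\<lambda>x. u x - v x) (\<lambda>x. f x - g x) =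
        (\<integral>x. (u x + v x) * (f x + g x) + (u x - v x) * (f x - g x) \<partial>N)"
      unfolding ip_def using that f g
      by (intro Bochner_Integration.integral_add[symmetric] sqint_integrable_mult sqint_add sqint_diff)
    also have "\<dots> = (\<integral>x. 2 * (u x * f x) + 2 * (v x * g x) \<partial>N)"
      by (intro Bochner_Integration.integral_cong refl) (simp add: algebra_simps)
    also have "\<dots> = 2 * ip N u f + 2 * ip N v g"
      unfolding ip_def using that f g
      by (subst Bochner_Integration.integral_add) (auto intro: sqint_integrable_mult)
    finally show ?thesis .
  qed
  have "t * energy t (\<lambda>x. f x + g x) + t * energy t (\<lambda>x. f x - g x) = t * (2 * energy t f) + t * (2 * energy t g)"
    unfolding energy_def Kp Km using pl[OF f g] pl[OF K] t by simp
  then have "t * (energy t (\<lambda>x. f x + g x) + energy t (\<lambda>x. f x - g x)) = t * (2 * energy t f + 2 * energy t g)"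
    by (simp only: distrib_left)
  then show ?thesis using t by simp
qed

lemma energy_add_le:
  assumes "f \<in> sqint N" "g \<in> sqint N" "0 < t"
  shows "energy t (\<lambda>x. f x + g x) \<le> 2 * energy t f + 2 * energy t g"
  using energy_parallelogram[OF assms] energy_nonneg[OF sqint_diff[OF assms(1,2)] assms(3)] by linarith

lemma energy_le: 
  assumes f: "f \<in> sqint N" and t: "0 < t"
  shows "energy t f \<le> ip N f f / t"
proof -
  have "0 \<le> ip N (K (t/2) f) (K (t/2) f)" by (rule ip_nonneg)
  also have "\<dots> = ip N (K t f) f" using ip_K_K[of "t/2" "t/2" f] f t by (simp add: corr_def)
  finally show ?thesis using t by (simp add: energy_def divide_right_mono)
qed

text \<open>Killing outside \<open>A\<close>: \<open>killed A h n x\<close> is the probability that a chain with transition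
  operator \<open>K\<^sub>h\<close> started at \<open>x\<close> is in \<open>A\<close> at the times \<open>0, \<dots>, n\<close>.\<close>

fun killed :: "'a set \<Rightarrow> real \<Rightarrow> nat \<Rightarrow> 'a \<Rightarrow> real" where
  "killed A h 0 x = indicator A x"
| "killed A h (Suc n) x = indicator A x * K h (killed A h n) x"

lemma killed_sqint:
  assumes "0 < h" "A \<in> sets N"
  shows "killed A h n \<in> sqint N"
proof (induction n)
  case 0
  then show ?case using sqint_indicator_mult[OF sqint_const[of 1] assms(2)] by (simp add: fun_eq_iff[symmetric])
next
  case (Suc n)
  then show ?case using sqint_indicator_mult[OF K_sqint[OF assms(1)] assms(2)] by (simp add: fun_eq_iff[symmetric])
qed

text \<open>The symmetric square root \<open>K\<^bsub>h/2\<^esub>\<close> of \<open>K\<^sub>h\<close> and the Cauchy-Schwarz inequality turn the bound on the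
  quadratic form into a bound on the operator norm.\<close>

lemma killed_decay:
  assumes h: "0 < h" and A: "A \<in> sets N" and \<rho>: "0 \<le> \<rho>"
    and contr: "\<And>f. f \<in> sqint N \<Longrightarrow> (\<And>x. x \<notin> A \<Longrightarrow> f x = 0) \<Longrightarrow> ip N (K h f) f \<le> \<rho> * ip N f f"
  shows "ip N (killed A h n) (killed A h n) \<le> (\<rho> ^ n)\<^sup>2"
proof (induction n)
  case 0
  have "ip N (killed A h 0) (killed A h 0) = measure N A"
    using A by (simp add: ip_def flip: indicator_inter_arith)
  then show ?case using prob_le_1[of A] by (simp only: power_0 one_power2)
next
  case (Suc n)
  let ?f = "killed A h n" and ?g = "killed A h (Suc n)"
  have f: "?f \<in> sqint N" and g: "?g \<in> sqint N" using killed_sqint[OF h A] by blast+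
  have f0: "?f x = 0" if "x \<notin> A" for x using that by (cases n) auto
  have h2: "0 < h / 2" using h by simp
  have half: "ip N (K (h/2) u) (K (h/2) u) = ip N (K h u) u" if "u \<in> sqint N" for u
    using ip_K_K[OF h2 h2 that] h by (simp add: corr_def)
  have "ip N ?g ?g = ip N (K h ?f) ?g"
    unfolding ip_def by (intro Bochner_Integration.integral_cong) (auto simp: indicator_def)
  also have "\<dots> = ip N (K (h/2) (K (h/2) ?f)) ?g"
    using K_K[OF h2 h2 f] by (intro ip_cong) auto
  also have "\<dots> = ip N (K (h/2) ?f) (K (h/2) ?g)"
    using K_symmetric[OF h2 K_sqint[OF h2 f] g] .
  finally have "(ip N ?g ?g)\<^sup>2 \<le> ip N (K (h/2) ?f) (K (h/2) ?f) * ip N (K (h/2) ?g) (K (h/2) ?g)"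
    using ip_Cauchy_Schwarz[OF K_sqint[OF h2 f] K_sqint[OF h2 g]] by simp
  also have "\<dots> \<le> (\<rho> * ip N ?f ?f) * (\<rho> * ip N ?g ?g)"
  proof (rule mult_mono)
    show "ip N (K (h/2) ?f) (K (h/2) ?f) \<le> \<rho> * ip N ?f ?f" using contr[OF f f0] half[OF f] by simp
    show "ip N (K (h/2) ?g) (K (h/2) ?g) \<le> \<rho> * ip N ?g ?g" using contr[OF g] half[OF g] by simp
  qed (use \<rho> in \<open>auto intro: mult_nonneg_nonneg ip_nonneg\<close>)
  finally have *: "ip N ?g ?g * ip N ?g ?g \<le> (\<rho>\<^sup>2 * ip N ?f ?f) * ip N ?g ?g"
    by (simp add: power2_eq_square mult_ac)
  have "ip N ?g ?g \<le> \<rho>\<^sup>2 * ip N ?f ?f"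
  proof (cases "ip N ?g ?g = 0")
    case True
    then show ?thesis using ip_nonneg[of N ?f] by simp
  next
    case False
    then have "0 < ip N ?g ?g" using ip_nonneg[of N ?g] by linarith
    then show ?thesis using * by (metis mult_le_cancel_right_pos)
  qed
  also have "\<dots> \<le> \<rho>\<^sup>2 * (\<rho> ^ n)\<^sup>2" using Suc.IH by (intro mult_left_mono) auto
  also have "\<dots> = (\<rho> ^ Suc n)\<^sup>2" by (simp add: power_mult_distrib)
  finally show ?case .
qed

lemma killed_integral_le:
  assumes "0 < h" "A \<in> sets N" "0 \<le> \<rho>"
    and "\<And>f. f \<in> sqint N \<Longrightarrow> (\<And>x. x \<notin> A \<Longrightarrow> f x = 0) \<Longrightarrow> ip N (K h f) f \<le> \<rho> * ip N f f"
  shows "(\<integral>x. killed A h n x \<partial>N) \<le> \<rho> ^ n"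
proof (rule power2_le_imp_le)
  show "(\<integral>x. killed A h n x \<partial>N)\<^sup>2 \<le> (\<rho> ^ n)\<^sup>2"
    using square_integral_le[OF killed_sqint[OF assms(1,2)]] killed_decay[OF assms, of n] by (rule order_trans) 
qed (use assms in simp)

end

section \<open>The Poincare inequality\<close>

lemma sqint_eq_L2: "L2 M = sqint (norm_lebesgue M)"
  by (simp add: L2_def sqint_def)

lemma ip_eq_l2_inner: "l2_inner M f g = ip (norm_lebesgue M) f g"
  by (simp add: l2_inner_def ip_def)

locale reflected_process =
  body M + symmetric_markov_kernel "norm_lebesgue M" p for M :: "'a::euclidean_space set" and p +
  fixes P :: "'a \<Rightarrow> (real \<Rightarrow> 'a) measure"
  assumes transition_op_eq: "0 < t \<Longrightarrow> f \<in> L2 M \<Longrightarrow> x \<in> M \<Longrightarrow> transition_op P t f x = K t f x"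
    and associated: "dirichlet_associated M P"
    and compact: "compact_semigroup M P"
    and ground_state: "\<forall>f \<in> neumann_eigenspace M 0. \<exists>c. AE x in norm_lebesgue M. f x = c"
begin

lemma transition_energy:
  assumes "0 < t" "f \<in> L2 M"
  shows "l2_inner M (\<lambda>x. f x - transition_op P t f x) f / t = energy t f"
proof -
  have f: "f \<in> sqint N" using assms by (simp add: sqint_eq_L2)
  have "ip N (\<lambda>x. f x - transition_op P t f x) f = ip N (\<lambda>x. f x - K t f x) f"
    using transition_op_eq[OF assms] space_N by (intro ip_cong) auto
  also have "\<dots> = ip N f f - ip N (K t f) f"
    using ip_diff_left[OF f K_sqint[OF assms(1) f] f] .
  finally show ?thesis by (simp add: energy_def ip_eq_l2_inner)
qed

text \<open>The energies increase as the scale tends to zero, so boundedness means convergence, which is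
  membership in the domain of the form.\<close>

lemma bounded_energy_imp_H1:
  assumes f: "f \<in> L2 M" and bd: "\<And>t. 0 < t \<Longrightarrow> energy t f \<le> k"
  shows "f \<in> H1 M" "dirichlet_form M f f \<le> k" "\<And>t. 0 < t \<Longrightarrow> energy t f \<le> dirichlet_form M f f"
proof -
  have f': "f \<in> sqint N" using f by (simp add: sqint_eq_L2)
  obtain l where l: "l \<le> k" "((\<lambda>t. energy t f) \<longlongrightarrow> l) (at_right 0)" "\<And>t. 0 < t \<Longrightarrow> energy t f \<le> l"
    using antimono_bounded_tendsto_at_right_0[of "\<lambda>t. energy t f" k] energy_antimono[OF f'] bd by blast
  have lim: "((\<lambda>t. l2_inner M (\<lambda>x. f x - transition_op P t f x) f / t) \<longlongrightarrow> l) (at_right 0)"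
    using l(2)
  proof (rule Lim_transform_eventually)
    show "\<forall>\<^sub>F t in at_right 0. energy t f = l2_inner M (\<lambda>x. f x - transition_op P t f x) f / t"
      using eventually_at_right_less[of 0] by eventually_elim (simp add: transition_energy f)
  qed
  then show H1: "f \<in> H1 M" using associated f unfolding dirichlet_associated_def by blast
  have "((\<lambda>t. l2_inner M (\<lambda>x. f x - transition_op P t f x) f / t) \<longlongrightarrow> dirichlet_form M f f) (at_right 0)"
    using associated H1 unfolding dirichlet_associated_def by blast
  then have "dirichlet_form M f f = l" using lim tendsto_unique trivial_limit_at_right_real by blast
  then show "dirichlet_form M f f \<le> k" "\<And>t. 0 < t \<Longrightarrow> energy t f \<le> dirichlet_form M f f"
    using l by auto
qed

lemma weak_gradient_has_weak_gradient: "f \<in> H1 M \<Longrightarrow> has_weak_gradient M f (weak_gradient M f)"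
  using someI_ex[of "has_weak_gradient M f"] unfolding H1_def weak_gradient_def by auto

text \<open>If the weak gradient vanishes, \<open>f\<close> is an eigenfunction for the eigenvalue zero, which is simple.\<close>

lemma zero_dirichlet_form_imp_constant:
  assumes f: "f \<in> H1 M" and 0: "dirichlet_form M f f = 0"
  shows "\<exists>c. AE x in N. f x = c"
proof -
  note int = interior_sets_N
  let ?G = "weak_gradient M f"
  have G: "?G \<in> borel_measurable N" "integrable N (\<lambda>x. (norm (?G x))\<^sup>2)"
    using weak_gradient_has_weak_gradient[OF f] by (auto simp: has_weak_gradient_def)
  have i: "integrable N (\<lambda>x. indicator (interior M) x *\<^sub>R (?G x \<bullet> ?G x))"
    using integrable_mult_indicator[OF int G(2)] by (simp add: power2_norm_eq_inner)
  have "(\<integral>x. indicator (interior M) x *\<^sub>R (?G x \<bullet> ?G x) \<partial>N) = 0"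
    using 0 by (simp add: dirichlet_form_def set_lebesgue_integral_def)
  then have "AE x in N. indicator (interior M) x *\<^sub>R (?G x \<bullet> ?G x) = 0"
    using integral_nonneg_eq_0_iff_AE[OF i] by simp
  then have ae: "AE x in N. indicator (interior M) x *\<^sub>R (?G x \<bullet> W x) = 0" for W
    by eventually_elim (auto simp: indicator_def split: if_splits)
  have "dirichlet_form M f g = 0" if g: "g \<in> H1 M" for g
  proof -
    have m: "weak_gradient M g \<in> borel_measurable N"
      using weak_gradient_has_weak_gradient[OF g] by (simp add: has_weak_gradient_def)
    have "(\<integral>x. indicator (interior M) x *\<^sub>R (?G x \<bullet> weak_gradient M g x) \<partial>N) = (\<integral>x. 0 \<partial>N)"
      using ae[of "weak_gradient M g"] G(1) m int by (intro integral_cong_AE) auto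
    then show ?thesis by (simp add: dirichlet_form_def set_lebesgue_integral_def)
  qed
  moreover have "l2_inner M (\<lambda>x. 0 * f x) g = 0" for g by (simp add: l2_inner_def)
  moreover have "(\<lambda>x. 0 * f x) \<in> L2 M" using sqint_const[of 0] by (simp add: sqint_eq_L2)
  ultimately have "f \<in> neumann_eigenspace M 0"
    using f unfolding neumann_eigenspace_def neumann_generator_def by simp
  then show ?thesis using ground_state by blast
qed

text \<open>The Poincare inequality, by contradiction: normalised functions with energies tending to zero
  are close to their images under \<open>K\<^sub>1\<close>, hence converge along a subsequence by compactness;
  the limit has energy zero, so it is constant, yet has mean zero and positive norm.\<close>

theorem Poincare:
  "\<exists>C>0. \<forall>u\<in>sqint N. \<forall>k. (\<forall>t>0. energy t u \<le> k) \<longrightarrow>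
     ip N (\<lambda>x. u x - (\<integral>x. u x \<partial>N)) (\<lambda>x. u x - (\<integral>x. u x \<partial>N)) \<le> C * k"
proof (rule ccontr)
  assume neg: "\<not> ?thesis"
  have "\<forall>n. \<exists>v. v \<in> sqint N \<and> ip N v v = 1 \<and> (\<integral>x. v x \<partial>N) = 0 \<and> (\<forall>t>0. energy t v \<le> inverse (real (Suc n)))"
  proof
    fix n
    have "0 < real (Suc n)" by simp
    then have "\<not> (\<forall>u\<in>sqint N. \<forall>k. (\<forall>t>0. energy t u \<le> k) \<longrightarrow>
       ip N (\<lambda>x. u x - (\<integral>x. u x \<partial>N)) (\<lambda>x. u x - (\<integral>x. u x \<partial>N)) \<le> real (Suc n) * k)"
      using neg by blast
    then obtain u k where u: "u \<in> sqint N" and k: "\<And>t. 0 < t \<Longrightarrow> energy t u \<le> k"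
      and big: "real (Suc n) * k < ip N (\<lambda>x. u x - (\<integral>x. u x \<partial>N)) (\<lambda>x. u x - (\<integral>x. u x \<partial>N))"
      unfolding not_le[symmetric] by blast
    define m where "m = (\<integral>x. u x \<partial>N)"
    define S where "S = ip N (\<lambda>x. u x - m) (\<lambda>x. u x - m)"
    have k0: "0 \<le> k" using energy_nonneg[OF u, of 1] k[of 1] by simp
    have S: "real (Suc n) * k < S" using big by (simp only: S_def m_def)
    then have S0: "0 < S" using k0 mult_nonneg_nonneg[of "real (Suc n)" k] by linarith
    define a where "a = 1 / sqrt S"
    have a2: "a\<^sup>2 = 1 / S" using S0 by (simp add: a_def power_divide)
    let ?v = "\<lambda>x. a * (u x - m)"
    have v: "?v \<in> sqint N" by (intro sqint_scale sqint_diff u sqint_const)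
    moreover have "ip N ?v ?v = 1"
    proof -
      have "ip N ?v ?v = a\<^sup>2 * S"
        by (simp add: S_def ip_def power2_eq_square mult_ac flip: integral_mult_right_zero)
      then show ?thesis using S0 a2 by simp
    qed
    moreover have "(\<integral>x. ?v x \<partial>N) = 0"
      using sqint_integrable[OF u] by (simp add: m_def prob_space)
    moreover have "energy t ?v \<le> inverse (real (Suc n))" if t: "0 < t" for t
    proof -
      have "energy t ?v = energy t u / S" using energy_affine[OF u t, of a m] a2 by simp
      also have "\<dots> \<le> k / S" using k[OF t] S0 by (simp add: divide_right_mono)
      also have "\<dots> \<le> inverse (real (Suc n))" using S S0 by (simp add: field_simps)
      finally show ?thesis .
    qed
    ultimately show "\<exists>v. v \<in> sqint N \<and> ip N v v = 1 \<and> (\<integral>x. v x \<partial>N) = 0 \<and> (\<forall>t>0. energy t v \<le> inverse (real (Suc n)))"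
      by blast
  qed
  from choice[OF this] obtain v where "\<And>n. v n \<in> sqint N \<and> ip N (v n) (v n) = 1 \<and> (\<integral>x. v n x \<partial>N) = 0 \<and>
      (\<forall>t>0. energy t (v n) \<le> inverse (real (Suc n)))" by blast
  then have v: "\<And>n. v n \<in> sqint N" "\<And>n. ip N (v n) (v n) = 1" "\<And>n. (\<integral>x. v n x \<partial>N) = 0"
    "\<And>n t. 0 < t \<Longrightarrow> energy t (v n) \<le> inverse (real (Suc n))" by blast+
  have "\<forall>n. v n \<in> L2 M \<and> l2_norm M (v n) \<le> 1"
    using v by (simp add: sqint_eq_L2 l2_norm_def ip_eq_l2_inner)
  then obtain k g where k: "strict_mono k" and gL: "g \<in> L2 M"
    and lim: "(\<lambda>n. l2_norm M (\<lambda>x. transition_op P 1 (v (k n)) x - g x)) \<longlonglongrightarrow> 0"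
    using compact[unfolded compact_semigroup_def, rule_format, of 1 v] by auto
  have g: "g \<in> sqint N" using gL by (simp add: sqint_eq_L2)
  define w where "w n = v (k n)" for n
  have w: "w n \<in> sqint N" "ip N (w n) (w n) = 1" "(\<integral>x. w n x \<partial>N) = 0" for n using v by (auto simp: w_def)
  have we: "energy t (w n) \<le> inverse (real (Suc n))" if "0 < t" for t n
  proof -
    have "inverse (real (Suc (k n))) \<le> inverse (real (Suc n))"
      using seq_suble[OF k, of n] by (intro le_imp_inverse_le) auto
    with v(4)[OF that, of "k n"] show ?thesis unfolding w_def by (rule order_trans)
  qed
  have Kw: "K 1 (w n) \<in> sqint N" for n using K_sqint[OF _ w(1)] by simp
  define \<delta> where "\<delta> n = ip N (\<lambda>x. K 1 (w n) x - g x) (\<lambda>x. K 1 (w n) x - g x)" for n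
  have "l2_norm M (\<lambda>x. transition_op P 1 (v (k n)) x - g x) = sqrt (\<delta> n)" for n
    unfolding l2_norm_def ip_eq_l2_inner \<delta>_def w_def
    using transition_op_eq[of 1 "v (k n)"] v(1) space_N by (intro arg_cong[where f=sqrt] ip_cong) (auto simp: sqint_eq_L2)
  then have "(\<lambda>n. sqrt (\<delta> n)) \<longlonglongrightarrow> 0" using lim by simp
  then have "(\<lambda>n. (sqrt (\<delta> n))\<^sup>2) \<longlonglongrightarrow> 0\<^sup>2" by (rule tendsto_power)
  moreover have "(sqrt (\<delta> n))\<^sup>2 = \<delta> n" for n by (simp add: \<delta>_def ip_nonneg)
  ultimately have \<delta>0: "\<delta> \<longlonglongrightarrow> 0" by simp
  define \<eta> where "\<eta> n = ip N (\<lambda>x. g x - w n x) (\<lambda>x. g x - w n x)" for n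
  have \<eta>_le: "\<eta> n \<le> 2 * inverse (real (Suc n)) + 2 * \<delta> n" for n
  proof -
    let ?a = "\<lambda>x. w n x - K 1 (w n) x" and ?b = "\<lambda>x. K 1 (w n) x - g x"
    have "ip N ?a ?a \<le> inverse (real (Suc n))" using ip_diff_K_le[OF w(1), of 1 n] we[of 1 n] by simp
    moreover have "\<eta> n = ip N (\<lambda>x. ?a x + ?b x) (\<lambda>x. ?a x + ?b x)"
      unfolding \<eta>_def ip_def by (intro Bochner_Integration.integral_cong) (auto simp: algebra_simps)
    moreover have "ip N (\<lambda>x. ?a x + ?b x) (\<lambda>x. ?a x + ?b x) \<le> 2 * ip N ?a ?a + 2 * ip N ?b ?b"
      using w(1) Kw g by (intro ip_add_le sqint_diff)
    ultimately show ?thesis by (simp add: \<delta>_def)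
  qed
  have \<eta>0: "\<eta> \<longlonglongrightarrow> 0"
  proof (rule tendsto_sandwich[of "\<lambda>_. 0" \<eta> sequentially "\<lambda>n. 2 * inverse (real (Suc n)) + 2 * \<delta> n"])
    have "(\<lambda>n. 2 * inverse (real (Suc n)) + 2 * \<delta> n) \<longlonglongrightarrow> 2 * 0 + 2 * 0"
      by (intro tendsto_intros \<delta>0 LIMSEQ_inverse_real_of_nat)
    then show "(\<lambda>n. 2 * inverse (real (Suc n)) + 2 * \<delta> n) \<longlonglongrightarrow> 0" by simp
  qed (use \<eta>_le in \<open>auto simp: \<eta>_def ip_nonneg\<close>)
  have gw: "(\<lambda>x. g x - w n x) \<in> sqint N" for n using sqint_diff[OF g w(1)] .
  have energy0: "energy t g = 0" if t: "0 < t" for t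
  proof -
    have "energy t g \<le> 2 * inverse (real (Suc n)) + 2 * (\<eta> n / t)" for n
    proof -
      have "energy t g \<le> 2 * energy t (w n) + 2 * energy t (\<lambda>x. g x - w n x)"
        using energy_add_le[OF w(1) gw t, of n n] by simp
      then show ?thesis using we[OF t, of n] energy_le[OF gw t, of n] by (simp add: \<eta>_def)
    qed
    moreover have lim: "(\<lambda>n. 2 * inverse (real (Suc n)) + 2 * (\<eta> n / t)) \<longlonglongrightarrow> 2 * 0 + 2 * (0 / t)"
      using t by (intro tendsto_intros \<eta>0 LIMSEQ_inverse_real_of_nat) auto
    ultimately have "energy t g \<le> 2 * 0 + 2 * (0 / t)" by (intro LIMSEQ_le_const[OF lim]) simp
    then show ?thesis using energy_nonneg[OF g t] by simp
  qed
  have mean0: "(\<integral>x. g x \<partial>N) = 0"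
  proof -
    have "(\<integral>x. g x \<partial>N)\<^sup>2 \<le> \<eta> n" for n
    proof -
      have "(\<integral>x. g x \<partial>N) = (\<integral>x. g x - w n x \<partial>N)"
        using sqint_integrable[OF g] sqint_integrable[OF w(1)] w(3) by simp
      then show ?thesis using square_integral_le[OF gw, of n] by (simp add: \<eta>_def)
    qed
    then have "(\<integral>x. g x \<partial>N)\<^sup>2 \<le> 0" by (intro LIMSEQ_le_const[OF \<eta>0]) simp
    then show ?thesis by simp
  qed
  have gg: "1 / 2 \<le> ip N g g"
  proof -
    have "1 \<le> 2 * ip N g g + 2 * \<eta> n" for n
    proof -
      let ?b = "\<lambda>x. w n x - g x"
      have "ip N (\<lambda>x. g x + ?b x) (\<lambda>x. g x + ?b x) \<le> 2 * ip N g g + 2 * ip N ?b ?b"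
        using w(1) g by (intro ip_add_le sqint_diff)
      moreover have "ip N ?b ?b = \<eta> n" unfolding \<eta>_def ip_def
        by (intro Bochner_Integration.integral_cong) (auto simp: algebra_simps)
      ultimately show ?thesis using w(2)[of n] by simp
    qed
    moreover have lim: "(\<lambda>n. 2 * ip N g g + 2 * \<eta> n) \<longlonglongrightarrow> 2 * ip N g g + 2 * 0"
      by (intro tendsto_intros \<eta>0)
    ultimately have "1 \<le> 2 * ip N g g + 2 * 0" by (intro LIMSEQ_le_const[OF lim]) simp
    then show ?thesis by simp
  qed
  have bd: "energy t g \<le> 0" if "0 < t" for t using energy0[OF that] by simp
  have H1: "g \<in> H1 M" "dirichlet_form M g g \<le> 0" "0 \<le> dirichlet_form M g g"
    using bounded_energy_imp_H1(1,2)[OF gL bd] bounded_energy_imp_H1(3)[OF gL bd zero_less_one] energy0[of 1] by simp_all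
  then obtain c where c: "AE x in N. g x = c"
    using zero_dirichlet_form_imp_constant[OF H1(1) order_antisym[OF H1(2,3)]] by blast
  have "(\<integral>x. g x \<partial>N) = (\<integral>x. c \<partial>N)" using c g by (intro integral_cong_AE) auto
  then have "c = 0" using mean0 by (simp add: prob_space)
  then have "ip N g g = (\<integral>x. 0 \<partial>N)"
    unfolding ip_def using c g by (intro integral_cong_AE) auto
  then show False using gg by simp
qed

end

section \<open>Quadratic B-splines\<close>

lemma has_real_derivative_truncated_power:
  fixes c :: real
  assumes "2 \<le> n"
  shows "((\<lambda>t. (max 0 (t - c)) ^ n) has_real_derivative (real n * (max 0 (t - c)) ^ (n - 1))) (at t)"
proof (cases t c rule: linorder_cases)
  case less
  have "((\<lambda>t. 0) has_real_derivative 0) (at t)" by simp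
  then have "((\<lambda>t. (max 0 (t - c)) ^ n) has_real_derivative 0) (at t)"
    by (rule has_field_derivative_transform_within_open[of _ _ _ "{..<c}"]) (use less assms in auto)
  moreover have "real n * (max 0 (t - c)) ^ (n - 1) = 0"
    using less assms by (cases "n - 1") auto
  ultimately show ?thesis by (simp only:)
next
  case greater
  have "((\<lambda>t. (t - c) ^ n) has_real_derivative (real n * (t - c) ^ (n - 1))) (at t)"
    by (auto intro!: derivative_eq_intros)
  then have "((\<lambda>t. (max 0 (t - c)) ^ n) has_real_derivative (real n * (t - c) ^ (n - 1))) (at t)"
    by (rule has_field_derivative_transform_within_open[of _ _ _ "{c<..}"]) (use greater in auto)
  then show ?thesis using greater by simp
next
  case equal
  have n: "n = Suc (n - 1)" "0 < n - 1" using assms by auto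
  have "((\<lambda>h. (max 0 (c + h - c) ^ n - max 0 (c - c) ^ n) / h) \<longlongrightarrow> 0) (at 0)"
  proof (rule Lim_null_comparison)
    have "norm ((max 0 (c + h - c) ^ n - max 0 (c - c) ^ n) / h) \<le> \<bar>h\<bar> ^ (n - 1)" for h
    proof (cases "0 < h")
      case True
      then have "h ^ n / h = h ^ (n - 1)" by (subst n(1)) simp
      then show ?thesis using True assms by (simp add: power_0_left)
    next
      case False
      then show ?thesis using assms by (simp add: power_0_left)
    qed
    then show "\<forall>\<^sub>F h in at 0. norm ((max 0 (c + h - c) ^ n - max 0 (c - c) ^ n) / h) \<le> \<bar>h\<bar> ^ (n - 1)"
      by (intro always_eventually allI)
    show "((\<lambda>h. \<bar>h\<bar> ^ (n - 1)) \<longlongrightarrow> 0) (at (0::real))"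
    proof -
      have "((\<lambda>h. \<bar>h\<bar> ^ (n - 1)) \<longlongrightarrow> \<bar>0\<bar> ^ (n - 1)) (at (0::real))" by (intro tendsto_intros)
      then show ?thesis using n(2) by (simp add: power_0_left)
    qed
  qed
  then show ?thesis unfolding DERIV_def equal using n(2) by (simp add: power_0_left)
qed

text \<open>The convolution of three copies of the indicator of the unit interval, supported in \<open>{0..3}\<close>. Degree two makes
  it continuously differentiable, hence admissible as a test function.\<close>

definition bspline :: "real \<Rightarrow> real" where
  "bspline t = ((max 0 t)\<^sup>2 - 3 * (max 0 (t - 1))\<^sup>2 + 3 * (max 0 (t - 2))\<^sup>2 - (max 0 (t - 3))\<^sup>2) / 2"

definition bspline_prim :: "real \<Rightarrow> real" where
  "bspline_prim t = ((max 0 t) ^ 3 - 3 * (max 0 (t - 1)) ^ 3 + 3 * (max 0 (t - 2)) ^ 3 - (max 0 (t - 3)) ^ 3) / 6"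

definition bspline_deriv :: "real \<Rightarrow> real" where
  "bspline_deriv t = max 0 t - 3 * max 0 (t - 1) + 3 * max 0 (t - 2) - max 0 (t - 3)"

lemma bspline_prim_has_derivative: "(bspline_prim has_real_derivative bspline t) (at t)"
proof -
  have d: "((\<lambda>t. (max 0 (t - c)) ^ 3) has_real_derivative 3 * (max 0 (t - c))\<^sup>2) (at t)" for c
    using has_real_derivative_truncated_power[of 3 c t] by simp
  show ?thesis
    unfolding bspline_prim_def[abs_def] bspline_def
    by (rule DERIV_cong[OF DERIV_cdivide[OF DERIV_diff[OF DERIV_add[OF DERIV_diff[OF
      d[of 0, unfolded diff_zero] DERIV_cmult[OF d]] DERIV_cmult[OF d]] d]]]) simp
qed

lemma bspline_has_derivative: "(bspline has_real_derivative bspline_deriv t) (at t)"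
proof -
  have d: "((\<lambda>t. (max 0 (t - c))\<^sup>2) has_real_derivative 2 * max 0 (t - c)) (at t)" for c
    using has_real_derivative_truncated_power[of 2 c t] by simp
  show ?thesis
    unfolding bspline_def[abs_def] bspline_deriv_def
    by (rule DERIV_cong[OF DERIV_cdivide[OF DERIV_diff[OF DERIV_add[OF DERIV_diff[OF
      d[of 0, unfolded diff_zero] DERIV_cmult[OF d]] DERIV_cmult[OF d]] d]]]) simp
qed

lemma continuous_bspline_deriv: "continuous_on UNIV bspline_deriv"
  unfolding bspline_deriv_def[abs_def] by (intro continuous_intros)

lemma continuous_bspline: "continuous_on UNIV bspline"
  unfolding bspline_def[abs_def] by (intro continuous_intros) auto

lemma bspline_cases:
  "bspline t = (if t \<le> 0 then 0 else if t \<le> 1 then t\<^sup>2 / 2 else if t \<le> 2 then 3/4 - (t - 3/2)\<^sup>2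
     else if t \<le> 3 then (3 - t)\<^sup>2 / 2 else 0)"
  by (auto simp: bspline_def max_def power2_eq_square field_simps)

lemma bspline_nonneg: "0 \<le> bspline t"
proof -
  have "0 \<le> 3/4 - (t - 3/2)\<^sup>2" if "1 \<le> t" "t \<le> 2"
  proof -
    have "\<bar>t - 3/2\<bar> \<le> 1/2" unfolding abs_le_iff using that by auto
    from power_mono[OF this, of 2] have "(t - 3/2)\<^sup>2 \<le> (1/2)\<^sup>2" by simp
    then show ?thesis by (simp add: power2_eq_square)
  qed
  then show ?thesis by (auto simp: bspline_cases)
qed

lemma bspline_le_1: "bspline t \<le> 1"
proof -
  have "t\<^sup>2 \<le> 1" if "0 \<le> t" "t \<le> 1" using that by (simp add: power_le_one)
  moreover have "(3 - t)\<^sup>2 \<le> 1" if "2 \<le> t" "t \<le> 3" using that by (simp add: power_le_one)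
  moreover have "3/4 - (t - 3/2)\<^sup>2 \<le> 1" using zero_le_power2[of "t - 3/2"] by linarith
  ultimately show ?thesis by (auto simp: bspline_cases)
qed

lemma bspline_ge: "1 \<le> t \<Longrightarrow> t \<le> 2 \<Longrightarrow> 1 / 2 \<le> bspline t"
proof -
  assume t: "1 \<le> t" "t \<le> 2"
  have "\<bar>t - 3/2\<bar> \<le> 1/2" unfolding abs_le_iff using t by auto
  from power_mono[OF this, of 2] have "(t - 3/2)\<^sup>2 \<le> (1/2)\<^sup>2" by simp
  then show ?thesis using t by (auto simp: bspline_cases power2_eq_square)
qed

lemma bspline_eq_0: "t \<le> 0 \<or> 3 \<le> t \<Longrightarrow> bspline t = 0"
  by (auto simp: bspline_cases)

lemma bspline_prim_eq: "t \<le> 0 \<Longrightarrow> bspline_prim t = 0" "3 \<le> t \<Longrightarrow> bspline_prim t = 1"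
  by (auto simp: bspline_prim_def max_def power3_eq_cube algebra_simps)

lemma bspline_prim_mono: "s \<le> t \<Longrightarrow> bspline_prim s \<le> bspline_prim t"
  using DERIV_nonneg_imp_nondecreasing[of s t bspline_prim] bspline_prim_has_derivative bspline_nonneg by blast

lemma bspline_prim_bounds: "0 \<le> bspline_prim t" "bspline_prim t \<le> 1"
  using bspline_prim_mono[of "min 0 t" t] bspline_prim_mono[of t "max 3 t"] bspline_prim_eq by (auto simp: min_def max_def split: if_splits)

section \<open>Averages against products of B-splines\<close>

lemma GDERIV_prod_components:
  fixes \<gamma> \<gamma>' :: "'n::finite \<Rightarrow> real \<Rightarrow> real"
  assumes "\<And>i t. (\<gamma> i has_real_derivative \<gamma>' i t) (at t)"
  shows "GDERIV (\<lambda>x::real^'n. \<Prod>i\<in>UNIV. \<gamma> i (x $ i)) x :> (\<chi> j. \<gamma>' j (x $ j) * (\<Prod>i\<in>UNIV - {j}. \<gamma> i (x $ i)))"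
proof -
  have *: "((\<lambda>x::real^'n. \<gamma> i (x $ i)) has_derivative (\<lambda>h. \<gamma>' i (x $ i) * h $ i)) (at x)" for i
  proof -
    have "((\<lambda>x::real^'n. x $ i) has_derivative (\<lambda>h. h $ i)) (at x)"
      by (intro bounded_linear_imp_has_derivative bounded_linear_vec_nth)
    from has_derivative_compose[OF this assms[unfolded has_field_derivative_def]]
    show ?thesis .
  qed
  have "((\<lambda>x::real^'n. \<Prod>i\<in>UNIV. \<gamma> i (x $ i)) has_derivative
      (\<lambda>h. \<Sum>j\<in>UNIV. (\<gamma>' j (x $ j) * h $ j) * (\<Prod>i\<in>UNIV - {j}. \<gamma> i (x $ i)))) (at x)"
    by (rule has_derivative_prod) (rule *)
  then show ?thesis
    unfolding gderiv_def by (simp add: inner_vec_def mult_ac)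
qed

locale cartesian_body = body M for M :: "(real^'n::finite) set"
begin

lemma integrable_interior_scaleR_continuous:
  fixes f :: "real^'n \<Rightarrow> 'b::{banach, second_countable_topology}" and h :: "real^'n \<Rightarrow> real"
  assumes f: "integrable N f" and h: "continuous_on UNIV h"
  shows "set_integrable lborel (interior M) (\<lambda>x. h x *\<^sub>R f x)"
proof -
  obtain B where B: "\<And>x. x \<in> M \<Longrightarrow> norm (h x) \<le> B"
    using compact_imp_bounded[OF compact_continuous_image[OF continuous_on_subset[OF h subset_UNIV] compact_M]]
    unfolding bounded_iff by auto
  have fi: "integrable lborel (\<lambda>x. indicator (interior M) x *\<^sub>R f x)"
    using integrable_interior[OF f] by (simp add: set_integrable_def)
  have hm: "h \<in> borel_measurable lborel" using h by (simp add: borel_measurable_continuous_onI)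
  have "integrable lborel (\<lambda>x. h x *\<^sub>R (indicator (interior M) x *\<^sub>R f x))"
  proof (rule Bochner_Integration.integrable_bound)
    show "integrable lborel (\<lambda>x. B *\<^sub>R (indicator (interior M) x *\<^sub>R f x))"
      using fi by (rule integrable_scaleR_right)
    show "(\<lambda>x. h x *\<^sub>R (indicator (interior M) x *\<^sub>R f x)) \<in> borel_measurable lborel"
      using hm borel_measurable_integrable[OF fi] by (rule borel_measurable_scaleR)
    show "AE x in lborel. norm (h x *\<^sub>R (indicator (interior M) x *\<^sub>R f x)) \<le> norm (B *\<^sub>R (indicator (interior M) x *\<^sub>R f x))"
    proof (rule AE_I2)
      fix x
      show "norm (h x *\<^sub>R (indicator (interior M) x *\<^sub>R f x)) \<le> norm (B *\<^sub>R (indicator (interior M) x *\<^sub>R f x))"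
      proof (cases "x \<in> interior M")
        case True
        then have "norm (h x) \<le> \<bar>B\<bar>" using B[of x] interior_subset[of M] by (auto intro: order_trans)
        then show ?thesis using True by (simp add: mult_right_mono)
      qed simp
    qed
  qed
  then show ?thesis by (simp add: set_integrable_def mult.commute)
qed

lemma integrable_N_weak_gradient:
  assumes "has_weak_gradient M f G"
  shows "integrable N G"
proof -
  interpret prob_space N by (rule prob_space_N)
  have G: "G \<in> borel_measurable N" "integrable N (\<lambda>x. (norm (G x))\<^sup>2)"
    using assms by (auto simp: has_weak_gradient_def)
  show ?thesis
  proof (rule Bochner_Integration.integrable_bound)
    show "integrable N (\<lambda>x. 1 + (norm (G x))\<^sup>2)" using G by (intro Bochner_Integration.integrable_add) auto
    have "norm (G x) \<le> 1 + (norm (G x))\<^sup>2" for x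
      using abs_mult_le_squares[of 1 "norm (G x)"] by simp
    then show "AE x in N. norm (G x) \<le> norm (1 + (norm (G x))\<^sup>2)" by (intro AE_I2) (auto intro: order_trans)
  qed (use G in simp)
qed

lemma weak_gradient_product_test:
  fixes \<gamma> \<gamma>' :: "'n \<Rightarrow> real \<Rightarrow> real"
  assumes f: "integrable N f" and G: "has_weak_gradient M f G"
    and d: "\<And>i t. (\<gamma> i has_real_derivative \<gamma>' i t) (at t)" and cont: "\<And>i. continuous_on UNIV (\<gamma>' i)"
    and supp: "\<And>i t. t \<notin> {a $ i..b $ i} \<Longrightarrow> \<gamma> i t = 0" and box: "cbox a b \<subseteq> interior M"
  shows "(LINT x:interior M|lborel. f x * (\<gamma>' j (x $ j) * (\<Prod>i\<in>UNIV - {j}. \<gamma> i (x $ i)))) =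
     - (LINT x:interior M|lborel. (\<Prod>i\<in>UNIV. \<gamma> i (x $ i)) * (G x $ j))"
proof -
  define \<phi> where "\<phi> = (\<lambda>x::real^'n. \<Prod>i\<in>UNIV. \<gamma> i (x $ i))"
  define D where "D = (\<lambda>x::real^'n. \<chi> j. \<gamma>' j (x $ j) * (\<Prod>i\<in>UNIV - {j}. \<gamma> i (x $ i)))"
  have c\<gamma>: "continuous_on UNIV (\<gamma> i)" for i
    using d DERIV_continuous_on by (metis DERIV_subset subset_UNIV)
  have comp: "continuous_on UNIV (\<lambda>x::real^'n. g (x $ i))" if "continuous_on UNIV g" for g :: "real \<Rightarrow> real" and i
    by (rule continuous_on_compose2[OF that]) (auto intro: continuous_intros)
  have Dj: "continuous_on UNIV (\<lambda>x. D x $ j)" for j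
    unfolding D_def by (auto intro!: continuous_on_mult continuous_on_prod comp cont c\<gamma>)
  have cD: "continuous_on UNIV D"
    unfolding D_def by (intro continuous_on_vec_lambda continuous_on_mult continuous_on_prod comp cont c\<gamma>)
  have c\<phi>: "continuous_on UNIV \<phi>"
    unfolding \<phi>_def by (intro continuous_on_prod comp c\<gamma>)
  have sub: "{x. \<phi> x \<noteq> 0} \<subseteq> cbox a b"
  proof
    fix x assume "x \<in> {x. \<phi> x \<noteq> 0}"
    then have "\<gamma> i (x $ i) \<noteq> 0" for i by (auto simp: \<phi>_def)
    then have "x $ i \<in> {a $ i..b $ i}" for i using supp by blast
    then show "x \<in> cbox a b" by (simp add: mem_box_cart)
  qed
  then have cl: "closure {x. \<phi> x \<noteq> 0} \<subseteq> cbox a b" by (rule closure_minimal) (rule closed_cbox)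
  then have "compact (closure {x. \<phi> x \<noteq> 0})"
    by (meson bounded_cbox bounded_subset closed_closure compact_eq_bounded_closed)
  moreover have "closure {x. \<phi> x \<noteq> 0} \<subseteq> interior M" using cl box by blast
  moreover have "\<forall>x. GDERIV \<phi> x :> D x"
    unfolding \<phi>_def D_def using GDERIV_prod_components[where \<gamma> = \<gamma> and \<gamma>' = \<gamma>', OF d] by blast
  ultimately have eq: "(LINT x:interior M|lborel. f x *\<^sub>R D x) = - (LINT x:interior M|lborel. \<phi> x *\<^sub>R G x)"
    using G cD unfolding has_weak_gradient_def by blast
  have fD: "set_integrable lborel (interior M) (\<lambda>x. f x *\<^sub>R D x)"
  proof -
    have "set_integrable lborel (interior M) (\<lambda>x. \<Sum>k\<in>UNIV. D x $ k *\<^sub>R (f x *\<^sub>R (axis k 1 :: real^'n)))"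
      unfolding set_integrable_def scaleR_sum_right
      by (intro Bochner_Integration.integrable_sum integrable_interior_scaleR_continuous[unfolded set_integrable_def] Dj)
         (use f in simp)
    moreover have "(\<lambda>x. \<Sum>k\<in>UNIV. D x $ k *\<^sub>R (f x *\<^sub>R (axis k 1 :: real^'n))) = (\<lambda>x. f x *\<^sub>R D x)"
      by (simp add: fun_eq_iff vec_eq_iff axis_def if_distrib[of "\<lambda>u. _ * u"] cong: if_cong)
    ultimately show ?thesis by (simp only:)
  qed
  have \<phi>G: "set_integrable lborel (interior M) (\<lambda>x. \<phi> x *\<^sub>R G x)"
    by (rule integrable_interior_scaleR_continuous[OF integrable_N_weak_gradient[OF G] c\<phi>])
  have nth: "(LINT x:interior M|lborel. F x) $ j = (LINT x:interior M|lborel. F x $ j)"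
    if "set_integrable lborel (interior M) F" for F :: "real^'n \<Rightarrow> real^'n"
    using integral_bounded_linear[OF bounded_linear_vec_nth that[unfolded set_integrable_def], of j]
    by (simp add: set_lebesgue_integral_def)
  show ?thesis
    using arg_cong[OF eq, of "\<lambda>v. v $ j"] nth[OF fD] nth[OF \<phi>G] by (simp add: D_def \<phi>_def)
qed

text \<open>A bump of integral one on the box with lower corner \<open>w\<close> and side lengths \<open>3 * r $ i\<close>. The width depends
  on the coordinate because two bumps are compared by changing one coordinate at a time.\<close>

definition bump :: "real^'n \<Rightarrow> real^'n \<Rightarrow> real^'n \<Rightarrow> real" where
  "bump w r x = (\<Prod>i\<in>UNIV. bspline ((x $ i - w $ i) / r $ i) / r $ i)"

definition bump_mean :: "(real^'n \<Rightarrow> real) \<Rightarrow> real^'n \<Rightarrow> real^'n \<Rightarrow> real" where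
  "bump_mean f w r = (LINT x:interior M|lborel. f x * bump w r x)"

lemma bump_nonneg: "(\<And>i. 0 < r $ i) \<Longrightarrow> 0 \<le> bump w r x"
  unfolding bump_def by (intro prod_nonneg) (auto intro!: divide_nonneg_pos bspline_nonneg)

lemma bump_le:
  assumes "0 < \<rho>" "\<And>i. \<rho> \<le> r $ i"
  shows "bump w r x \<le> (1 / \<rho>) ^ CARD('n)"
proof -
  have "bump w r x \<le> (\<Prod>i\<in>(UNIV::'n set). 1 / \<rho>)"
    unfolding bump_def
  proof (rule prod_mono)
    fix i :: 'n
    have "0 < r $ i" using assms(1) assms(2)[of i] by linarith
    then show "0 \<le> bspline ((x $ i - w $ i) / r $ i) / r $ i \<and> bspline ((x $ i - w $ i) / r $ i) / r $ i \<le> 1 / \<rho>"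
      using bspline_nonneg bspline_le_1 assms(1) assms(2)[of i] by (auto intro!: frac_le)
  qed
  then show ?thesis by simp
qed

lemma bump_eq_0:
  assumes "\<And>i. 0 < r $ i" "x $ i \<notin> {w $ i..w $ i + 3 * r $ i}"
  shows "bump w r x = 0"
proof -
  have "(x $ i - w $ i) / r $ i \<le> 0 \<or> 3 \<le> (x $ i - w $ i) / r $ i"
    using assms(1)[of i] assms(2) by (auto simp: field_simps)
  then have "bspline ((x $ i - w $ i) / r $ i) = 0" by (rule bspline_eq_0)
  then show ?thesis unfolding bump_def by (intro prod_zero) auto
qed

lemma continuous_bump: "(\<And>i. 0 < r $ i) \<Longrightarrow> continuous_on UNIV (bump w r)"
  unfolding bump_def[abs_def]
  by (intro continuous_on_prod continuous_on_divide continuous_on_compose2[OF continuous_bspline] continuous_intros)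
     (auto simp: less_imp_neq[symmetric])

lemma integral_box_norm_square_le:
  fixes G :: "real^'n \<Rightarrow> real^'n"
  assumes G: "G \<in> borel_measurable N" "integrable N (\<lambda>x. (norm (G x))\<^sup>2)" and Q: "cbox a b \<subseteq> interior M"
  shows "(LINT x:cbox a b|lborel. norm (G x))\<^sup>2 \<le> measure lborel (cbox a b) * (LINT x:cbox a b|lborel. (norm (G x))\<^sup>2)"
proof -
  let ?Q = "cbox a b"
  have QM: "?Q \<subseteq> M" using Q interior_subset[of M] by blast
  have i: "set_integrable lborel ?Q (\<lambda>x. (norm (G x))\<^sup>2)"
    by (rule set_integrable_subset[OF G(2)[unfolded integrable_N] _ QM]) simp
  have m: "(\<lambda>x. indicator ?Q x *\<^sub>R norm (G x)) \<in> borel_measurable lborel"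
  proof -
    have "(\<lambda>x. norm (G x)) \<in> borel_measurable (restrict_space lborel M)" using G(1)[unfolded measurable_N] by measurable
    then have "(\<lambda>x. indicator M x *\<^sub>R norm (G x)) \<in> borel_measurable lborel"
      by (subst (asm) borel_measurable_restrict_space_iff) simp_all
    then have "(\<lambda>x. indicator ?Q x *\<^sub>R (indicator M x *\<^sub>R norm (G x))) \<in> borel_measurable lborel"
      by measurable
    moreover have "(\<lambda>x. indicator ?Q x *\<^sub>R (indicator M x *\<^sub>R norm (G x))) = (\<lambda>x. indicator ?Q x *\<^sub>R norm (G x))"
      using QM by (auto simp: indicator_def fun_eq_iff)
    ultimately show ?thesis by simp
  qed
  define u where "u = (indicator ?Q :: real^'n \<Rightarrow> real)"
  define v where "v = (\<lambda>x. indicator ?Q x *\<^sub>R norm (G x))"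
  have uu: "(u x)\<^sup>2 = u x" "u x * v x = v x" "(v x)\<^sup>2 = indicator ?Q x *\<^sub>R (norm (G x))\<^sup>2" "u x * u x = u x" for x
    by (auto simp: u_def v_def indicator_def)
  have vv: "v x * v x = indicator ?Q x *\<^sub>R (norm (G x))\<^sup>2" for x using uu(3) by (simp add: power2_eq_square)
  have "integrable lborel u" unfolding u_def by (rule integrable_real_indicator) (use emeasure_lborel_cbox_finite[of a b] in simp_all)
  then have u: "u \<in> sqint lborel" unfolding sqint_def by (simp add: uu(1))
  have v: "v \<in> sqint lborel" unfolding sqint_def using m i by (simp add: uu(3) set_integrable_def) (simp add: v_def)
  have "(ip lborel u v)\<^sup>2 \<le> ip lborel u u * ip lborel v v" by (rule ip_Cauchy_Schwarz[OF u v])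
  moreover have "ip lborel u u = measure lborel ?Q" unfolding ip_def uu by (simp add: u_def)
  ultimately show ?thesis
    unfolding ip_def uu vv by (simp add: v_def set_lebesgue_integral_def)
qed

text \<open>When only the \<open>j\<close>-th parameters differ, the difference of the bumps is the \<open>j\<close>-th partial derivative of
  a product whose \<open>j\<close>-th factor is the difference of two B-spline primitives. Both primitives rise from
  zero to one, so this factor has compact support and the weak gradient may be tested against it.\<close>

lemma bump_mean_change_coordinate:
  fixes w r w' r' a b :: "real^'n"
  assumes f: "integrable N f" and G: "has_weak_gradient M f G" and box: "cbox a b \<subseteq> interior M"
    and \<rho>: "0 < \<rho>" "\<And>i. \<rho> \<le> r $ i" "\<And>i. \<rho> \<le> r' $ i"
    and in_box: "\<And>i. a $ i \<le> w $ i \<and> w $ i + 3 * r $ i \<le> b $ i" "\<And>i. a $ i \<le> w' $ i \<and> w' $ i + 3 * r' $ i \<le> b $ i"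
    and same: "\<And>i. i \<noteq> j \<Longrightarrow> w' $ i = w $ i \<and> r' $ i = r $ i"
    and side: "\<And>i. b $ i - a $ i \<le> l"
  shows "\<bar>bump_mean f w r - bump_mean f w' r'\<bar> \<le>
    sqrt (((1 / \<rho>) ^ (CARD('n) - 1))\<^sup>2 * l ^ CARD('n) * (LINT x:cbox a b|lborel. (norm (G x))\<^sup>2))"
proof -
  have rp: "0 < r $ i" "0 < r' $ i" for i using \<rho>(1) \<rho>(2)[of i] \<rho>(3)[of i] by linarith+
  let ?S = "\<lambda>w r t. bspline_prim ((t - w) / r)" and ?B = "\<lambda>w r t. bspline ((t - w) / r) / r"
  define \<gamma> where "\<gamma> = (\<lambda>i. if i = j then (\<lambda>t. ?S (w $ j) (r $ j) t - ?S (w' $ j) (r' $ j) t) else ?B (w $ i) (r $ i))"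
  define \<gamma>' where "\<gamma>' = (\<lambda>i. if i = j then (\<lambda>t. ?B (w $ j) (r $ j) t - ?B (w' $ j) (r' $ j) t)
      else (\<lambda>t. bspline_deriv ((t - w $ i) / r $ i) / r $ i / r $ i))"
  have lin: "((\<lambda>t. (t - c) / s) has_real_derivative 1 / s) (at t)" for c s t :: real
    by (cases "s = 0") (auto intro!: derivative_eq_intros)
  have dS: "(?S c s has_real_derivative ?B c s t) (at t)" for c s t
    using DERIV_chain2[OF bspline_prim_has_derivative lin[of c s t]] by simp
  have dB: "(?B c s has_real_derivative bspline_deriv ((t - c) / s) / s / s) (at t)" for c s t
    using DERIV_cdivide[OF DERIV_chain2[OF bspline_has_derivative lin[of c s t]], of s] by simp
  have d: "(\<gamma> i has_real_derivative \<gamma>' i t) (at t)" for i t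
    unfolding \<gamma>_def \<gamma>'_def using dS dB by (auto intro!: DERIV_diff)
  have cB: "continuous_on UNIV (?B c s)" for c s
    by (cases "s = 0") (auto intro!: continuous_intros continuous_on_compose2[OF continuous_bspline])
  have cB': "continuous_on UNIV (\<lambda>t. bspline_deriv ((t - c) / s) / s / s)" for c s
    by (cases "s = 0") (auto intro!: continuous_intros continuous_on_compose2[OF continuous_bspline_deriv])
  have cont: "continuous_on UNIV (\<gamma>' i)" for i
    unfolding \<gamma>'_def using cB cB' by (auto intro!: continuous_on_diff)
  have low: "(t - w $ i) / r $ i \<le> 0" "(t - w' $ i) / r' $ i \<le> 0" if "t < a $ i" for t i
    using that in_box(1)[of i] in_box(2)[of i] rp[of i] by (auto simp: divide_le_0_iff)
  have high: "3 \<le> (t - w $ i) / r $ i" "3 \<le> (t - w' $ i) / r' $ i" if "b $ i < t" for t i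
    using that in_box(1)[of i] in_box(2)[of i] rp[of i] by (auto simp: le_divide_eq)
  have supp: "\<gamma> i t = 0" if "t \<notin> {a $ i..b $ i}" for i t
  proof -
    consider "t < a $ i" | "b $ i < t" using \<open>t \<notin> {a $ i..b $ i}\<close> by fastforce
    then show ?thesis
    proof cases
      case 1
      then show ?thesis using low[of t i] by (auto simp: \<gamma>_def bspline_eq_0 bspline_prim_eq)
    next
      case 2
      then show ?thesis using high[of i t] by (auto simp: \<gamma>_def bspline_eq_0 bspline_prim_eq)
    qed
  qed
  define \<psi> where "\<psi> = (\<lambda>x::real^'n. \<Prod>i\<in>UNIV. \<gamma> i (x $ i))"
  have diff: "\<gamma>' j (x $ j) * (\<Prod>i\<in>UNIV - {j}. \<gamma> i (x $ i)) = bump w r x - bump w' r' x" for x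
  proof -
    have "(\<Prod>i\<in>UNIV - {j}. \<gamma> i (x $ i)) = (\<Prod>i\<in>UNIV - {j}. ?B (w $ i) (r $ i) (x $ i))"
      by (intro prod.cong) (auto simp: \<gamma>_def)
    moreover have "(\<Prod>i\<in>UNIV - {j}. ?B (w' $ i) (r' $ i) (x $ i)) = (\<Prod>i\<in>UNIV - {j}. ?B (w $ i) (r $ i) (x $ i))"
      using same by (intro prod.cong) auto
    ultimately show ?thesis
      unfolding bump_def using prod.remove[of UNIV j "\<lambda>i. ?B (w $ i) (r $ i) (x $ i)"] prod.remove[of UNIV j "\<lambda>i. ?B (w' $ i) (r' $ i) (x $ i)"]
      by (simp add: \<gamma>'_def left_diff_distrib)
  qed
  have \<psi>_le: "\<bar>\<psi> x\<bar> \<le> (1 / \<rho>) ^ (CARD('n) - 1)" for x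
  proof -
    have "\<bar>\<psi> x\<bar> = \<bar>\<gamma> j (x $ j)\<bar> * (\<Prod>i\<in>UNIV - {j}. \<bar>\<gamma> i (x $ i)\<bar>)"
      unfolding \<psi>_def using prod.remove[of UNIV j "\<lambda>i. \<gamma> i (x $ i)"] by (simp add: abs_mult abs_prod)
    also have "\<dots> \<le> 1 * (\<Prod>i\<in>UNIV - {j}. 1 / \<rho>)"
    proof (intro mult_mono prod_mono)
      show "\<bar>\<gamma> j (x $ j)\<bar> \<le> 1"
        using bspline_prim_bounds[of "(x $ j - w $ j) / r $ j"] bspline_prim_bounds[of "(x $ j - w' $ j) / r' $ j"]
        by (simp add: \<gamma>_def)
      fix i assume "i \<in> UNIV - {j}"
      then show "0 \<le> \<bar>\<gamma> i (x $ i)\<bar> \<and> \<bar>\<gamma> i (x $ i)\<bar> \<le> 1 / \<rho>"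
        using bspline_nonneg[of "(x $ i - w $ i) / r $ i"] bspline_le_1[of "(x $ i - w $ i) / r $ i"] \<rho>(1) \<rho>(2)[of i] rp(1)[of i]
        by (auto simp: \<gamma>_def intro!: frac_le)
    qed (auto intro: prod_nonneg)
    finally show ?thesis by (simp add: card_Diff_singleton)
  qed
  have \<psi>_0: "\<psi> x = 0" if "x \<notin> cbox a b" for x
  proof -
    obtain i where "x $ i \<notin> {a $ i..b $ i}" using \<open>x \<notin> cbox a b\<close> by (auto simp: mem_box_cart)
    then show ?thesis unfolding \<psi>_def by (intro prod_zero) (auto intro!: bexI[of _ i] supp)
  qed
  have c\<gamma>: "continuous_on UNIV (\<gamma> i)" for i
    using d DERIV_continuous_on by (metis DERIV_subset subset_UNIV)
  have c\<psi>: "continuous_on UNIV \<psi>"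
    unfolding \<psi>_def by (intro continuous_on_prod continuous_on_compose2[OF c\<gamma>]) (auto intro: continuous_intros)
  have "bump_mean f w r - bump_mean f w' r' = (LINT x:interior M|lborel. f x * (bump w r x - bump w' r' x))"
  proof -
    have "set_integrable lborel (interior M) (\<lambda>x. f x * bump w r x)" "set_integrable lborel (interior M) (\<lambda>x. f x * bump w' r' x)"
      using integrable_interior_scaleR_continuous[OF f continuous_bump] rp by (simp_all add: mult.commute)
    then show ?thesis unfolding bump_mean_def by (simp add: right_diff_distrib set_integral_diff)
  qed
  also have "\<dots> = - (LINT x:interior M|lborel. \<psi> x * (G x $ j))"
    using weak_gradient_product_test[where \<gamma> = \<gamma> and \<gamma>' = \<gamma>' and j = j, OF f G d cont supp box] by (simp add: diff \<psi>_def)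
  finally have eq: "\<bar>bump_mean f w r - bump_mean f w' r'\<bar> = \<bar>LINT x:interior M|lborel. \<psi> x * (G x $ j)\<bar>" by simp
  let ?K = "(1 / \<rho>) ^ (CARD('n) - 1)"
  have QM: "cbox a b \<subseteq> M" using box interior_subset[of M] by blast
  have GN: "G \<in> borel_measurable N" "integrable N (\<lambda>x. (norm (G x))\<^sup>2)" using G by (auto simp: has_weak_gradient_def)
  have nG: "set_integrable lborel (cbox a b) (\<lambda>x. norm (G x))"
    using set_integrable_subset[OF integrable_norm[OF integrable_N_weak_gradient[OF G], unfolded integrable_N] _ QM] by simp
  have "\<bar>LINT x:interior M|lborel. \<psi> x * (G x $ j)\<bar> \<le> ?K * (LINT x:cbox a b|lborel. norm (G x))"
  proof -
    have "integrable N (\<lambda>x. G x $ j)"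
      by (rule integrable_bounded_linear[OF bounded_linear_vec_nth integrable_N_weak_gradient[OF G]])
    then have i: "set_integrable lborel (interior M) (\<lambda>x. \<psi> x * (G x $ j))"
      using integrable_interior_scaleR_continuous[of "\<lambda>x. G x $ j" \<psi>] c\<psi> by simp
    have "\<bar>LINT x:interior M|lborel. \<psi> x * (G x $ j)\<bar> \<le> (\<integral>x. norm (indicator (interior M) x *\<^sub>R (\<psi> x * (G x $ j))) \<partial>lborel)"
      unfolding set_lebesgue_integral_def real_norm_def[symmetric] by (rule integral_norm_bound)
    also have "\<dots> \<le> (\<integral>x. ?K * (indicator (cbox a b) x *\<^sub>R norm (G x)) \<partial>lborel)"
    proof (rule integral_mono)
      show "integrable lborel (\<lambda>x. norm (indicator (interior M) x *\<^sub>R (\<psi> x * (G x $ j))))"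
        using i unfolding set_integrable_def by (rule integrable_norm)
      show "integrable lborel (\<lambda>x. ?K * (indicator (cbox a b) x *\<^sub>R norm (G x)))"
        using nG unfolding set_integrable_def by (rule integrable_mult_right)
      fix x
      show "norm (indicator (interior M) x *\<^sub>R (\<psi> x * (G x $ j))) \<le> ?K * (indicator (cbox a b) x *\<^sub>R norm (G x))"
      proof (cases "x \<in> cbox a b")
        case True
        then have "norm (indicator (interior M) x *\<^sub>R (\<psi> x * (G x $ j))) = \<bar>\<psi> x\<bar> * \<bar>G x $ j\<bar>"
          using box by (auto simp: abs_mult)
        also have "\<dots> \<le> ?K * norm (G x)"
          using \<psi>_le[of x] component_le_norm_cart[of "G x" j] \<rho>(1) by (intro mult_mono) auto
        finally show ?thesis using True by simp
      qed (simp add: \<psi>_0)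
    qed
    also have "\<dots> = ?K * (LINT x:cbox a b|lborel. norm (G x))"
      by (simp add: set_lebesgue_integral_def)
    finally show ?thesis .
  qed
  also have "\<dots> = sqrt (?K\<^sup>2 * (LINT x:cbox a b|lborel. norm (G x))\<^sup>2)"
  proof -
    have "0 \<le> (LINT x:cbox a b|lborel. norm (G x))"
      unfolding set_lebesgue_integral_def by (intro integral_nonneg_AE) auto
    then show ?thesis using \<rho>(1) by (simp add: real_sqrt_mult)
  qed
  also have "\<dots> \<le> sqrt (?K\<^sup>2 * l ^ CARD('n) * (LINT x:cbox a b|lborel. (norm (G x))\<^sup>2))"
  proof -
    have vol: "measure lborel (cbox a b) \<le> l ^ CARD('n)"
    proof -
      have ab: "a $ i \<le> b $ i" for i using in_box(1)[of i] rp(1)[of i] by linarith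
      then have "cbox a b \<noteq> {}" by (simp add: interval_ne_empty_cart)
      then have "measure lborel (cbox a b) = (\<Prod>i\<in>UNIV. b $ i - a $ i)" by (rule content_cbox_cart)
      also have "\<dots> \<le> (\<Prod>i\<in>(UNIV::'n set). l)" using side ab by (intro prod_mono) (simp add: le_diff_eq)
      finally show ?thesis by simp
    qed
    have nn: "0 \<le> (LINT x:cbox a b|lborel. (norm (G x))\<^sup>2)"
      unfolding set_lebesgue_integral_def by (intro integral_nonneg_AE) auto
    have "(LINT x:cbox a b|lborel. norm (G x))\<^sup>2 \<le> l ^ CARD('n) * (LINT x:cbox a b|lborel. (norm (G x))\<^sup>2)"
      using integral_box_norm_square_le[OF GN box] mult_right_mono[OF vol nn] by linarith
    then show ?thesis unfolding mult.assoc by (intro real_sqrt_le_mono mult_left_mono) auto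
  qed
  finally show ?thesis unfolding eq .
qed

text \<open>The coordinates are changed one after the other inside the same box.\<close>

lemma bump_mean_change:
  fixes w r w' r' a b :: "real^'n"
  assumes f: "integrable N f" and G: "has_weak_gradient M f G" and box: "cbox a b \<subseteq> interior M"
    and \<rho>: "0 < \<rho>" "\<And>i. \<rho> \<le> r $ i" "\<And>i. \<rho> \<le> r' $ i"
    and in_box: "\<And>i. a $ i \<le> w $ i \<and> w $ i + 3 * r $ i \<le> b $ i" "\<And>i. a $ i \<le> w' $ i \<and> w' $ i + 3 * r' $ i \<le> b $ i"
    and side: "\<And>i. b $ i - a $ i \<le> l"
  shows "(bump_mean f w r - bump_mean f w' r')\<^sup>2 \<le>
    (real CARD('n))\<^sup>2 * (((1 / \<rho>) ^ (CARD('n) - 1))\<^sup>2 * l ^ CARD('n) * (LINT x:cbox a b|lborel. (norm (G x))\<^sup>2))"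
    (is "_ \<le> _ * ?X")
proof -
  define mix where "mix = (\<lambda>(u::real^'n) v S. \<chi> i. if i \<in> S then v $ i else u $ i)"
  have step: "\<bar>bump_mean f w r - bump_mean f (mix w w' S) (mix r r' S)\<bar> \<le> real (card S) * sqrt ?X" if "finite S" for S
    using that
  proof (induction S rule: finite_induct)
    case empty
    have "mix u v {} = u" for u v by (simp add: mix_def vec_eq_iff)
    then show ?case by simp
  next
    case (insert j S)
    have "\<bar>bump_mean f (mix w w' S) (mix r r' S) - bump_mean f (mix w w' (insert j S)) (mix r r' (insert j S))\<bar> \<le> sqrt ?X"
      by (rule bump_mean_change_coordinate[OF f G box \<rho>(1) _ _ _ _ _ side, of _ _ _ _ j])
         (use \<rho> in_box in \<open>auto simp: mix_def\<close>)
    then show ?case using insert by (simp add: distrib_right)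
  qed
  have "mix u v UNIV = v" for u v by (simp add: mix_def vec_eq_iff)
  then have "\<bar>bump_mean f w r - bump_mean f w' r'\<bar> \<le> real CARD('n) * sqrt ?X" using step[of UNIV] by simp
  then have "\<bar>bump_mean f w r - bump_mean f w' r'\<bar>\<^sup>2 \<le> (real CARD('n) * sqrt ?X)\<^sup>2" by (intro power_mono) auto
  moreover have "0 \<le> ?X"
  proof -
    have "0 \<le> (LINT x:cbox a b|lborel. (norm (G x))\<^sup>2)"
      unfolding set_lebesgue_integral_def by (intro integral_nonneg_AE) auto
    moreover have "0 \<le> l" using side[of undefined] in_box(1)[of undefined] \<rho>(1) \<rho>(2)[of undefined] by linarith
    ultimately show ?thesis by simp
  qed
  ultimately show ?thesis by (simp add: power_mult_distrib)
qed

end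

section \<open>Interior cones\<close>

text \<open>The image is open by invariance of domain, and by expansion it is relatively closed in the ball
  about \<open>\<Phi> b\<close>; the ball is connected.\<close>

lemma expanding_map_image_contains_ball:
  fixes \<Phi> :: "'a::euclidean_space \<Rightarrow> 'a"
  assumes cont: "continuous_on (ball b t) \<Phi>" and L: "0 < L" and t: "0 < t"
    and expand: "\<And>y z. y \<in> ball b t \<Longrightarrow> z \<in> ball b t \<Longrightarrow> dist y z / L \<le> dist (\<Phi> y) (\<Phi> z)"
  shows "ball (\<Phi> b) (t / L) \<subseteq> \<Phi> ` ball b t"
proof
  fix z assume z: "z \<in> ball (\<Phi> b) (t / L)"
  obtain r where r: "dist (\<Phi> b) z < r" "r < t / L" using dense[of "dist (\<Phi> b) z" "t / L"] z by auto
  have r0: "0 < r" using r(1) zero_le_dist[of "\<Phi> b" z] by linarith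
  have inj: "inj_on \<Phi> (ball b t)"
  proof (rule inj_onI)
    fix y y' assume "y \<in> ball b t" "y' \<in> ball b t" "\<Phi> y = \<Phi> y'"
    then have "dist y y' / L \<le> 0" using expand[of y y'] by simp
    then have "dist y y' \<le> 0" using L by (simp add: divide_le_0_iff)
    then show "y = y'" by simp
  qed
  have O: "open (\<Phi> ` ball b t)" using invariance_of_domain[OF cont open_ball inj] .
  have Lr: "L * r < t" using r(2) L by (simp add: field_simps)
  have K: "closed (\<Phi> ` cball b (L * r))"
    using Lr by (intro compact_imp_closed compact_continuous_image continuous_on_subset[OF cont]) auto
  have sub: "ball (\<Phi> b) r \<inter> \<Phi> ` ball b t = ball (\<Phi> b) r \<inter> \<Phi> ` cball b (L * r)"
  proof (rule subset_antisym; rule subsetI)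
    fix u assume "u \<in> ball (\<Phi> b) r \<inter> \<Phi> ` ball b t"
    then obtain y where y: "y \<in> ball b t" "u = \<Phi> y" "dist (\<Phi> b) (\<Phi> y) < r" by auto
    have "dist b y / L < r" using expand[of b y] y t by auto
    then have "dist b y \<le> L * r" using L by (simp add: field_simps)
    then show "u \<in> ball (\<Phi> b) r \<inter> \<Phi> ` cball b (L * r)" using y by auto
  next
    fix u assume "u \<in> ball (\<Phi> b) r \<inter> \<Phi> ` cball b (L * r)"
    then show "u \<in> ball (\<Phi> b) r \<inter> \<Phi> ` ball b t" using Lr by auto
  qed
  have "openin (top_of_set (ball (\<Phi> b) r)) (ball (\<Phi> b) r \<inter> \<Phi> ` ball b t)"
    using O by (rule openin_open_Int)
  moreover have "closedin (top_of_set (ball (\<Phi> b) r)) (ball (\<Phi> b) r \<inter> \<Phi> ` ball b t)"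
    unfolding sub using K by (rule closedin_closed_Int)
  moreover have "\<Phi> b \<in> ball (\<Phi> b) r \<inter> \<Phi> ` ball b t" using r0 t by auto
  ultimately have "ball (\<Phi> b) r \<inter> \<Phi> ` ball b t = ball (\<Phi> b) r"
    using connected_ball[of "\<Phi> b" r] unfolding connected_clopen by blast
  then show "z \<in> \<Phi> ` ball b t" using r(1) by auto
qed

text \<open>A model of a bi-Lipschitz image of a solid cone with apex \<open>x\<close>: the Lipschitz axis \<open>w\<close> recedes from \<open>x\<close> at linear rate,
  and about each of its points \<open>M\<close> contains a ball of radius proportional to the distance from \<open>x\<close>.\<close>

definition interior_cone :: "'a::euclidean_space set \<Rightarrow> real \<Rightarrow> real \<Rightarrow> 'a \<Rightarrow> (real \<Rightarrow> 'a) \<Rightarrow> bool" where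
  "interior_cone M L s x w \<longleftrightarrow>
     (\<forall>t\<in>{0<..s}. t / L \<le> dist x (w t) \<and> dist x (w t) \<le> L * t \<and> ball (w t) (t / L) \<subseteq> M) \<and>
     (\<forall>t\<in>{0<..s}. \<forall>u\<in>{0<..s}. dist (w t) (w u) \<le> L * \<bar>t - u\<bar>)"

lemma interior_cone_mono: "interior_cone M L s x w \<Longrightarrow> s' \<le> s \<Longrightarrow> interior_cone M L s' x w"
  unfolding interior_cone_def by auto

text \<open>The axis is the preimage of the ray from \<open>\<Psi> x\<close> in direction \<open>e\<close>; the balls of radius \<open>t\<close> about the
  points of that ray have preimages that contain balls of radius \<open>t / L\<close>.\<close>

lemma chart_interior_cone:
  fixes \<Psi> :: "'a::euclidean_space \<Rightarrow> 'a"
  assumes U: "U \<subseteq> M" "x \<in> U" and L: "1 \<le> L"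
    and lip: "\<And>a b. a \<in> U \<Longrightarrow> b \<in> U \<Longrightarrow> dist a b / L \<le> dist (\<Psi> a) (\<Psi> b) \<and> dist (\<Psi> a) (\<Psi> b) \<le> L * dist a b"
    and e: "norm e = 1" and room: "\<And>t. 0 < t \<Longrightarrow> t \<le> s \<Longrightarrow> ball (\<Psi> x + t *\<^sub>R e) t \<subseteq> \<Psi> ` U"
  shows "\<exists>w. interior_cone M L s x w"
proof -
  define \<Phi> where "\<Phi> = inv_into U \<Psi>"
  have inj: "inj_on \<Psi> U"
  proof (rule inj_onI)
    fix a b assume "a \<in> U" "b \<in> U" "\<Psi> a = \<Psi> b"
    then have "dist a b / L \<le> 0" using lip[of a b] by simp
    then have "dist a b \<le> 0" using L by (simp add: divide_le_0_iff)
    then show "a = b" by simp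
  qed
  have \<Phi>U: "\<Phi> y \<in> U" "\<Psi> (\<Phi> y) = y" if "y \<in> \<Psi> ` U" for y
    using that unfolding \<Phi>_def by (auto intro: inv_into_into f_inv_into_f)
  have \<Phi>x: "\<Phi> (\<Psi> x) = x" unfolding \<Phi>_def using inj U(2) by simp
  have up: "dist (\<Phi> y) (\<Phi> z) \<le> L * dist y z" if "y \<in> \<Psi> ` U" "z \<in> \<Psi> ` U" for y z
    using lip[OF \<Phi>U(1)[OF that(1)] \<Phi>U(1)[OF that(2)]] \<Phi>U(2)[OF that(1)] \<Phi>U(2)[OF that(2)] L
    by (simp add: field_simps)
  have low: "dist y z / L \<le> dist (\<Phi> y) (\<Phi> z)" if "y \<in> \<Psi> ` U" "z \<in> \<Psi> ` U" for y z
    using lip[OF \<Phi>U(1)[OF that(1)] \<Phi>U(1)[OF that(2)]] \<Phi>U(2)[OF that(1)] \<Phi>U(2)[OF that(2)] L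
    by (simp add: field_simps)
  define b where "b t = \<Psi> x + t *\<^sub>R e" for t
  have bU: "b t \<in> \<Psi> ` U" if "0 < t" "t \<le> s" for t
    using room[OF that] that by (auto simp: b_def)
  have \<Psi>x: "\<Psi> x \<in> \<Psi> ` U" using U(2) by simp
  have db: "dist (\<Psi> x) (b t) = t" if "0 < t" for t using that e by (simp add: b_def dist_norm)
  have "interior_cone M L s x (\<lambda>t. \<Phi> (b t))"
    unfolding interior_cone_def
  proof (intro conjI ballI)
    fix t assume "t \<in> {0<..s}"
    then have t: "0 < t" "t \<le> s" by auto
    show "t / L \<le> dist x (\<Phi> (b t))" using low[OF \<Psi>x bU[OF t]] db[OF t(1)] \<Phi>x by simp
    show "dist x (\<Phi> (b t)) \<le> L * t" using up[OF \<Psi>x bU[OF t]] db[OF t(1)] \<Phi>x by simp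
    have room': "ball (b t) t \<subseteq> \<Psi> ` U" using room[OF t] by (simp add: b_def)
    have "L-lipschitz_on (ball (b t) t) \<Phi>"
      using up room' L by (intro lipschitz_onI) (auto simp: subset_iff)
    then have "ball (\<Phi> (b t)) (t / L) \<subseteq> \<Phi> ` ball (b t) t"
      using room' low t L by (intro expanding_map_image_contains_ball lipschitz_on_continuous_on) (auto simp: subset_iff)
    also have "\<dots> \<subseteq> M" using room' \<Phi>U(1) U(1) by blast
    finally show "ball (\<Phi> (b t)) (t / L) \<subseteq> M" .
  next
    fix t u assume "t \<in> {0<..s}" "u \<in> {0<..s}"
    then have "dist (\<Phi> (b t)) (\<Phi> (b u)) \<le> L * dist (b t) (b u)" using up bU by auto
    also have "dist (b t) (b u) = \<bar>t - u\<bar>" using e by (simp add: b_def dist_norm flip: scaleR_diff_left)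
    finally show "dist (\<Phi> (b t)) (\<Phi> (b u)) \<le> L * \<bar>t - u\<bar>" .
  qed
  then show ?thesis by blast
qed

lemma ball_in_half_ball:
  fixes a c e :: "'a::euclidean_space"
  assumes e: "norm e = 1" and t: "0 < t" and a: "dist c a + 2 * t \<le> R" and y: "y \<in> ball (a + t *\<^sub>R e) t"
  shows "y \<in> ball c R" "0 \<le> e \<bullet> (a - c) \<Longrightarrow> 0 \<le> e \<bullet> (y - c)"
proof -
  have "dist c y \<le> dist c a + (dist a (a + t *\<^sub>R e) + dist (a + t *\<^sub>R e) y)"
    using dist_triangle[of c y a] dist_triangle[of a y "a + t *\<^sub>R e"] by linarith
  moreover have "dist a (a + t *\<^sub>R e) = t" using e t by (simp add: dist_norm)
  ultimately show "y \<in> ball c R" using y a by auto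
  assume "0 \<le> e \<bullet> (a - c)"
  moreover have "\<bar>e \<bullet> (y - (a + t *\<^sub>R e))\<bar> \<le> norm (y - (a + t *\<^sub>R e))"
    using Cauchy_Schwarz_ineq2[of e "y - (a + t *\<^sub>R e)"] e by simp
  moreover have "norm (y - (a + t *\<^sub>R e)) < t" using y by (simp add: dist_norm norm_minus_commute)
  moreover have "e \<bullet> e = 1" using e by (simp add: dot_square_norm)
  then have "e \<bullet> (y - c) = e \<bullet> (a - c) + t + e \<bullet> (y - (a + t *\<^sub>R e))"
    by (simp add: inner_diff_right inner_add_right)
  ultimately show "0 \<le> e \<bullet> (y - c)" by linarith
qed

text \<open>Near the base point of a chart the cones all point in the chart's direction \<open>e\<close>, the inner normal of
  the half-ball, or any unit vector for a full ball. Their length is locally uniform, and compactness makes it uniform.\<close>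

lemma uniform_interior_cones:
  fixes M :: "(real^'n::finite) set"
  assumes M: "compact M" and charts: "uniform_charts M"
  shows "\<exists>L\<ge>1. \<exists>s>0. \<forall>x\<in>M. \<exists>w. interior_cone M L s x w"
proof -
  define chart :: "real \<Rightarrow> real \<Rightarrow> real \<Rightarrow> real^'n \<Rightarrow> (real^'n) set \<Rightarrow> (real^'n \<Rightarrow> real^'n) \<Rightarrow> bool"
    where "chart \<rho> L J x U \<Psi> \<longleftrightarrow> U \<subseteq> M \<and> (\<exists>V. open V \<and> x \<in> V \<and> M \<inter> V \<subseteq> U) \<and>
        (\<forall>a\<in>U. \<forall>b\<in>U. dist a b / L \<le> dist (\<Psi> a) (\<Psi> b) \<and> dist (\<Psi> a) (\<Psi> b) \<le> L * dist a b) \<and>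
        jacobian_bounds J \<Psi> U \<and> jacobian_bounds J (inv_into U \<Psi>) (\<Psi> ` U) \<and>
        (\<exists>c R. 0 < R \<and>
          (if \<rho> \<le> infdist x (frontier M) then \<Psi> ` U = ball c R
           else (\<exists>e. norm e = 1 \<and> \<Psi> ` U = {y \<in> ball c R. 0 \<le> e \<bullet> (y - c)} \<and>
                  \<Psi> ` (U \<inter> frontier M) \<subseteq> {y. e \<bullet> (y - c) = 0})))" for \<rho> L J x U \<Psi>
  have "\<exists>\<rho> L J. 0 < \<rho> \<and> 1 \<le> L \<and> 1 \<le> J \<and> (\<forall>x\<in>M. \<exists>U \<Psi>. chart \<rho> L J x U \<Psi>)"
    using charts unfolding uniform_charts_def chart_def .
  then obtain \<rho> L J where L: "1 \<le> L" and ch: "\<forall>x\<in>M. \<exists>U \<Psi>. chart \<rho> L J x U \<Psi>" by blast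
  have loc: "\<exists>\<eta>>0. \<exists>s>0. \<forall>x\<in>M \<inter> ball x0 \<eta>. \<exists>w. interior_cone M L s x w" if x0: "x0 \<in> M" for x0
  proof -
    obtain U \<Psi> where "chart \<rho> L J x0 U \<Psi>" using ch x0 by blast
    note chart = this[unfolded chart_def]
    have U: "U \<subseteq> M" using chart by (elim conjE)
    have lip': "\<forall>a\<in>U. \<forall>b\<in>U. dist a b / L \<le> dist (\<Psi> a) (\<Psi> b) \<and> dist (\<Psi> a) (\<Psi> b) \<le> L * dist a b"
      using chart by (elim conjE)
    have "\<exists>V. open V \<and> x0 \<in> V \<and> M \<inter> V \<subseteq> U" using chart by (elim conjE)
    then obtain V where V: "open V" "x0 \<in> V" "M \<inter> V \<subseteq> U" by blast
    obtain c R where im: "if \<rho> \<le> infdist x0 (frontier M) then \<Psi> ` U = ball c R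
           else (\<exists>e. norm e = 1 \<and> \<Psi> ` U = {y \<in> ball c R. 0 \<le> e \<bullet> (y - c)} \<and>
                  \<Psi> ` (U \<inter> frontier M) \<subseteq> {y. e \<bullet> (y - c) = 0})"
      using chart by (elim conjE exE) (rule that)
    have lip: "dist a b / L \<le> dist (\<Psi> a) (\<Psi> b) \<and> dist (\<Psi> a) (\<Psi> b) \<le> L * dist a b" if "a \<in> U" "b \<in> U" for a b
      using lip' that by blast
    obtain e :: "real^'n" where e: "norm e = 1"
      and sub: "\<Psi> ` U \<subseteq> ball c R"
      and mem: "\<And>a y. a \<in> \<Psi> ` U \<Longrightarrow> y \<in> ball c R \<Longrightarrow> (0 \<le> e \<bullet> (a - c) \<Longrightarrow> 0 \<le> e \<bullet> (y - c)) \<Longrightarrow> y \<in> \<Psi> ` U"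
    proof (cases "\<rho> \<le> infdist x0 (frontier M)")
      case True
      then have eq: "\<Psi> ` U = ball c R" using im by simp
      obtain e :: "real^'n" where "norm e = 1" using vector_choose_size[of 1] by auto
      then show ?thesis by (rule that) (simp_all add: eq)
    next
      case False
      then obtain e where e: "norm e = 1" and eq: "\<Psi> ` U = {y \<in> ball c R. 0 \<le> e \<bullet> (y - c)}" using im by auto
      from e show ?thesis by (rule that) (simp_all add: eq subset_iff)
    qed
    have x0U: "x0 \<in> U" using V x0 by blast
    then have "\<Psi> x0 \<in> ball c R" using sub by blast
    \<comment> \<open>One third leaves room for moving the apex by \<open>s\<close> and for balls that reach \<open>2 s\<close> from it.\<close>
    define s where "s = (R - dist c (\<Psi> x0)) / 3"
    have s: "0 < s" using \<open>\<Psi> x0 \<in> ball c R\<close> by (simp add: s_def)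
    obtain \<eta>' where \<eta>': "0 < \<eta>'" "ball x0 \<eta>' \<subseteq> V" using V open_contains_ball by blast
    define \<eta> where "\<eta> = min \<eta>' (s / L)"
    have "\<exists>w. interior_cone M L s x w" if x: "x \<in> M \<inter> ball x0 \<eta>" for x
    proof (rule chart_interior_cone[OF U _ L lip e])
      have d: "dist x0 x < \<eta>'" "dist x0 x < s / L" using x by (auto simp: \<eta>_def)
      show xU: "x \<in> U" using d \<eta>' V x by auto
      have "dist (\<Psi> x0) (\<Psi> x) \<le> L * dist x0 x" using lip[OF x0U xU] by blast
      also have "\<dots> < s" using d(2) L by (simp add: field_simps)
      finally have "dist (\<Psi> x0) (\<Psi> x) < s" .
      moreover have "3 * s = R - dist c (\<Psi> x0)" by (simp add: s_def)
      ultimately have near: "dist c (\<Psi> x) + 2 * s \<le> R"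
        using dist_triangle[of c "\<Psi> x" "\<Psi> x0"] by linarith
      fix t assume t: "0 < t" "t \<le> s"
      show "ball (\<Psi> x + t *\<^sub>R e) t \<subseteq> \<Psi> ` U"
      proof
        fix y assume y: "y \<in> ball (\<Psi> x + t *\<^sub>R e) t"
        have "dist c (\<Psi> x) + 2 * t \<le> R" using near t by linarith
        note hb = ball_in_half_ball[OF e t(1) this y]
        show "y \<in> \<Psi> ` U" using mem[OF imageI[OF xU] hb(1) hb(2)] .
      qed
    qed
    then show ?thesis using s \<eta>' L by (intro exI[of _ \<eta>] conjI exI[of _ s]) (auto simp: \<eta>_def)
  qed
  then obtain \<eta> s where \<eta>: "\<And>x0. x0 \<in> M \<Longrightarrow> 0 < \<eta> x0" and s: "\<And>x0. x0 \<in> M \<Longrightarrow> 0 < s x0"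
    and cone: "\<And>x0 x. x0 \<in> M \<Longrightarrow> x \<in> M \<Longrightarrow> dist x0 x < \<eta> x0 \<Longrightarrow> \<exists>w. interior_cone M L (s x0) x w"
  proof -
    have "\<forall>x0. \<exists>p. x0 \<in> M \<longrightarrow> 0 < fst p \<and> 0 < snd p \<and> (\<forall>x\<in>M \<inter> ball x0 (fst p). \<exists>w. interior_cone M L (snd p) x w)"
      using loc by auto
    from choice[OF this] obtain p where p: "\<forall>x0. x0 \<in> M \<longrightarrow> 0 < fst (p x0) \<and> 0 < snd (p x0) \<and>
        (\<forall>x\<in>M \<inter> ball x0 (fst (p x0)). \<exists>w. interior_cone M L (snd (p x0)) x w)" ..
    show thesis by (rule that[of "fst \<circ> p" "snd \<circ> p"]) (use p in auto)
  qed
  have cover: "M \<subseteq> (\<Union>x0\<in>M. ball x0 (\<eta> x0))" using \<eta> by force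
  obtain F where F: "F \<subseteq> M" "finite F" "M \<subseteq> (\<Union>x0\<in>F. ball x0 (\<eta> x0))"
    using compactE_image[OF M _ cover] by auto
  define s0 where "s0 = Min (insert 1 (s ` F))"
  have s0: "0 < s0" "\<And>x0. x0 \<in> F \<Longrightarrow> s0 \<le> s x0" using F s by (auto simp: s0_def)
  have "\<exists>w. interior_cone M L s0 x w" if x: "x \<in> M" for x
  proof -
    obtain x0 where x0: "x0 \<in> F" "dist x0 x < \<eta> x0" using F(3) x by auto
    then obtain w where "interior_cone M L (s x0) x w" using cone[of x0 x] x F(1) by blast
    then show ?thesis using interior_cone_mono s0(2)[OF x0(1)] by blast
  qed
  then show ?thesis using L s0(1) by blast
qed

section \<open>Averages along an interior cone\<close>

text \<open>Terms of a geometric progression whose ratios stay above a threshold are few. This gives the bounded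
  overlap of the cubes along a cone.\<close>

lemma card_geometric_window_le:
  fixes q :: real
  assumes q: "0 < q" "q < 1" and K: "q ^ K < \<theta>" and S: "finite S"
    and window: "\<And>j k. j \<in> S \<Longrightarrow> k \<in> S \<Longrightarrow> j \<le> k \<Longrightarrow> \<theta> \<le> q ^ (k - j)"
  shows "card S \<le> K"
proof (cases "S = {}")
  case False
  define m where "m = Min S"
  have m: "m \<in> S" "\<And>k. k \<in> S \<Longrightarrow> m \<le> k" using S False by (auto simp: m_def)
  have "S \<subseteq> {m..<m + K}"
  proof
    fix k assume k: "k \<in> S"
    have "k - m < K"
    proof (rule ccontr)
      assume "\<not> k - m < K"
      then have "q ^ (k - m) \<le> q ^ K" using q by (intro power_decreasing) auto
      then show False using window[OF m(1) k m(2)[OF k]] K by simp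
    qed
    then show "k \<in> {m..<m + K}" using m(2)[OF k] by auto
  qed
  then have "card S \<le> card {m..<m + K}" by (intro card_mono) auto
  then show ?thesis by simp
qed simp

context cartesian_body
begin

text \<open>A bump is given by the lower corner of its support; here it is placed by its centre.\<close>

definition centred_mean :: "(real^'n \<Rightarrow> real) \<Rightarrow> real^'n \<Rightarrow> real \<Rightarrow> real" where
  "centred_mean f w r = bump_mean f (\<chi> i. w $ i - 3 / 2 * r) (\<chi> i. r)"

abbreviation cube :: "real^'n \<Rightarrow> real \<Rightarrow> (real^'n) set" where
  "cube w h \<equiv> cbox (\<chi> i. w $ i - h) (\<chi> i. w $ i + h)"

lemma cube_subset_ball:
  assumes "real CARD('n) * h < r"
  shows "cube w h \<subseteq> ball w r"
proof
  fix y assume "y \<in> cube w h"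
  then have "\<bar>(y - w) $ i\<bar> \<le> h" for i by (auto simp: mem_box_cart abs_le_iff algebra_simps)
  then have "norm (y - w) \<le> (\<Sum>i\<in>(UNIV::'n set). h)"
    using norm_le_l1_cart[of "y - w"] by (intro order_trans[OF norm_le_l1_cart] sum_mono) auto
  then show "y \<in> ball w r" using assms by (simp add: dist_norm norm_minus_commute)
qed

text \<open>The constants are chosen so that both bumps fit into the cube of half side \<open>h = t / (4 d L)\<close> about \<open>w\<close>: by the
  choice of \<open>q\<close> their centres are at most \<open>h / 2\<close> apart, and by the choice of \<open>\<rho>\<close> the larger one has half-width
  \<open>3 / 2 * \<rho> t = h / 2\<close>. The cube itself lies in the ball of radius \<open>t / L\<close>, hence in the interior of \<open>M\<close>.\<close>

lemma chain_step:
  fixes L :: real and f :: "real^'n \<Rightarrow> real"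
  defines "d \<equiv> CARD('n)"
  defines "q \<equiv> 1 - 1 / (8 * real d * L\<^sup>2)" and "\<rho> \<equiv> 1 / (12 * real d * L)"
  assumes L: "1 \<le> L" and t: "0 < t" and f: "integrable N f" and G: "has_weak_gradient M f G"
    and near: "dist w w' \<le> L * (1 - q) * t" and sub: "ball w (t / L) \<subseteq> M"
  shows "(centred_mean f w (\<rho> * t) - centred_mean f w' (\<rho> * (q * t)))\<^sup>2 \<le>
     (real d)\<^sup>2 * ((24 * real d * L) ^ (2 * (d - 1)) / (2 * real d * L) ^ d) * (t\<^sup>2 / t ^ d) *
       (LINT x:cube w (t / (4 * real d * L))|lborel. (norm (G x))\<^sup>2)"
proof -
  have d: "1 \<le> real d" unfolding d_def using zero_less_card_finite[where 'a = 'n] by linarith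
  have dL: "1 \<le> real d * L" using mult_mono[OF d L] by simp
  have "1 \<le> real d * L\<^sup>2" using mult_mono[OF d one_le_power[OF L, of 2]] by simp
  then have q: "1 / 2 \<le> q" "q < 1" unfolding q_def by (simp_all add: field_simps)
  define h where "h = t / (4 * real d * L)"
  have h: "0 < h" using t dL d L by (simp add: h_def)
  have step: "L * (1 - q) * t = h / 2" using d L by (simp add: q_def h_def power2_eq_square)
  have \<rho>h: "3 / 2 * (\<rho> * t) = h / 2" using d L by (simp add: \<rho>_def h_def)
  have \<rho>qh: "3 / 2 * (\<rho> * (q * t)) \<le> h / 2"
  proof -
    have "\<rho> * (q * t) \<le> \<rho> * (1 * t)" using q t d L by (intro mult_left_mono mult_right_mono) (auto simp: \<rho>_def)
    then show ?thesis using \<rho>h by simp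
  qed
  define r0 where "r0 = t / (24 * real d * L)"
  have r0: "0 < r0" "r0 \<le> \<rho> * t" "r0 \<le> \<rho> * (q * t)"
  proof -
    show "0 < r0" using t dL d L by (simp add: r0_def)
    have e: "r0 = \<rho> * (1 / 2 * t)" by (simp add: r0_def \<rho>_def)
    have "0 \<le> \<rho>" using d L by (simp add: \<rho>_def)
    moreover have "1 / 2 * t \<le> q * t" "1 / 2 * t \<le> t" using mult_right_mono[OF q(1), of t] t by auto
    ultimately show "r0 \<le> \<rho> * (q * t)" "r0 \<le> \<rho> * t" unfolding e by (blast intro: mult_left_mono)+
  qed
  have "real CARD('n) * h < t / L" using d L t by (simp add: h_def d_def field_simps)
  then have "cube w h \<subseteq> ball w (t / L)" by (rule cube_subset_ball)
  moreover have "ball w (t / L) \<subseteq> interior M" using sub by (simp add: interior_maximal)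
  ultimately have box: "cube w h \<subseteq> interior M" by blast
  have wi: "\<bar>w $ i - w' $ i\<bar> \<le> h / 2" for i
    using component_le_norm_cart[of "w - w'" i] near step by (simp add: dist_norm)
  have "(centred_mean f w (\<rho> * t) - centred_mean f w' (\<rho> * (q * t)))\<^sup>2 \<le>
     (real CARD('n))\<^sup>2 * (((1 / r0) ^ (CARD('n) - 1))\<^sup>2 * (2 * h) ^ CARD('n) * (LINT x:cube w h|lborel. (norm (G x))\<^sup>2))"
    unfolding centred_mean_def
  proof (rule bump_mean_change[OF f G box r0(1)])
    fix i
    show "(\<chi> i. w $ i - h) $ i \<le> (\<chi> i. w $ i - 3 / 2 * (\<rho> * t)) $ i \<and>
        (\<chi> i. w $ i - 3 / 2 * (\<rho> * t)) $ i + 3 * (\<chi> i. \<rho> * t) $ i \<le> (\<chi> i. w $ i + h) $ i"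
      using \<rho>h h by simp
    show "(\<chi> i. w $ i - h) $ i \<le> (\<chi> i. w' $ i - 3 / 2 * (\<rho> * (q * t))) $ i \<and>
        (\<chi> i. w' $ i - 3 / 2 * (\<rho> * (q * t))) $ i + 3 * (\<chi> i. \<rho> * (q * t)) $ i \<le> (\<chi> i. w $ i + h) $ i"
      using \<rho>qh wi[of i] unfolding abs_le_iff by simp
  qed (use r0 in auto)
  also have "((1 / r0) ^ (CARD('n) - 1))\<^sup>2 * (2 * h) ^ CARD('n) =
      ((24 * real d * L) ^ (2 * (d - 1)) / (2 * real d * L) ^ d) * (t\<^sup>2 / t ^ d)"
  proof -
    have 1: "((1 / r0) ^ (d - 1))\<^sup>2 = (24 * real d * L) ^ (2 * (d - 1)) / t ^ (2 * (d - 1))"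
      by (simp add: r0_def power_divide power_mult[symmetric] mult.commute)
    have 2: "(2 * h) ^ d = t ^ d / (2 * real d * L) ^ d"
    proof -
      have "2 * h = t / (2 * real d * L)" by (simp add: h_def)
      then show ?thesis by (simp add: power_divide)
    qed
    have 3: "t ^ d / t ^ (2 * (d - 1)) = t\<^sup>2 / t ^ d"
    proof -
      have "t ^ d * t ^ d = t\<^sup>2 * t ^ (2 * (d - 1))"
        unfolding power_add[symmetric] using d by (intro arg_cong[where f = "\<lambda>n. t ^ n"]) linarith
      then show ?thesis using t by (simp add: field_simps)
    qed
    have "(A / T) * (E / B) = (A / B) * c" if "E / T = c" for A T E B c :: real using that by auto
    from this[OF 3] show ?thesis unfolding d_def[symmetric] 1 2 .
  qed
  finally show ?thesis by (simp add: h_def d_def mult.assoc)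
qed

text \<open>Telescoping along the scales \<open>s q\<^sup>j\<close> and the Cauchy-Schwarz inequality with weights \<open>t\<^sup>2 / t\<^sup>d\<close>. The cube used at
  scale \<open>t\<close> lies at a distance comparable to \<open>t\<close> from the apex, so every point belongs to boundedly many cubes and
  the gradient integrals over them add up to a multiple of the full one.\<close>

lemma chain_estimate:
  fixes L :: real
  defines "d \<equiv> CARD('n)"
  defines "q \<equiv> 1 - 1 / (8 * real d * L\<^sup>2)" and "\<rho> \<equiv> 1 / (12 * real d * L)"
  assumes L: "1 \<le> L"
  shows "\<exists>C>0. \<forall>f G x w s J. integrable N f \<longrightarrow> has_weak_gradient M f G \<longrightarrow> 0 < s \<longrightarrow> interior_cone M L s x w \<longrightarrow>
    (centred_mean f (w s) (\<rho> * s))\<^sup>2 \<le> 2 * (centred_mean f (w (s * q ^ J)) (\<rho> * (s * q ^ J)))\<^sup>2 +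
      C * (\<Sum>j<J. (s * q ^ j)\<^sup>2 / (s * q ^ j) ^ d) * (LINT x:interior M|lborel. (norm (G x))\<^sup>2)"
proof -
  have d: "1 \<le> real d" unfolding d_def using zero_less_card_finite[where 'a = 'n] by linarith
  have dL: "1 \<le> real d * L" using mult_mono[OF d L] by simp
  have "1 \<le> real d * L\<^sup>2" using mult_mono[OF d one_le_power[OF L, of 2]] by simp
  then have q: "0 < q" "q < 1" unfolding q_def by (simp_all add: field_simps)
  obtain K where K: "q ^ K < 1 / (4 * L\<^sup>2)" using real_arch_pow_inv[of "1 / (4 * L\<^sup>2)" q] q L by auto
  define C1 where "C1 = (real d)\<^sup>2 * ((24 * real d * L) ^ (2 * (d - 1)) / (2 * real d * L) ^ d)"
  have C1: "0 < C1" using d L by (simp add: C1_def)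
  show ?thesis
  proof (intro exI[of _ "2 * C1 * (real K + 1)"] conjI allI impI)
    show "0 < 2 * C1 * (real K + 1)" using C1 by simp
    fix f G x w s J
    assume f: "integrable N f" and G: "has_weak_gradient M f G" and s: "0 < s" and cone: "interior_cone M L s x w"
    define t where "t j = s * q ^ j" for j
    have t: "0 < t j" "t j \<in> {0<..s}" "t (Suc j) = q * t j" for j
      using s q by (auto simp: t_def power_le_one)
    define m where "m j = centred_mean f (w (t j)) (\<rho> * t j)" for j
    define Q where "Q j = cube (w (t j)) (t j / (4 * real d * L))" for j
    define g where "g j = (LINT x:Q j|lborel. (norm (G x))\<^sup>2)" for j
    define a where "a j = (t j)\<^sup>2 / t j ^ d" for j
    have a0: "0 < a j" for j unfolding a_def using t(1)[of j] by (intro divide_pos_pos zero_less_power)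
    have step: "(m j - m (Suc j))\<^sup>2 \<le> C1 * a j * g j" for j
    proof -
      have "dist (w (t j)) (w (t (Suc j))) \<le> L * \<bar>t j - t (Suc j)\<bar>"
        using cone t(2) unfolding interior_cone_def by blast
      also have "\<bar>t j - t (Suc j)\<bar> = (1 - q) * t j"
        using q t(1)[of j] unfolding t(3) by (simp add: left_diff_distrib abs_of_nonneg)
      finally have near: "dist (w (t j)) (w (t (Suc j))) \<le> L * (1 - q) * t j" by (simp add: mult.assoc)
      have "ball (w (t j)) (t j / L) \<subseteq> M" using cone t(2) unfolding interior_cone_def by blast
      from chain_step[OF L t(1) f G near[unfolded q_def d_def] this]
      show ?thesis unfolding m_def g_def a_def Q_def C1_def t(3) by (simp add: q_def d_def \<rho>_def mult.assoc)
    qed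
    have QM: "Q j \<subseteq> ball (w (t j)) (t j / (2 * L))" for j
      unfolding Q_def using d L t(1)[of j] by (intro cube_subset_ball) (simp add: d_def[symmetric] field_simps)
    have Qint: "Q j \<subseteq> interior M" for j
    proof -
      have "ball (w (t j)) (t j / (2 * L)) \<subseteq> ball (w (t j)) (t j / L)"
        using t(1)[of j] L by (intro subset_ball) (simp add: field_simps)
      also have "\<dots> \<subseteq> M" using cone t(2) unfolding interior_cone_def by blast
      finally have "ball (w (t j)) (t j / (2 * L)) \<subseteq> interior M" by (simp add: interior_maximal)
      then show ?thesis using QM by blast
    qed
    have dist_y: "t j / (2 * L) \<le> dist x y" "dist x y \<le> 2 * L * t j" if "y \<in> Q j" for j y
    proof -
      have c: "t j / L \<le> dist x (w (t j))" "dist x (w (t j)) \<le> L * t j"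
        using cone t(2) unfolding interior_cone_def by blast+
      have y: "dist (w (t j)) y < t j / (2 * L)" using subsetD[OF QM that] by simp
      have "t j / L = t j / (2 * L) + t j / (2 * L)" by simp
      then show "t j / (2 * L) \<le> dist x y" using c(1) y dist_triangle[of x "w (t j)" y] by (simp add: dist_commute)
      have "t j / (2 * L) \<le> L * t j"
      proof -
        have "t j / (2 * L) \<le> t j / 1" using t(1)[of j] L by (intro divide_left_mono) auto
        also have "\<dots> \<le> L * t j" using t(1)[of j] L by simp
        finally show ?thesis .
      qed
      then show "dist x y \<le> 2 * L * t j" using c(2) y dist_triangle[of x y "w (t j)"] by linarith
    qed
    have overlap: "(\<Sum>j<J. indicator (Q j) y) \<le> real K * indicator (interior M) y" for y
    proof -
      let ?S = "{j. j < J \<and> y \<in> Q j}"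
      have "(\<Sum>j<J. indicator (Q j) y) = real (card ?S)"
      proof -
        have "(\<Sum>j<J. indicator (Q j) y) = (\<Sum>j\<in>{..<J}. if y \<in> Q j then 1 else (0::real))"
          by (intro sum.cong) (auto simp: indicator_def)
        also have "\<dots> = real (card ({..<J} \<inter> {j. y \<in> Q j}))" by (simp add: sum.If_cases)
        also have "{..<J} \<inter> {j. y \<in> Q j} = ?S" by auto
        finally show ?thesis .
      qed
      moreover have "card ?S \<le> K"
      proof (rule card_geometric_window_le[OF q K])
        fix j k assume jk: "j \<in> ?S" "k \<in> ?S" "j \<le> k"
        have "t j / (2 * L) \<le> 2 * L * t k" using dist_y[of y j] dist_y[of y k] jk by auto
        then have "t j \<le> 4 * L\<^sup>2 * t k" using L by (simp add: field_simps power2_eq_square)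
        also have "t k = q ^ (k - j) * t j" using jk by (simp add: t_def flip: power_add)
        finally have "1 * t j \<le> (4 * L\<^sup>2 * q ^ (k - j)) * t j" by (simp add: mult_ac)
        then have "1 \<le> 4 * L\<^sup>2 * q ^ (k - j)" using t(1)[of j] by (simp only: mult_le_cancel_right_pos)
        then show "1 / (4 * L\<^sup>2) \<le> q ^ (k - j)" using L by (simp add: field_simps)
      qed simp
      moreover have "?S = {}" if "y \<notin> interior M" using Qint that by auto
      ultimately show ?thesis by (cases "y \<in> interior M") auto
    qed
    have iG: "set_integrable lborel (interior M) (\<lambda>x. (norm (G x))\<^sup>2)"
      using G by (intro integrable_interior) (auto simp: has_weak_gradient_def)
    have iQ: "set_integrable lborel (Q j) (\<lambda>x. (norm (G x))\<^sup>2)" for j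
      by (rule set_integrable_subset[OF iG _ Qint]) (simp add: Q_def)
    have sum_g: "(\<Sum>j<J. g j) \<le> real K * (LINT x:interior M|lborel. (norm (G x))\<^sup>2)"
    proof -
      have "(\<Sum>j<J. g j) = (\<integral>x. (\<Sum>j<J. indicator (Q j) x * (norm (G x))\<^sup>2) \<partial>lborel)"
        unfolding g_def set_lebesgue_integral_def using iQ
        by (subst Bochner_Integration.integral_sum) (auto simp: set_integrable_def)
      also have "\<dots> \<le> (\<integral>x. real K * (indicator (interior M) x * (norm (G x))\<^sup>2) \<partial>lborel)"
      proof (rule integral_mono)
        show "integrable lborel (\<lambda>x. \<Sum>j<J. indicator (Q j) x * (norm (G x))\<^sup>2)"
          using iQ by (intro Bochner_Integration.integrable_sum) (auto simp: set_integrable_def)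
        show "integrable lborel (\<lambda>x. real K * (indicator (interior M) x * (norm (G x))\<^sup>2))"
          using iG by (intro integrable_mult_right) (auto simp: set_integrable_def)
        fix y
        show "(\<Sum>j<J. indicator (Q j) y * (norm (G y))\<^sup>2) \<le> real K * (indicator (interior M) y * (norm (G y))\<^sup>2)"
          using mult_right_mono[OF overlap[of y], of "(norm (G y))\<^sup>2"] by (simp add: sum_distrib_right mult.assoc)
      qed
      finally show ?thesis by (simp add: set_lebesgue_integral_def)
    qed
    have "(m 0 - m J)\<^sup>2 \<le> (\<Sum>j<J. a j) * (\<Sum>j<J. (m j - m (Suc j))\<^sup>2 / a j)"
    proof -
      have "m 0 - m J = (\<Sum>j<J. sqrt (a j) * ((m j - m (Suc j)) / sqrt (a j)))"
        using a0 by (simp add: less_imp_neq[symmetric] sum_lessThan_telescope')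
      then have "(m 0 - m J)\<^sup>2 \<le> (\<Sum>j<J. (sqrt (a j))\<^sup>2) * (\<Sum>j<J. ((m j - m (Suc j)) / sqrt (a j))\<^sup>2)"
        using Cauchy_Schwarz_ineq_sum[of "\<lambda>j. sqrt (a j)" "\<lambda>j. (m j - m (Suc j)) / sqrt (a j)" "{..<J}"] by simp
      then show ?thesis using a0 by (simp add: power_divide less_imp_le)
    qed
    also have "\<dots> \<le> (\<Sum>j<J. a j) * (\<Sum>j<J. C1 * g j)"
    proof (intro mult_left_mono sum_mono sum_nonneg)
      fix j
      show "(m j - m (Suc j))\<^sup>2 / a j \<le> C1 * g j" using step[of j] a0[of j] by (simp add: divide_le_eq mult_ac)
    qed (use a0 in \<open>auto intro: less_imp_le\<close>)
    also have "\<dots> = (\<Sum>j<J. a j) * (C1 * (\<Sum>j<J. g j))" by (simp add: sum_distrib_left)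
    also have "\<dots> \<le> (\<Sum>j<J. a j) * (C1 * ((real K + 1) * (LINT x:interior M|lborel. (norm (G x))\<^sup>2)))"
    proof (intro mult_left_mono sum_nonneg)
      have "0 \<le> (LINT x:interior M|lborel. (norm (G x))\<^sup>2)"
        unfolding set_lebesgue_integral_def by (intro integral_nonneg_AE) auto
      then show "(\<Sum>j<J. g j) \<le> (real K + 1) * (LINT x:interior M|lborel. (norm (G x))\<^sup>2)"
        using sum_g by (simp add: distrib_right)
    qed (use a0 C1 in \<open>auto intro: less_imp_le\<close>)
    finally have mm: "(m 0 - m J)\<^sup>2 \<le> C1 * (real K + 1) * (\<Sum>j<J. a j) * (LINT x:interior M|lborel. (norm (G x))\<^sup>2)"
      by (simp add: mult_ac)
    have "(m 0)\<^sup>2 \<le> 2 * (m J)\<^sup>2 + 2 * (m 0 - m J)\<^sup>2"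
    proof -
      have "0 \<le> (m 0 - 2 * m J)\<^sup>2" by simp
      then show ?thesis by (simp add: power2_eq_square algebra_simps)
    qed
    with mm have "(m 0)\<^sup>2 \<le> 2 * (m J)\<^sup>2 + 2 * C1 * (real K + 1) * (\<Sum>j<J. a j) * (LINT x:interior M|lborel. (norm (G x))\<^sup>2)"
      by simp
    then show "(centred_mean f (w s) (\<rho> * s))\<^sup>2 \<le> 2 * (centred_mean f (w (s * q ^ J)) (\<rho> * (s * q ^ J)))\<^sup>2 +
      2 * C1 * (real K + 1) * (\<Sum>j<J. (s * q ^ j)\<^sup>2 / (s * q ^ j) ^ d) * (LINT x:interior M|lborel. (norm (G x))\<^sup>2)"
      by (simp add: m_def a_def t_def)
  qed
qed

end

section \<open>The scale function\<close>

lemma ln_one_over_ge_1: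
  assumes "0 < \<epsilon>" "\<epsilon> \<le> exp (-1 :: real)"
  shows "1 \<le> ln (1 / \<epsilon>)"
proof -
  have "ln \<epsilon> \<le> ln (exp (-1))" by (rule ln_mono[OF assms(2,1)])
  then show ?thesis using assms by (simp add: ln_div)
qed

text \<open>For \<open>d = 2\<close> all weights are one and the number of scales above \<open>\<epsilon>\<close> is logarithmic; for \<open>d \<ge> 3\<close> the sum is
  geometric and comparable to its last term. In both cases it is at most a multiple of the reciprocal of \<open>kappa\<close>.\<close>

lemma scale_sum_le:
  fixes L q s :: real and d :: nat
  assumes d: "2 \<le> d" and q: "0 < q" "q < 1" and L: "0 < L" and s: "0 < s"
  shows "\<exists>C>0. \<forall>\<epsilon> J. 0 < \<epsilon> \<longrightarrow> \<epsilon> \<le> exp (-1) \<longrightarrow> (\<forall>j<J. \<epsilon> / (4 * L) < s * q ^ j) \<longrightarrow>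
     (\<Sum>j<J. (s * q ^ j)\<^sup>2 / (s * q ^ j) ^ d) \<le> C * inverse (kappa d \<epsilon>)"
proof (cases "d = 2")
  case True
  define C where "C = 1 + (\<bar>ln (4 * L * s)\<bar> + 1) / ln (1 / q)"
  have lq: "0 < ln (1 / q)" using q by simp
  have C: "0 < C" using lq by (auto simp: C_def intro!: add_pos_nonneg divide_nonneg_pos)
  show ?thesis
  proof (intro exI[of _ C] conjI allI impI)
    show "0 < C" by (rule C)
    fix \<epsilon> J assume \<epsilon>: "0 < \<epsilon>" "\<epsilon> \<le> exp (-1)" and scale: "\<forall>j<J. \<epsilon> / (4 * L) < s * q ^ j"
    note l1 = ln_one_over_ge_1[OF \<epsilon>]
    have "(\<Sum>j<J. (s * q ^ j)\<^sup>2 / (s * q ^ j) ^ d) = real J" using True s q by simp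
    also have "\<dots> \<le> C * ln (1 / \<epsilon>)"
    proof (cases J)
      case (Suc i)
      have "\<epsilon> / (4 * L) < s * q ^ i" using scale Suc by auto
      then have "(1 / q) ^ i < 4 * L * s * (1 / \<epsilon>)" using \<epsilon> L q by (simp add: field_simps)
      then have "ln ((1 / q) ^ i) < ln (4 * L * s * (1 / \<epsilon>))"
        using q \<epsilon> L s by (subst ln_less_cancel_iff) auto
      also have "\<dots> = ln (4 * L * s) + ln (1 / \<epsilon>)" using L s \<epsilon> by (intro ln_mult_pos) auto
      also have "ln ((1 / q) ^ i) = real i * ln (1 / q)" by (rule ln_realpow)
      finally have "real i * ln (1 / q) \<le> \<bar>ln (4 * L * s)\<bar> * ln (1 / \<epsilon>) + 1 * ln (1 / \<epsilon>)"
        using mult_left_mono[OF l1, of "\<bar>ln (4 * L * s)\<bar>"] by linarith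
      also have "\<dots> = (\<bar>ln (4 * L * s)\<bar> + 1) * ln (1 / \<epsilon>)" by (simp add: distrib_right)
      finally have "real i \<le> (\<bar>ln (4 * L * s)\<bar> + 1) / ln (1 / q) * ln (1 / \<epsilon>)"
        using lq by (simp add: field_simps)
      then show ?thesis using l1 Suc by (simp add: C_def distrib_right)
    qed (use C l1 in simp)
    finally show "(\<Sum>j<J. (s * q ^ j)\<^sup>2 / (s * q ^ j) ^ d) \<le> C * inverse (kappa d \<epsilon>)"
      using True by (simp add: kappa_def inverse_eq_divide)
  qed
next
  case False
  then have d3: "1 \<le> d - 2" using d by simp
  define C where "C = (4 * L) ^ (d - 2) / (1 - q)"
  show ?thesis
  proof (intro exI[of _ C] conjI allI impI)
    show "0 < C" using q L by (simp add: C_def)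
    fix \<epsilon> J assume \<epsilon>: "0 < \<epsilon>" "\<epsilon> \<le> exp (-1)" and scale: "\<forall>j<J. \<epsilon> / (4 * L) < s * q ^ j"
    have summand: "(s * q ^ j)\<^sup>2 / (s * q ^ j) ^ d \<le> (4 * L / \<epsilon>) ^ (d - 2) * q ^ (J - Suc j)" if j: "j < J" for j
    proof -
      let ?t = "s * q ^ j"
      have t: "0 < ?t" using s q by simp
      have "?t ^ d = ?t\<^sup>2 * ?t ^ (d - 2)" using power_add[of ?t 2 "d - 2"] d by (simp only: le_add_diff_inverse)
      then have "?t\<^sup>2 / ?t ^ d = (1 / ?t) ^ (d - 2)" using t s q by (simp add: power_one_over)
      also have "\<dots> \<le> (4 * L / \<epsilon> * q ^ (J - Suc j)) ^ (d - 2)"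
      proof (rule power_mono)
        have "\<epsilon> / (4 * L) < s * q ^ (J - 1)" using scale j by auto
        also have "q ^ (J - 1) = q ^ j * q ^ (J - Suc j)" using j by (simp flip: power_add)
        finally show "1 / ?t \<le> 4 * L / \<epsilon> * q ^ (J - Suc j)" using t \<epsilon> L by (simp add: field_simps)
        show "0 \<le> 1 / ?t" using t by simp
      qed
      also have "\<dots> = (4 * L / \<epsilon>) ^ (d - 2) * (q ^ (J - Suc j)) ^ (d - 2)" by (rule power_mult_distrib)
      also have "\<dots> \<le> (4 * L / \<epsilon>) ^ (d - 2) * (q ^ (J - Suc j)) ^ 1"
        using q d3 L \<epsilon> by (intro mult_left_mono power_decreasing) (auto intro: power_le_one)
      finally show ?thesis by simp
    qed
    have "(\<Sum>j<J. (s * q ^ j)\<^sup>2 / (s * q ^ j) ^ d) \<le> (\<Sum>j<J. (4 * L / \<epsilon>) ^ (d - 2) * q ^ (J - Suc j))"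
      using summand by (intro sum_mono) auto
    also have "\<dots> = (4 * L / \<epsilon>) ^ (d - 2) * (\<Sum>j<J. q ^ (J - Suc j))" by (simp add: sum_distrib_left)
    also have "(\<Sum>j<J. q ^ (J - Suc j)) = (\<Sum>j<J. q ^ j)" by (rule sum.nat_diff_reindex)
    also have "(\<Sum>j<J. q ^ j) \<le> 1 / (1 - q)"
    proof -
      have "(\<Sum>j<J. q ^ j) = (1 - q ^ J) / (1 - q)" using q by (subst geometric_sum) (auto simp: field_simps)
      also have "\<dots> \<le> 1 / (1 - q)" using q by (intro divide_right_mono) auto
      finally show ?thesis .
    qed
    finally have "(\<Sum>j<J. (s * q ^ j)\<^sup>2 / (s * q ^ j) ^ d) \<le> (4 * L / \<epsilon>) ^ (d - 2) * (1 / (1 - q))"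
      using L \<epsilon> by (simp add: mult_left_mono)
    also have "\<dots> = C * inverse (kappa d \<epsilon>)" using False by (simp add: C_def kappa_def power_divide field_simps)
    finally show "(\<Sum>j<J. (s * q ^ j)\<^sup>2 / (s * q ^ j) ^ d) \<le> C * inverse (kappa d \<epsilon>)" .
  qed
qed

lemma kappa_bounds:
  assumes "2 \<le> d" "0 < \<epsilon>" "\<epsilon> \<le> exp (-1)"
  shows "0 < kappa d \<epsilon>" "kappa d \<epsilon> \<le> 1"
proof -
  have "exp (-1) \<le> (1::real)" by simp
  then have e1: "\<epsilon> \<le> 1" using assms(3) by linarith
  have l1: "1 \<le> ln (inverse \<epsilon>)" using ln_one_over_ge_1[OF assms(2,3)] by (simp add: inverse_eq_divide)
  have "0 < inverse (ln (inverse \<epsilon>))" "inverse (ln (inverse \<epsilon>)) \<le> 1"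
    using l1 by (simp_all only: positive_imp_inverse_positive inverse_le_1_iff) auto
  moreover have "0 < \<epsilon> ^ (d - 2)" "\<epsilon> ^ (d - 2) \<le> 1" using e1 assms(2) by (auto intro: power_le_one)
  ultimately show "0 < kappa d \<epsilon>" "kappa d \<epsilon> \<le> 1" unfolding kappa_def by presburger+
qed

section \<open>Functions vanishing on a small hole\<close>

context cartesian_body
begin

lemma centred_bump_support:
  fixes w :: "real^'n"
  assumes "0 < r" "x \<notin> cube w (3 / 2 * r)"
  shows "bump (\<chi> i. w $ i - 3 / 2 * r) (\<chi> i. r) x = 0"
proof -
  obtain i where "x $ i \<notin> {w $ i - 3 / 2 * r..w $ i + 3 / 2 * r}"
    using assms(2) by (auto simp: mem_box_cart)
  then show ?thesis using assms(1) by (intro bump_eq_0[where i = i]) auto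
qed

lemma integrable_mult_bump:
  assumes "integrable N f" "0 < r"
  shows "set_integrable lborel (interior M) (\<lambda>x. f x * bump w (\<chi> i. r) x)"
  using integrable_interior_scaleR_continuous[OF assms(1) continuous_bump, of "\<chi> i. r" w] assms(2)
  by (simp add: mult.commute)

lemma centred_mean_diff:
  assumes "integrable N f" "integrable N g" "0 < r"
  shows "centred_mean (\<lambda>x. f x - g x) w r = centred_mean f w r - centred_mean g w r"
  using integrable_mult_bump[OF assms(1,3)] integrable_mult_bump[OF assms(2,3)]
  unfolding centred_mean_def bump_mean_def by (simp add: left_diff_distrib set_integral_diff)

lemma centred_mean_const: "centred_mean (\<lambda>x. c) w r = c * centred_mean (\<lambda>x. 1) w r"
  unfolding centred_mean_def bump_mean_def set_lebesgue_integral_def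
  by (simp add: mult.left_commute[of _ c])

lemma centred_mean_eq_0:
  assumes "0 < r" "\<And>x. x \<in> cube w (3 / 2 * r) \<Longrightarrow> f x = 0"
  shows "centred_mean f w r = 0"
proof -
  have "f x * bump (\<chi> i. w $ i - 3 / 2 * r) (\<chi> i. r) x = 0" for x
    using assms centred_bump_support by (cases "x \<in> cube w (3 / 2 * r)") auto
  then have "(\<lambda>x. f x * bump (\<chi> i. w $ i - 3 / 2 * r) (\<chi> i. r) x) = (\<lambda>x. 0)" by (rule ext)
  then show ?thesis unfolding centred_mean_def bump_mean_def by (simp only: set_lebesgue_integral_def) simp
qed

lemma centred_mean_square_le:
  assumes f: "f \<in> sqint N" and r: "0 < r"
  shows "(centred_mean f w r)\<^sup>2 \<le> (V * (1 / r) ^ CARD('n))\<^sup>2 * ip N f f"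
proof -
  interpret prob_space N by (rule prob_space_N)
  have fi: "integrable N f" by (rule sqint_integrable[OF f])
  have af: "(\<lambda>x. \<bar>f x\<bar>) \<in> sqint N" using f by (auto simp: sqint_def)
  let ?b = "bump (\<chi> i. w $ i - 3 / 2 * r) (\<chi> i. r)" and ?K = "(1 / r) ^ CARD('n)"
  have b: "0 \<le> ?b x" "?b x \<le> ?K" for x
    using bump_nonneg[of "\<chi> i. r"] bump_le[of r "\<chi> i. r"] r by auto
  have "\<bar>centred_mean f w r\<bar> \<le> (\<integral>x. norm (indicator (interior M) x *\<^sub>R (f x * ?b x)) \<partial>lborel)"
    unfolding centred_mean_def bump_mean_def set_lebesgue_integral_def real_norm_def[symmetric] by (rule integral_norm_bound)
  also have "\<dots> \<le> (\<integral>x. ?K * (indicator (interior M) x *\<^sub>R \<bar>f x\<bar>) \<partial>lborel)"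
  proof (rule integral_mono)
    show "integrable lborel (\<lambda>x. norm (indicator (interior M) x *\<^sub>R (f x * ?b x)))"
      using integrable_mult_bump[OF fi r] unfolding set_integrable_def by (rule integrable_norm)
    show "integrable lborel (\<lambda>x. ?K * (indicator (interior M) x *\<^sub>R \<bar>f x\<bar>))"
      using integrable_interior[OF integrable_abs[OF fi]] unfolding set_integrable_def by (rule integrable_mult_right)
    fix x
    have "\<bar>f x\<bar> * ?b x \<le> \<bar>f x\<bar> * ?K" using b by (intro mult_left_mono) auto
    then show "norm (indicator (interior M) x *\<^sub>R (f x * ?b x)) \<le> ?K * (indicator (interior M) x *\<^sub>R \<bar>f x\<bar>)"
      using b(1)[of x] by (auto simp: indicator_def abs_mult mult.commute)
  qed
  also have "\<dots> = ?K * (LINT x:interior M|lborel. \<bar>f x\<bar>)" by (simp add: set_lebesgue_integral_def)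
  also have "\<dots> \<le> ?K * (V * (\<integral>x. \<bar>f x\<bar> \<partial>N))"
    using r by (intro mult_left_mono integral_interior_le integrable_abs fi) auto
  finally have "\<bar>centred_mean f w r\<bar>\<^sup>2 \<le> (?K * (V * (\<integral>x. \<bar>f x\<bar> \<partial>N)))\<^sup>2" by (intro power_mono) auto
  also have "\<dots> = (V * ?K)\<^sup>2 * (\<integral>x. \<bar>f x\<bar> \<partial>N)\<^sup>2" by (simp add: power_mult_distrib)
  also have "\<dots> \<le> (V * ?K)\<^sup>2 * ip N f f"
    using square_integral_le[OF af] by (intro mult_left_mono) (auto simp: ip_def)
  finally show ?thesis by simp
qed

text \<open>The bump is at least \<open>(1 / (2 * r)) ^ d\<close> on the middle cube of side \<open>r\<close>.\<close>

lemma centred_mean_one_ge: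
  assumes r: "0 < r" and sub: "cube w (3 / 2 * r) \<subseteq> interior M"
  shows "(1 / 2) ^ CARD('n) \<le> centred_mean (\<lambda>x. 1) w r"
proof -
  interpret prob_space N by (rule prob_space_N)
  let ?b = "bump (\<chi> i. w $ i - 3 / 2 * r) (\<chi> i. r)" and ?Q = "cube w (1 / 2 * r)" and ?K = "(1 / (2 * r)) ^ CARD('n)"
  have ge: "?K \<le> ?b x" if x: "x \<in> ?Q" for x
  proof -
    have "?K = (\<Prod>i\<in>(UNIV::'n set). (1 / 2) / r)" by simp
    also have "\<dots> \<le> ?b x" unfolding bump_def
    proof (rule prod_mono)
      fix i :: 'n
      have xi: "w $ i - 1 / 2 * r \<le> x $ i" "x $ i \<le> w $ i + 1 / 2 * r" using x by (auto simp: mem_box_cart)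
      have "1 / 2 \<le> bspline ((x $ i - (w $ i - 3 / 2 * r)) / r)"
      proof (rule bspline_ge)
        show "1 \<le> (x $ i - (w $ i - 3 / 2 * r)) / r" using xi r by (simp add: le_divide_eq)
        show "(x $ i - (w $ i - 3 / 2 * r)) / r \<le> 2" using xi r by (simp add: divide_le_eq)
      qed
      then show "0 \<le> (1 / 2) / r \<and> (1 / 2) / r \<le> bspline ((x $ i - (\<chi> i. w $ i - 3 / 2 * r) $ i) / (\<chi> i. r) $ i) / (\<chi> i. r) $ i"
        using r divide_right_mono[OF \<open>1 / 2 \<le> bspline _\<close>, of r] by simp
    qed
    finally show ?thesis .
  qed
  have QM: "?Q \<subseteq> interior M"
  proof -
    have "?Q \<subseteq> cube w (3 / 2 * r)" using r by (intro subset_interval_cart(1)[THEN iffD2]) simp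
    then show ?thesis using sub by blast
  qed
  have vol: "measure lborel ?Q = r ^ CARD('n)"
  proof -
    have "?Q \<noteq> {}" using r by (simp add: interval_ne_empty_cart)
    then have "measure lborel ?Q = (\<Prod>i\<in>UNIV. (\<chi> i. w $ i + 1 / 2 * r) $ i - (\<chi> i. w $ i - 1 / 2 * r) $ i)"
      by (rule content_cbox_cart)
    then show ?thesis by simp
  qed
  have "(1 / 2) ^ CARD('n) = (\<integral>x. ?K * indicator ?Q x \<partial>lborel)"
    using r vol by (simp add: power_divide power_mult_distrib)
  also have "\<dots> \<le> (\<integral>x. indicator (interior M) x *\<^sub>R (1 * ?b x) \<partial>lborel)"
  proof (rule integral_mono)
    show "integrable lborel (\<lambda>x. ?K * indicator ?Q x)"
      by (intro integrable_mult_right integrable_real_indicator) (use emeasure_lborel_cbox_finite in simp_all)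
    show "integrable lborel (\<lambda>x. indicator (interior M) x *\<^sub>R (1 * ?b x))"
      using integrable_mult_bump[OF integrable_const r, of 1] unfolding set_integrable_def .
    fix x
    show "?K * indicator ?Q x \<le> indicator (interior M) x *\<^sub>R (1 * ?b x)"
    proof (cases "x \<in> ?Q")
      case True
      then have "x \<in> interior M" using QM by blast
      then show ?thesis using ge[OF True] True by simp
    next
      case False
      have "0 \<le> ?b x" using bump_nonneg[of "\<chi> i. r"] r by simp
      then show ?thesis using False by (simp add: indicator_def)
    qed
  qed
  finally show ?thesis unfolding centred_mean_def bump_mean_def set_lebesgue_integral_def .
qed

end

locale rbm_body = cartesian_body M + reflected_process M p P
  for M :: "(real^'n::finite) set" and p and P
begin

lemma dirichlet_form_lborel:
  assumes "f \<in> H1 M"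
  shows "dirichlet_form M f f = (LINT x:interior M|lborel. (norm (weak_gradient M f x))\<^sup>2) / (2 * V)"
proof -
  have "(\<lambda>x. (norm (weak_gradient M f x))\<^sup>2) \<in> borel_measurable N"
    using weak_gradient_has_weak_gradient[OF assms] by (auto simp: has_weak_gradient_def)
  from set_integral_interior_N[OF this] show ?thesis
    by (simp add: dirichlet_form_def power2_norm_eq_inner)
qed

text \<open>Smoothing by \<open>K h\<close> moves the average over the hole, which is zero for \<open>f\<close>, by an amount that the term
  \<open>h / (s * q ^ J) ^ (2 * d)\<close> accounts for. The chain estimate carries the average of the smoothed function
  to the fixed scale \<open>s\<close>, where the Poincare inequality takes over.\<close>

lemma smoothed_hole_estimate:
  fixes L :: real
  defines "d \<equiv> CARD('n)"
  defines "q \<equiv> 1 - 1 / (8 * real d * L\<^sup>2)" and "\<rho> \<equiv> 1 / (12 * real d * L)"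
  assumes L: "1 \<le> L" and s: "0 < s"
  shows "\<exists>C>0. \<forall>x w J f h. interior_cone M L s x w \<longrightarrow> 0 < h \<longrightarrow> h \<le> 1 \<longrightarrow> f \<in> sqint N \<longrightarrow>
     (\<forall>z \<in> ball (w (s * q ^ J)) (s * q ^ J / L). f z = 0) \<longrightarrow>
     ip N f f \<le> C * (1 + h / (s * q ^ J) ^ (2 * d) + (\<Sum>j<J. (s * q ^ j)\<^sup>2 / (s * q ^ j) ^ d)) * energy h f"
proof -
  have d: "1 \<le> real d" unfolding d_def using zero_less_card_finite[where 'a = 'n] by linarith
  have "1 \<le> real d * L\<^sup>2" using mult_mono[OF d one_le_power[OF L, of 2]] by simp
  then have q: "0 < q" "q < 1" unfolding q_def by (simp_all add: field_simps)
  have \<rho>: "0 < \<rho>" using d L by (simp add: \<rho>_def)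
  from Poincare obtain CP where CP: "0 < CP" and poincare': "\<forall>u\<in>sqint N. \<forall>k. (\<forall>t>0. energy t u \<le> k) \<longrightarrow>
     ip N (\<lambda>x. u x - (\<integral>x. u x \<partial>N)) (\<lambda>x. u x - (\<integral>x. u x \<partial>N)) \<le> CP * k"
    by (elim exE conjE) (rule that)
  have poincare: "ip N (\<lambda>x. u x - (\<integral>x. u x \<partial>N)) (\<lambda>x. u x - (\<integral>x. u x \<partial>N)) \<le> CP * k"
    if "u \<in> sqint N" "\<And>t. 0 < t \<Longrightarrow> energy t u \<le> k" for u k
    using poincare'[rule_format, OF that(1)] that(2) by simp
  from chain_estimate[OF L, folded d_def, folded q_def \<rho>_def] obtain CC where CC: "0 < CC" and chain': "\<forall>f G x w s J. integrable N f \<longrightarrow> has_weak_gradient M f G \<longrightarrow> 0 < s \<longrightarrow> interior_cone M L s x w \<longrightarrow>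
    (centred_mean f (w s) (\<rho> * s))\<^sup>2 \<le> 2 * (centred_mean f (w (s * q ^ J)) (\<rho> * (s * q ^ J)))\<^sup>2 +
      CC * (\<Sum>j<J. (s * q ^ j)\<^sup>2 / (s * q ^ j) ^ d) * (LINT x:interior M|lborel. (norm (G x))\<^sup>2)"
    by (elim exE conjE) (rule that)
  have chain: "(centred_mean f (w s) (\<rho> * s))\<^sup>2 \<le> 2 * (centred_mean f (w (s * q ^ J)) (\<rho> * (s * q ^ J)))\<^sup>2 +
      CC * (\<Sum>j<J. (s * q ^ j)\<^sup>2 / (s * q ^ j) ^ d) * (LINT x:interior M|lborel. (norm (G x))\<^sup>2)"
    if "integrable N f" "has_weak_gradient M f G" "interior_cone M L s x w" for f G x w J
    using chain'[rule_format, OF that(1,2) s that(3)] .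
  define B where "B r = (V * (1 / r) ^ d)\<^sup>2" for r :: real
  define \<beta> :: real where "\<beta> = ((1 / 2) ^ d)\<^sup>2"
  have \<beta>: "0 < \<beta>" by (simp add: \<beta>_def)
  define Ca where "Ca = 2 + 4 * CP + 8 * B (\<rho> * s) * CP / \<beta>"
  define Cb where "Cb = 16 * B \<rho> / \<beta>"
  define Cc where "Cc = 16 * V * CC / \<beta>"
  define C where "C = Ca + Cb + Cc"
  have B0: "0 \<le> B r" for r by (simp add: B_def)
  have pos: "0 < Ca" "0 \<le> Cb" "0 \<le> Cc"
    using CP CC \<beta> B0[of "\<rho> * s"] B0[of \<rho>] V_pos by (auto simp: Ca_def Cb_def Cc_def intro!: add_pos_nonneg)
  show ?thesis
  proof (intro exI[of _ C] conjI allI impI)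
    show "0 < C" using pos by (simp add: C_def)
    fix x w and J :: nat and f :: "real^'n \<Rightarrow> real" and h :: real
    assume cone: "interior_cone M L s x w" and h: "0 < h" "h \<le> 1" and f: "f \<in> sqint N"
      and hole: "\<forall>z \<in> ball (w (s * q ^ J)) (s * q ^ J / L). f z = 0"
    define k where "k = energy h f"
    have k0: "0 \<le> k" unfolding k_def by (rule energy_nonneg[OF f h(1)])
    \<comment> \<open>The function \<open>f\<close> need not have a weak gradient; its smoothing does.\<close>
    define g where "g = K h f"
    have g: "g \<in> sqint N" unfolding g_def by (rule K_sqint[OF h(1) f])
    have eg: "energy t g \<le> k" if "0 < t" for t unfolding g_def k_def by (rule energy_K_le[OF f h(1) that])
    have fg: "ip N (\<lambda>x. f x - g x) (\<lambda>x. f x - g x) \<le> h * k" unfolding g_def k_def by (rule ip_diff_K_le[OF f h(1)])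
    have gL: "g \<in> L2 M" using g by (simp add: sqint_eq_L2)
    have H1: "g \<in> H1 M" "dirichlet_form M g g \<le> k" using bounded_energy_imp_H1(1,2)[OF gL eg] by blast+
    define G where "G = weak_gradient M g"
    define S where "S = (LINT x:interior M|lborel. (norm (G x))\<^sup>2)"
    have S: "S \<le> 2 * V * k"
      using H1(2) V_pos unfolding dirichlet_form_lborel[OF H1(1)] by (simp add: S_def G_def divide_le_eq mult_ac)
    have wG: "has_weak_gradient M g G" unfolding G_def by (rule weak_gradient_has_weak_gradient[OF H1(1)])
    have gi: "integrable N g" and fi: "integrable N f" using sqint_integrable g f by auto
    define tJ where "tJ = s * q ^ J"
    have tJ: "0 < tJ" "tJ \<in> {0<..s}" using s q by (auto simp: tJ_def power_le_one)
    define A where "A = (\<Sum>j<J. (s * q ^ j)\<^sup>2 / (s * q ^ j) ^ d)"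
    have A0: "0 \<le> A" unfolding A_def using s q by (intro sum_nonneg) auto
    have cube_sub: "cube v (3 / 2 * (\<rho> * t)) \<subseteq> ball v (t / L)" if "0 < t" for v t
      using that d L by (intro cube_subset_ball) (simp add: \<rho>_def d_def[symmetric] field_simps)
    define mJ where "mJ = centred_mean g (w tJ) (\<rho> * tJ)"
    have mJ: "mJ\<^sup>2 \<le> B (\<rho> * tJ) * (h * k)"
    proof -
      \<comment> \<open>The bump at the smallest scale is supported in the hole, so only \<open>f - g\<close> contributes.\<close>
      have "centred_mean f (w tJ) (\<rho> * tJ) = 0"
        using hole cube_sub[OF tJ(1), of "w tJ"] \<rho> tJ(1) by (intro centred_mean_eq_0) (auto simp: tJ_def)
      then have "mJ\<^sup>2 = (centred_mean (\<lambda>x. f x - g x) (w tJ) (\<rho> * tJ))\<^sup>2"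
        using centred_mean_diff[OF fi gi, of "\<rho> * tJ" "w tJ"] \<rho> tJ(1) by (simp add: mJ_def)
      also have "\<dots> \<le> B (\<rho> * tJ) * ip N (\<lambda>x. f x - g x) (\<lambda>x. f x - g x)"
        unfolding B_def d_def using \<rho> tJ(1) by (intro centred_mean_square_le sqint_diff f g) auto
      also have "\<dots> \<le> B (\<rho> * tJ) * (h * k)" using fg B0 by (intro mult_left_mono) auto
      finally show ?thesis .
    qed
    define m0 where "m0 = centred_mean g (w s) (\<rho> * s)"
    have "m0\<^sup>2 \<le> 2 * mJ\<^sup>2 + CC * A * S"
      using chain[OF gi wG cone, of J] by (simp add: m0_def mJ_def A_def S_def tJ_def)
    also have "\<dots> \<le> 2 * (B (\<rho> * tJ) * (h * k)) + CC * A * (2 * V * k)"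
      using mJ S CC A0 by (intro add_mono mult_left_mono) auto
    finally have m0: "m0\<^sup>2 \<le> 2 * (B (\<rho> * tJ) * (h * k)) + CC * A * (2 * V * k)" .
    define \<mu> where "\<mu> = (\<integral>x. g x \<partial>N)"
    have c: "(\<lambda>x. \<mu>) \<in> sqint N" by (rule sqint_const)
    have P: "ip N (\<lambda>x. g x - \<mu>) (\<lambda>x. g x - \<mu>) \<le> CP * k" unfolding \<mu>_def by (rule poincare[OF g eg])
    \<comment> \<open>The mean of \<open>g\<close> over \<open>M\<close> is compared with the average at the largest scale, whose bump has mass at
      least \<open>(1 / 2) ^ d\<close> inside \<open>M\<close>.\<close>
    have \<mu>2: "\<beta> * \<mu>\<^sup>2 \<le> 2 * m0\<^sup>2 + 2 * (B (\<rho> * s) * (CP * k))"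
    proof -
      define \<alpha> where "\<alpha> = centred_mean (\<lambda>x. 1) (w s) (\<rho> * s)"
      have "ball (w s) (s / L) \<subseteq> M" using cone s unfolding interior_cone_def by auto
      then have "ball (w s) (s / L) \<subseteq> interior M" by (simp add: interior_maximal)
      then have "cube (w s) (3 / 2 * (\<rho> * s)) \<subseteq> interior M" using cube_sub[OF s, of "w s"] by blast
      then have "(1 / 2) ^ d \<le> \<alpha>" unfolding \<alpha>_def d_def using \<rho> s by (intro centred_mean_one_ge) auto
      then have "\<beta> \<le> \<alpha>\<^sup>2" unfolding \<beta>_def by (intro power_mono) auto
      define v where "v = centred_mean (\<lambda>x. g x - \<mu>) (w s) (\<rho> * s)"
      have "v = m0 - \<mu> * \<alpha>"
        unfolding v_def m0_def \<alpha>_def using \<rho> s centred_mean_const[of \<mu> "w s" "\<rho> * s"]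
        by (subst centred_mean_diff[OF gi integrable_const]) auto
      then have \<mu>\<alpha>: "\<mu> * \<alpha> = m0 - v" by simp
      have v2: "v\<^sup>2 \<le> B (\<rho> * s) * (CP * k)"
      proof -
        have "v\<^sup>2 \<le> B (\<rho> * s) * ip N (\<lambda>x. g x - \<mu>) (\<lambda>x. g x - \<mu>)"
          unfolding B_def d_def v_def using \<rho> s by (intro centred_mean_square_le sqint_diff g c) auto
        also have "\<dots> \<le> B (\<rho> * s) * (CP * k)" using P B0 by (intro mult_left_mono) auto
        finally show ?thesis .
      qed
      have "\<beta> * \<mu>\<^sup>2 \<le> \<alpha>\<^sup>2 * \<mu>\<^sup>2" using \<open>\<beta> \<le> \<alpha>\<^sup>2\<close> by (intro mult_right_mono) auto
      also have "\<dots> = (m0 - v)\<^sup>2" unfolding \<mu>\<alpha>[symmetric] by (simp add: power_mult_distrib)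
      also have "\<dots> \<le> 2 * m0\<^sup>2 + 2 * v\<^sup>2"
      proof -
        have "0 \<le> (m0 + v)\<^sup>2" by simp
        then show ?thesis by (simp add: power2_eq_square algebra_simps)
      qed
      finally show ?thesis using v2 by linarith
    qed
    have gg: "ip N g g \<le> 2 * (CP * k) + 2 * \<mu>\<^sup>2"
    proof -
      have "ip N (\<lambda>x. (g x - \<mu>) + \<mu>) (\<lambda>x. (g x - \<mu>) + \<mu>) \<le> 2 * ip N (\<lambda>x. g x - \<mu>) (\<lambda>x. g x - \<mu>) + 2 * ip N (\<lambda>x. \<mu>) (\<lambda>x. \<mu>)"
        by (intro ip_add_le sqint_diff g c)
      then show ?thesis using P by (simp add: ip_const)
    qed
    have ff: "ip N f f \<le> 2 * (h * k) + 2 * ip N g g"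
    proof -
      have "ip N (\<lambda>x. (f x - g x) + g x) (\<lambda>x. (f x - g x) + g x) \<le> 2 * ip N (\<lambda>x. f x - g x) (\<lambda>x. f x - g x) + 2 * ip N g g"
        by (intro ip_add_le sqint_diff f g)
      then show ?thesis using fg by simp
    qed
    have hk: "h * k \<le> k" using h k0 by (simp add: mult_left_le_one_le)
    have "\<mu>\<^sup>2 \<le> (2 * m0\<^sup>2 + 2 * (B (\<rho> * s) * (CP * k))) / \<beta>" using \<mu>2 \<beta> by (simp add: le_divide_eq mult.commute)
    also have "\<dots> \<le> (2 * (2 * (B (\<rho> * tJ) * (h * k)) + CC * A * (2 * V * k)) + 2 * (B (\<rho> * s) * (CP * k))) / \<beta>"
      using m0 \<beta> by (intro divide_right_mono) auto
    finally have \<mu>3: "\<mu>\<^sup>2 \<le> (4 * (B (\<rho> * tJ) * (h * k)) + 4 * V * CC * A * k + 2 * (B (\<rho> * s) * (CP * k))) / \<beta>"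
      by (simp add: algebra_simps)
    have "ip N f f \<le> 2 * k + 4 * (CP * k) + 4 * \<mu>\<^sup>2" using ff gg hk by linarith
    also have "\<dots> \<le> 2 * k + 4 * (CP * k) + 4 * ((4 * (B (\<rho> * tJ) * (h * k)) + 4 * V * CC * A * k + 2 * (B (\<rho> * s) * (CP * k))) / \<beta>)"
      using mult_left_mono[OF \<mu>3, of 4] by linarith
    also have "\<dots> = Ca * k + 16 * B (\<rho> * tJ) / \<beta> * h * k + Cc * A * k"
      by (simp add: Ca_def Cc_def add_divide_distrib algebra_simps)
    also have "16 * B (\<rho> * tJ) / \<beta> * h * k = Cb * (h / tJ ^ (2 * d)) * k"
    proof -
      have "B (\<rho> * tJ) = B \<rho> / tJ ^ (2 * d)"
        by (simp add: B_def power_mult_distrib power_divide power_mult[symmetric] mult.commute[of d 2])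
      then show ?thesis by (simp add: Cb_def)
    qed
    also have "Ca * k + Cb * (h / tJ ^ (2 * d)) * k + Cc * A * k = (Ca * 1 + Cb * (h / tJ ^ (2 * d)) + Cc * A) * k"
      by (simp add: algebra_simps)
    also have "\<dots> \<le> (C * 1 + C * (h / tJ ^ (2 * d)) + C * A) * k"
      using pos k0 A0 h tJ by (intro mult_right_mono add_mono) (auto simp: C_def intro!: divide_nonneg_pos)
    also have "\<dots> = C * (1 + h / tJ ^ (2 * d) + A) * k" by (simp add: distrib_left)
    finally show "ip N f f \<le> C * (1 + h / (s * q ^ J) ^ (2 * d) + (\<Sum>j<J. (s * q ^ j)\<^sup>2 / (s * q ^ j) ^ d)) * energy h f"
      by (simp add: tJ_def A_def k_def)
  qed
qed

text \<open>The hole is the ball of the cone at the first scale \<open>t \<le> \<epsilon> / (4 L)\<close>, which lies in the ball of radius \<open>\<epsilon>\<close>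
  about the apex. Since \<open>t\<close> is still comparable to \<open>\<epsilon>\<close>, the step \<open>h = \<epsilon> ^ (2 * d)\<close> keeps \<open>h / t ^ (2 * d)\<close>
  bounded, and the sum over the scales gives the factor \<open>1 / kappa\<close>.\<close>

theorem hole_estimate:
  assumes dim: "2 \<le> CARD('n)" and L: "1 \<le> L" and s: "0 < s" and cones: "\<forall>x\<in>M. \<exists>w. interior_cone M L s x w"
  shows "\<exists>C\<ge>1. \<exists>\<epsilon>0>0. \<epsilon>0 \<le> exp (-1) \<and> (\<forall>\<epsilon> x. 0 < \<epsilon> \<longrightarrow> \<epsilon> < \<epsilon>0 \<longrightarrow> x \<in> M \<longrightarrow>
    (\<exists>y r. 0 < r \<and> ball y r \<subseteq> M \<inter> ball x \<epsilon> \<and>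
      (\<forall>f\<in>sqint N. (\<forall>z\<in>ball y r. f z = 0) \<longrightarrow>
         ip N (K (\<epsilon> ^ (2 * CARD('n))) f) f \<le> (1 - kappa CARD('n) \<epsilon> * \<epsilon> ^ (2 * CARD('n)) / C) * ip N f f)))"
    (is "\<exists>C\<ge>1. \<exists>\<epsilon>0>0. \<epsilon>0 \<le> exp (-1) \<and> ?P C \<epsilon>0")
proof -
  define d where "d = CARD('n)"
  define q where "q = 1 - 1 / (8 * real d * L\<^sup>2)"
  have d: "2 \<le> d" "1 \<le> real d" using dim by (auto simp: d_def)
  have "1 \<le> real d * L\<^sup>2" using mult_mono[OF d(2) one_le_power[OF L, of 2]] by simp
  then have q: "0 < q" "q < 1" unfolding q_def by (simp_all add: field_simps)
  obtain C1 where C1: "0 < C1" and est: "\<And>x w J f h. interior_cone M L s x w \<Longrightarrow> 0 < h \<Longrightarrow> h \<le> 1 \<Longrightarrow> f \<in> sqint N \<Longrightarrow>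
     (\<forall>z \<in> ball (w (s * q ^ J)) (s * q ^ J / L). f z = 0) \<Longrightarrow>
     ip N f f \<le> C1 * (1 + h / (s * q ^ J) ^ (2 * d) + (\<Sum>j<J. (s * q ^ j)\<^sup>2 / (s * q ^ j) ^ d)) * energy h f"
    using smoothed_hole_estimate[OF L s] unfolding d_def q_def by blast
  obtain C2 where C2: "0 < C2" and sums: "\<And>\<epsilon> J. 0 < \<epsilon> \<Longrightarrow> \<epsilon> \<le> exp (-1) \<Longrightarrow> (\<forall>j<J. \<epsilon> / (4 * L) < s * q ^ j) \<Longrightarrow>
     (\<Sum>j<J. (s * q ^ j)\<^sup>2 / (s * q ^ j) ^ d) \<le> C2 * inverse (kappa d \<epsilon>)"
    using scale_sum_le[OF d(1) q _ s, of L] L by auto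
  define C3 where "C3 = (4 * L / q) ^ (2 * d)"
  have C3: "0 < C3" using L q by (simp add: C3_def)
  define C where "C = max 1 (C1 * (1 + C3 + C2))"
  define \<epsilon>0 where "\<epsilon>0 = min (exp (-1)) (4 * L * s)"
  have C_ge: "1 \<le> C" by (simp add: C_def)
  have \<epsilon>0: "0 < \<epsilon>0" "\<epsilon>0 \<le> exp (-1)" using L s by (auto simp: \<epsilon>0_def)
  have "?P C \<epsilon>0"
  proof (intro allI impI)
    fix \<epsilon> x assume \<epsilon>: "0 < \<epsilon>" "\<epsilon> < \<epsilon>0" and x: "x \<in> M"
    have \<epsilon>e: "\<epsilon> \<le> exp (-1)" and \<epsilon>s: "\<epsilon> / (4 * L) < s" using \<epsilon> L by (auto simp: \<epsilon>0_def divide_less_eq mult_ac)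
    have "exp (-1) \<le> (1::real)" by simp
    then have \<epsilon>1: "\<epsilon> \<le> 1" using \<epsilon>e by linarith
    obtain w where cone: "interior_cone M L s x w" using cones x by blast
    have exJ: "\<exists>J. s * q ^ J \<le> \<epsilon> / (4 * L)"
    proof -
      define e where "e = \<epsilon> / (4 * L)"
      have "0 < e" using \<epsilon> L by (simp add: e_def)
      then obtain J where "q ^ J < e / s" using real_arch_pow_inv[of "e / s" q] q s by auto
      then have "s * q ^ J \<le> e" using s by (simp add: less_divide_eq mult.commute)
      then have "s * q ^ J \<le> \<epsilon> / (4 * L)" by (simp add: e_def)
      then show ?thesis ..
    qed
    define J where "J = (LEAST J. s * q ^ J \<le> \<epsilon> / (4 * L))"
    have J: "s * q ^ J \<le> \<epsilon> / (4 * L)" using LeastI_ex[OF exJ] by (simp add: J_def)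
    have less: "\<epsilon> / (4 * L) < s * q ^ j" if "j < J" for j
      using not_less_Least[of j "\<lambda>J. s * q ^ J \<le> \<epsilon> / (4 * L)"] that by (simp add: J_def not_le)
    have J0: "J \<noteq> 0" using J \<epsilon>s by (cases J) auto
    define t where "t = s * q ^ J"
    have t: "0 < t" "t \<in> {0<..s}" using s q by (auto simp: t_def power_le_one)
    have tlow: "q * \<epsilon> / (4 * L) \<le> t"
    proof -
      have "\<epsilon> / (4 * L) < s * q ^ (J - 1)" using less J0 by simp
      then have "q * (\<epsilon> / (4 * L)) \<le> q * (s * q ^ (J - 1))" using q by (intro mult_left_mono) auto
      also have "q * (s * q ^ (J - 1)) = t" unfolding t_def using power_minus_mult[of J q] J0 by (simp add: mult_ac)
      finally show ?thesis by simp
    qed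
    define h where "h = \<epsilon> ^ (2 * d)"
    have h: "0 < h" "h \<le> 1" using \<epsilon> \<epsilon>1 by (auto simp: h_def power_le_one)
    note \<kappa> = kappa_bounds[OF d(1) \<epsilon>(1) \<epsilon>e]
    have ht: "h / t ^ (2 * d) \<le> C3"
    proof -
      have "\<epsilon> \<le> 4 * L / q * t" using tlow L q by (simp add: field_simps)
      then have "h \<le> (4 * L / q * t) ^ (2 * d)" unfolding h_def using \<epsilon> by (intro power_mono) auto
      also have "\<dots> = C3 * t ^ (2 * d)" unfolding C3_def by (rule power_mult_distrib)
      finally show ?thesis using t by (simp add: divide_le_eq)
    qed
    have factor: "1 + h / t ^ (2 * d) + (\<Sum>j<J. (s * q ^ j)\<^sup>2 / (s * q ^ j) ^ d) \<le> (1 + C3 + C2) * inverse (kappa d \<epsilon>)"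
    proof -
      have ik: "1 \<le> inverse (kappa d \<epsilon>)" using \<kappa> by (simp add: one_le_inverse_iff)
      have "1 + h / t ^ (2 * d) \<le> (1 + C3) * 1" using ht by simp
      also have "\<dots> \<le> (1 + C3) * inverse (kappa d \<epsilon>)" using ik C3 by (intro mult_left_mono) auto
      finally show ?thesis using sums[OF \<epsilon>(1) \<epsilon>e, of J] less by (simp add: distrib_right)
    qed
    have main: "ip N (K h f) f \<le> (1 - kappa d \<epsilon> * h / C) * ip N f f"
      if f: "f \<in> sqint N" and hole: "\<forall>z\<in>ball (w t) (t / L). f z = 0" for f
    proof -
      have e0: "0 \<le> energy h f" by (rule energy_nonneg[OF f h(1)])
      have "ip N f f \<le> C1 * (1 + h / t ^ (2 * d) + (\<Sum>j<J. (s * q ^ j)\<^sup>2 / (s * q ^ j) ^ d)) * energy h f"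
        using est[OF cone h f, of J] hole by (simp add: t_def)
      also have "\<dots> \<le> C1 * ((1 + C3 + C2) * inverse (kappa d \<epsilon>)) * energy h f"
        using factor C1 e0 by (intro mult_right_mono mult_left_mono) auto
      also have "\<dots> \<le> C * inverse (kappa d \<epsilon>) * energy h f"
      proof (rule mult_right_mono[OF _ e0])
        have "C1 * (1 + C3 + C2) \<le> C" by (simp add: C_def)
        then show "C1 * ((1 + C3 + C2) * inverse (kappa d \<epsilon>)) \<le> C * inverse (kappa d \<epsilon>)"
          unfolding mult.assoc[symmetric] using \<kappa>(1) by (intro mult_right_mono) auto
      qed
      also have "\<dots> = C / (kappa d \<epsilon> * h) * (ip N f f - ip N (K h f) f)"
        by (simp add: energy_def inverse_eq_divide)
      finally have "kappa d \<epsilon> * h / C * ip N f f \<le> kappa d \<epsilon> * h / C * (C / (kappa d \<epsilon> * h) * (ip N f f - ip N (K h f) f))"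
        using \<kappa> h by (intro mult_left_mono) (auto simp: C_def)
      also have "\<dots> = ip N f f - ip N (K h f) f" using \<kappa> h C_ge by simp
      finally show ?thesis by (simp add: left_diff_distrib)
    qed
    have "ball (w t) (t / L) \<subseteq> M" using cone t(2) unfolding interior_cone_def by blast
    moreover have "ball (w t) (t / L) \<subseteq> ball x \<epsilon>"
    proof
      fix z assume z: "z \<in> ball (w t) (t / L)"
      have "dist x (w t) \<le> L * t" using cone t(2) unfolding interior_cone_def by blast
      moreover have "t / L \<le> L * t"
      proof -
        have "t / L \<le> t / 1" using t(1) L by (intro divide_left_mono) auto
        also have "\<dots> \<le> L * t" using t(1) L by simp
        finally show ?thesis .
      qed
      moreover have "2 * (L * t) \<le> \<epsilon> / 2" using J L by (simp add: t_def field_simps)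
      ultimately have "dist x z < \<epsilon>" using z dist_triangle[of x z "w t"] \<epsilon>(1) by simp
      then show "z \<in> ball x \<epsilon>" by simp
    qed
    ultimately show "\<exists>y r. 0 < r \<and> ball y r \<subseteq> M \<inter> ball x \<epsilon> \<and>
      (\<forall>f\<in>sqint N. (\<forall>z\<in>ball y r. f z = 0) \<longrightarrow>
         ip N (K (\<epsilon> ^ (2 * CARD('n))) f) f \<le> (1 - kappa CARD('n) \<epsilon> * \<epsilon> ^ (2 * CARD('n)) / C) * ip N f f)"
      using main t L unfolding h_def d_def by (intro exI[of _ "w t"] exI[of _ "t / L"]) auto
  qed
  with C_ge \<epsilon>0 show ?thesis by blast
qed

end

section \<open>The process at discrete times\<close>

locale hunt_kernel = body M for M :: "'a::euclidean_space set" +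
  fixes P :: "'a \<Rightarrow> (real \<Rightarrow> 'a) measure" and p :: "real \<Rightarrow> 'a \<Rightarrow> 'a \<Rightarrow> real"
  assumes hunt: "hunt_process M P" and heat: "neumann_heat_kernel M P p"
begin

lemma space_path: "space (path_space M) = {\<omega> \<in> extensional {0..}. continuous_on {0..} \<omega> \<and> \<omega> ` {0..} \<subseteq> M}"
  unfolding path_space_def space_restrict_space space_PiM by (auto simp: PiE_def)

lemma coordinate_measurable_borel: "0 \<le> t \<Longrightarrow> (\<lambda>\<omega>. \<omega> t) \<in> path_space M \<rightarrow>\<^sub>M borel"
  unfolding path_space_def by (intro measurable_restrict_space1 measurable_component_singleton) simp

lemma coordinate_measurable: "0 \<le> t \<Longrightarrow> (\<lambda>\<omega>. \<omega> t) \<in> path_space M \<rightarrow>\<^sub>M N"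
proof -
  assume t: "0 \<le> t"
  have "(\<lambda>\<omega>. \<omega> t) \<in> path_space M \<rightarrow>\<^sub>M restrict_space borel M"
    using t by (intro measurable_restrict_space2 coordinate_measurable_borel) (auto simp: space_path)
  then show ?thesis using measurable_cong_sets[OF refl sets_N, of "path_space M"] by simp
qed

lemma P_kernel: "z \<in> M \<Longrightarrow> prob_space (P z)" "z \<in> M \<Longrightarrow> sets (P z) = sets (path_space M)" "z \<in> M \<Longrightarrow> space (P z) = space (path_space M)"
proof -
  assume z: "z \<in> M"
  have "P \<in> restrict_space borel M \<rightarrow>\<^sub>M prob_algebra (path_space M)" using hunt by (simp add: hunt_process_def)
  from measurable_space[OF this] have "P z \<in> space (prob_algebra (path_space M))" using z by (simp add: space_restrict_space)
  then show "prob_space (P z)" "sets (P z) = sets (path_space M)" by (auto simp: space_prob_algebra)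
  then show "space (P z) = space (path_space M)" by (intro sets_eq_imp_space_eq)
qed

lemma coordinate_measurable_P: "z \<in> M \<Longrightarrow> 0 \<le> t \<Longrightarrow> (\<lambda>\<omega>. \<omega> t) \<in> P z \<rightarrow>\<^sub>M N"
  using coordinate_measurable measurable_cong_sets[OF P_kernel(2) refl] by blast

lemma start: "z \<in> M \<Longrightarrow> AE \<omega> in P z. \<omega> 0 = z"
  using hunt by (simp add: hunt_process_def)

lemma heat_facts:
  assumes "0 < t"
  shows "(\<lambda>(x, y). p t x y) \<in> borel_measurable (N \<Otimes>\<^sub>M N)"
    "\<And>x y. x \<in> M \<Longrightarrow> y \<in> M \<Longrightarrow> 0 \<le> p t x y" "\<And>x y. x \<in> M \<Longrightarrow> y \<in> M \<Longrightarrow> p t x y = p t y x"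
    "\<And>x. x \<in> M \<Longrightarrow> distr (P x) N (\<lambda>\<omega>. \<omega> t) = density N (\<lambda>y. ennreal (p t x y))"
  using heat assms unfolding neumann_heat_kernel_def by auto

lemma kernel_section_measurable: "0 < t \<Longrightarrow> x \<in> M \<Longrightarrow> (\<lambda>y. p t x y) \<in> borel_measurable N"
  using measurable_compose[OF measurable_Pair1' heat_facts(1)] space_N by simp

lemma nn_integral_coordinate:
  assumes t: "0 < t" and x: "x \<in> M" and f: "f \<in> borel_measurable N"
  shows "(\<integral>\<^sup>+\<omega>. f (\<omega> t) \<partial>P x) = (\<integral>\<^sup>+y. ennreal (p t x y) * f y \<partial>N)"
proof -
  have "(\<integral>\<^sup>+\<omega>. f (\<omega> t) \<partial>P x) = (\<integral>\<^sup>+y. f y \<partial>distr (P x) N (\<lambda>\<omega>. \<omega> t))"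
    using f coordinate_measurable_P[OF x] t by (subst nn_integral_distr) auto
  also have "\<dots> = (\<integral>\<^sup>+y. ennreal (p t x y) * f y \<partial>N)"
    unfolding heat_facts(4)[OF t x] using f kernel_section_measurable[OF t x] by (subst nn_integral_density) auto
  finally show ?thesis .
qed

sublocale kernel: symmetric_markov_kernel "norm_lebesgue M" p
proof -
  interpret prob_space N by (rule prob_space_N)
  show "symmetric_markov_kernel N p"
  proof
    fix t :: real and x y assume t: "0 < t" and x: "x \<in> space N"
    have "(\<integral>\<^sup>+\<omega>. 1 \<partial>P x) = (\<integral>\<^sup>+y. ennreal (p t x y) * 1 \<partial>N)"
      using nn_integral_coordinate[OF t, of x "\<lambda>_. 1"] x space_N by simp
    moreover have "(\<integral>\<^sup>+\<omega>. 1 \<partial>P x) = 1"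
      using prob_space.emeasure_space_1[OF P_kernel(1)] x space_N by simp
    ultimately show "(\<integral>\<^sup>+y. ennreal (p t x y) \<partial>N) = 1" by simp
  qed (use heat_facts space_N heat in \<open>auto simp: neumann_heat_kernel_def\<close>)
qed

lemma transition_op_kernel:
  assumes t: "0 < t" and f: "f \<in> L2 M" and x: "x \<in> M"
  shows "transition_op P t f x = kernel.K t f x"
proof -
  have fm: "f \<in> borel_measurable N" using f by (simp add: L2_def)
  have "transition_op P t f x = (\<integral>y. f y \<partial>distr (P x) N (\<lambda>\<omega>. \<omega> t))"
    unfolding transition_op_def using fm coordinate_measurable_P[OF x] t by (subst integral_distr) auto
  also have "\<dots> = (\<integral>y. p t x y *\<^sub>R f y \<partial>N)"
    unfolding heat_facts(4)[OF t x] using fm kernel_section_measurable[OF t x] heat_facts(2)[OF t x]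
    by (subst integral_density) (auto simp: space_N)
  finally show ?thesis by (simp add: kernel.K_def)
qed

lemma filtration_right: "filtration (space (path_space M)) (right_filtration M)"
proof
  show "space (right_filtration M i) = space (path_space M)" for i
    by (simp add: right_filtration_def space_measure_of_conv)
  fix i j :: ennreal assume ij: "i \<le> j"
  have pow: "{A. A \<in> sets (natural_filtration M \<infinity>) \<and> (\<forall>u>i. A \<in> sets (natural_filtration M u))} \<subseteq> Pow (space (path_space M))" for i
  proof
    fix A assume "A \<in> {A. A \<in> sets (natural_filtration M \<infinity>) \<and> (\<forall>u>i. A \<in> sets (natural_filtration M u))}"
    then have "A \<subseteq> space (natural_filtration M \<infinity>)" by (auto dest: sets.sets_into_space)
    then show "A \<in> Pow (space (path_space M))" by (simp add: natural_filtration_def space_measure_of_conv)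
  qed
  show "sets (right_filtration M i) \<subseteq> sets (right_filtration M j)"
    unfolding right_filtration_def sets_measure_of[OF pow]
    by (rule sigma_sets_mono') (use ij in auto)
qed

text \<open>The strong Markov property at a constant stopping time.\<close>

lemma markov_fixed_time:
  assumes z: "z \<in> M" and s: "0 \<le> s" and B: "B \<in> sets (path_space M)"
  shows "emeasure (P z) {\<omega> \<in> space (path_space M). path_shift s \<omega> \<in> B} = (\<integral>\<^sup>+\<omega>. emeasure (P (\<omega> s)) B \<partial>P z)"
proof -
  let ?\<tau> = "\<lambda>_::real \<Rightarrow> 'a. ennreal s"
  interpret F: filtration "space (path_space M)" "right_filtration M" by (rule filtration_right)
  have st: "stopping_time (right_filtration M) ?\<tau>" by (rule stopping_time_const)
  have top: "space (path_space M) \<in> sets (F.pre_sigma ?\<tau>)"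
    using sets.top[of "F.pre_sigma ?\<tau>"] by (simp add: F.space_pre_sigma)
  have "emeasure (P z) {\<omega>\<in>space (path_space M). ?\<tau> \<omega> < \<infinity> \<and> path_shift (enn2real (?\<tau> \<omega>)) \<omega> \<in> B} =
      (\<integral>\<^sup>+\<omega>. emeasure (P (\<omega> (enn2real (?\<tau> \<omega>)))) B * indicator {\<omega>\<in>space (path_space M). ?\<tau> \<omega> < \<infinity>} \<omega> \<partial>P z)"
    using hunt st z top B unfolding hunt_process_def by blast
  moreover have "(\<integral>\<^sup>+\<omega>. emeasure (P (\<omega> s)) B * indicator {\<omega>\<in>space (path_space M). ennreal s < \<infinity>} \<omega> \<partial>P z) =
      (\<integral>\<^sup>+\<omega>. emeasure (P (\<omega> s)) B \<partial>P z)"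
    using P_kernel(3)[OF z] by (intro nn_integral_cong) simp
  ultimately show ?thesis using s by simp
qed

lemma path_shift_in_space: "\<omega> \<in> space (path_space M) \<Longrightarrow> 0 \<le> s \<Longrightarrow> path_shift s \<omega> \<in> space (path_space M)"
proof -
  assume \<omega>: "\<omega> \<in> space (path_space M)" and s: "0 \<le> s"
  have c: "continuous_on {0..} \<omega>" and im: "\<omega> ` {0..} \<subseteq> M" using \<omega> by (auto simp: space_path)
  have "continuous_on {0..} (\<lambda>t. \<omega> (s + t))"
    using s by (intro continuous_on_compose2[OF c] continuous_intros) auto
  then have "continuous_on {0..} (path_shift s \<omega>)"
    by (rule continuous_on_eq) (simp add: path_shift_def)
  moreover have "path_shift s \<omega> ` {0..} \<subseteq> M" using im s by (auto simp: path_shift_def)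
  ultimately show ?thesis by (auto simp: space_path path_shift_def)
qed

definition avoid :: "'a set \<Rightarrow> real \<Rightarrow> real \<Rightarrow> nat \<Rightarrow> (real \<Rightarrow> 'a) set" where
  "avoid D s h n = {\<omega> \<in> space (path_space M). \<forall>k\<le>n. \<omega> (s + real k * h) \<notin> D}"

lemma avoid_sets:
  assumes D: "D \<in> sets borel" and "0 \<le> s" "0 \<le> h"
  shows "avoid D s h n \<in> sets (path_space M)"
proof -
  have "{\<omega> \<in> space (path_space M). \<omega> (s + real k * h) \<notin> D} \<in> sets (path_space M)" for k
  proof -
    have "(\<lambda>\<omega>. \<omega> (s + real k * h)) -` (- D) \<inter> space (path_space M) \<in> sets (path_space M)"
      using D assms by (intro measurable_sets[OF coordinate_measurable_borel]) auto
    then show ?thesis by (simp add: vimage_def Int_def conj_commute)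
  qed
  then have "(\<Inter>k\<in>{..n}. {\<omega> \<in> space (path_space M). \<omega> (s + real k * h) \<notin> D}) \<in> sets (path_space M)"
    by (intro sets.finite_INT) auto
  moreover have "(\<Inter>k\<in>{..n}. {\<omega> \<in> space (path_space M). \<omega> (s + real k * h) \<notin> D}) = avoid D s h n"
    by (auto simp: avoid_def)
  ultimately show ?thesis by simp
qed

lemma avoid_shift: "0 \<le> s \<Longrightarrow> 0 \<le> h \<Longrightarrow>
    {\<omega> \<in> space (path_space M). path_shift s \<omega> \<in> avoid D 0 h n} = avoid D s h n"
  using path_shift_in_space by (auto simp: avoid_def path_shift_def)

lemma killed_nonneg:
  assumes h: "0 < h" and A: "A \<subseteq> M" shows "0 \<le> kernel.killed A h n x"
proof (induction n arbitrary: x)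
  case (Suc n)
  show ?case
  proof (cases "x \<in> A")
    case True
    then have "0 \<le> kernel.K h (kernel.killed A h n) x"
      unfolding kernel.K_def using heat_facts(2)[OF h] Suc.IH A
      by (intro integral_nonneg_AE AE_I2) (auto simp: space_N)
    then show ?thesis by simp
  qed simp
qed simp

lemma N_set_diff: "D \<in> sets borel \<Longrightarrow> M - D \<in> sets N"
  unfolding sets_N sets_restrict_space by (intro image_eqI[of _ _ "M - D"]) auto

text \<open>Induction on the number of steps, with the Markov property at time \<open>h\<close>.\<close>

lemma emeasure_avoid_0:
  assumes D: "D \<in> sets borel" and h: "0 < h" and z: "z \<in> M"
  shows "emeasure (P z) (avoid D 0 h n) = ennreal (kernel.killed (M - D) h n z)"
  using z
proof (induction n arbitrary: z)
  case (0 z)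
  interpret prob_space "P z" using P_kernel(1)[OF 0] .
  have "emeasure (P z) (avoid D 0 h 0) = emeasure (P z) (if z \<in> D then {} else space (P z))"
  proof (rule emeasure_eq_AE)
    show "AE \<omega> in P z. \<omega> \<in> avoid D 0 h 0 \<longleftrightarrow> \<omega> \<in> (if z \<in> D then {} else space (P z))"
      using start[OF 0] AE_space by eventually_elim (auto simp: avoid_def P_kernel(3)[OF 0])
  qed (use avoid_sets[OF D, of 0 h 0] h P_kernel(2)[OF 0] in auto)
  then show ?case using 0 emeasure_space_1 by simp
next
  case (Suc n z)
  let ?A = "M - D"
  have h0: "0 \<le> h" using h by simp
  have sq: "kernel.killed ?A h n \<in> sqint N" by (rule kernel.killed_sqint[OF h N_set_diff[OF D]])
  have nn: "0 \<le> kernel.killed ?A h n y" for y by (rule killed_nonneg[OF h]) auto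
  have next_step: "emeasure (P z) (avoid D h h n) = ennreal (kernel.K h (kernel.killed ?A h n) z)"
  proof -
    have "emeasure (P z) (avoid D h h n) = (\<integral>\<^sup>+\<omega>. emeasure (P (\<omega> h)) (avoid D 0 h n) \<partial>P z)"
      using markov_fixed_time[OF Suc.prems h0 avoid_sets[OF D, of 0 h n]] h0 by (simp add: avoid_shift)
    also have "\<dots> = (\<integral>\<^sup>+\<omega>. ennreal (kernel.killed ?A h n (\<omega> h)) \<partial>P z)"
    proof (rule nn_integral_cong)
      fix \<omega> assume "\<omega> \<in> space (P z)"
      then have "\<omega> h \<in> M" using P_kernel(3)[OF Suc.prems] h0 by (auto simp: space_path)
      then show "emeasure (P (\<omega> h)) (avoid D 0 h n) = ennreal (kernel.killed ?A h n (\<omega> h))" by (rule Suc.IH)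
    qed
    also have "\<dots> = (\<integral>\<^sup>+y. ennreal (p h z y) * ennreal (kernel.killed ?A h n y) \<partial>N)"
      by (rule nn_integral_coordinate[OF h Suc.prems measurable_compose[OF sqint_measurable[OF sq] measurable_ennreal]])
    also have "\<dots> = (\<integral>\<^sup>+y. ennreal (p h z y * kernel.killed ?A h n y) \<partial>N)"
      using heat_facts(2)[OF h Suc.prems] nn by (intro nn_integral_cong) (auto simp: space_N ennreal_mult)
    also have "\<dots> = ennreal (kernel.K h (kernel.killed ?A h n) z)"
      unfolding kernel.K_def using kernel.K_integrable[OF h _ sq, of z] heat_facts(2)[OF h Suc.prems] nn Suc.prems
      by (intro nn_integral_eq_integral) (auto simp: space_N)
    finally show ?thesis .
  qed
  have split: "\<omega> \<in> avoid D 0 h (Suc n) \<longleftrightarrow> \<omega> 0 \<notin> D \<and> \<omega> \<in> avoid D h h n" for \<omega>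
  proof -
    have "(\<forall>k\<le>Suc n. \<omega> (0 + real k * h) \<notin> D) \<longleftrightarrow> \<omega> 0 \<notin> D \<and> (\<forall>k\<le>n. \<omega> (h + real k * h) \<notin> D)"
      using All_less_Suc2[of "Suc n" "\<lambda>k. \<omega> (0 + real k * h) \<notin> D"] unfolding less_Suc_eq_le
      by (simp add: distrib_right)
    then show ?thesis by (auto simp: avoid_def)
  qed
  have "emeasure (P z) (avoid D 0 h (Suc n)) = emeasure (P z) (if z \<in> D then {} else avoid D h h n)"
  proof (rule emeasure_eq_AE)
    show "AE \<omega> in P z. \<omega> \<in> avoid D 0 h (Suc n) \<longleftrightarrow> \<omega> \<in> (if z \<in> D then {} else avoid D h h n)"
      using start[OF Suc.prems] by eventually_elim (auto simp: split)
  qed (use avoid_sets[OF D, of 0 h "Suc n"] avoid_sets[OF D, of h h n] h0 P_kernel(2)[OF Suc.prems] in auto)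
  then show ?case using next_step Suc.prems by simp
qed

text \<open>After the waiting time \<open>s\<close> the law of the process is dominated by \<open>a\<close> times the stationary law.\<close>

lemma emeasure_avoid_le:
  assumes D: "D \<in> sets borel" and h: "0 < h" and z: "z \<in> M" and s: "0 < s" and a: "0 \<le> a" "\<And>y. y \<in> M \<Longrightarrow> p s z y \<le> a"
  shows "measure (P z) (avoid D s h n) \<le> a * (\<integral>y. kernel.killed (M - D) h n y \<partial>N)"
proof -
  let ?A = "M - D"
  interpret Pz: prob_space "P z" using P_kernel(1)[OF z] .
  have h0: "0 \<le> h" using h by simp
  have sq: "kernel.killed ?A h n \<in> sqint N" by (rule kernel.killed_sqint[OF h N_set_diff[OF D]])
  have nn: "0 \<le> kernel.killed ?A h n y" for y by (rule killed_nonneg[OF h]) auto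
  have "emeasure (P z) (avoid D s h n) = (\<integral>\<^sup>+\<omega>. emeasure (P (\<omega> s)) (avoid D 0 h n) \<partial>P z)"
    using markov_fixed_time[OF z _ avoid_sets[OF D, of 0 h n], of s] h0 s by (simp add: avoid_shift)
  also have "\<dots> = (\<integral>\<^sup>+\<omega>. ennreal (kernel.killed ?A h n (\<omega> s)) \<partial>P z)"
  proof (rule nn_integral_cong)
    fix \<omega> assume "\<omega> \<in> space (P z)"
    then have "\<omega> s \<in> M" using P_kernel(3)[OF z] s by (auto simp: space_path)
    then show "emeasure (P (\<omega> s)) (avoid D 0 h n) = ennreal (kernel.killed ?A h n (\<omega> s))"
      by (rule emeasure_avoid_0[OF D h])
  qed
  also have "\<dots> = (\<integral>\<^sup>+y. ennreal (p s z y) * ennreal (kernel.killed ?A h n y) \<partial>N)"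
    by (rule nn_integral_coordinate[OF s z measurable_compose[OF sqint_measurable[OF sq] measurable_ennreal]])
  also have "\<dots> \<le> (\<integral>\<^sup>+y. ennreal (a * kernel.killed ?A h n y) \<partial>N)"
    using a nn by (intro nn_integral_mono) (auto simp: space_N ennreal_mult intro!: mult_right_mono ennreal_leI)
  also have "\<dots> = ennreal (\<integral>y. a * kernel.killed ?A h n y \<partial>N)"
    using kernel.sqint_integrable[OF sq] a nn by (intro nn_integral_eq_integral) auto
  finally have "emeasure (P z) (avoid D s h n) \<le> ennreal (a * (\<integral>y. kernel.killed ?A h n y \<partial>N))" by simp
  moreover have "0 \<le> a * (\<integral>y. kernel.killed ?A h n y \<partial>N)"
    using a nn by (intro mult_nonneg_nonneg integral_nonneg_AE) auto
  ultimately show ?thesis by (simp add: Pz.emeasure_eq_measure)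
qed

end

section \<open>Avoiding a small ball\<close>

locale reflected_brownian_body = rbm_body M p P + hunt_kernel M P p
  for M :: "(real^'n::finite) set" and p P
begin

text \<open>The target is the hole inside the \<open>\<epsilon>\<close>-ball; each step avoids it with the factor of the hole estimate, and
  the waiting time \<open>s\<close> costs the constant \<open>a\<close> once.\<close>

theorem avoid_decay:
  assumes dim: "2 \<le> CARD('n)" and charts: "uniform_charts M" and s: "0 < s" and a: "0 \<le> a"
    and dom: "\<forall>x\<in>M. \<forall>y\<in>M. p s x y \<le> a"
  shows "\<exists>C\<ge>1. \<exists>\<epsilon>0>0. \<epsilon>0 \<le> exp (-1) \<and> (\<forall>\<epsilon> x. 0 < \<epsilon> \<longrightarrow> \<epsilon> < \<epsilon>0 \<longrightarrow> x \<in> M \<longrightarrow>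
    (\<exists>D. D \<in> sets borel \<and> D \<subseteq> ball x \<epsilon> \<and>
      (\<forall>z\<in>M. \<forall>n. measure (P z) (avoid D s (\<epsilon> ^ (2 * CARD('n))) n) \<le>
         a * (1 - kappa CARD('n) \<epsilon> * \<epsilon> ^ (2 * CARD('n)) / C) ^ n)))"
    (is "\<exists>C\<ge>1. \<exists>\<epsilon>0>0. \<epsilon>0 \<le> exp (-1) \<and> ?P C \<epsilon>0")
proof -
  obtain L s1 where L: "1 \<le> L" and s1: "0 < s1" and cones: "\<forall>x\<in>M. \<exists>w. interior_cone M L s1 x w"
    using uniform_interior_cones[OF compact_M charts] by blast
  from hole_estimate[OF dim L s1 cones] obtain C \<epsilon>0 where C: "1 \<le> C" and \<epsilon>0: "0 < \<epsilon>0" "\<epsilon>0 \<le> exp (-1)"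
    and hole: "\<forall>\<epsilon> x. 0 < \<epsilon> \<longrightarrow> \<epsilon> < \<epsilon>0 \<longrightarrow> x \<in> M \<longrightarrow>
    (\<exists>y r. 0 < r \<and> ball y r \<subseteq> M \<inter> ball x \<epsilon> \<and>
      (\<forall>f\<in>sqint N. (\<forall>z\<in>ball y r. f z = 0) \<longrightarrow>
         ip N (K (\<epsilon> ^ (2 * CARD('n))) f) f \<le> (1 - kappa CARD('n) \<epsilon> * \<epsilon> ^ (2 * CARD('n)) / C) * ip N f f))"
    by (elim exE conjE) (rule that)
  have "?P C \<epsilon>0"
  proof (intro allI impI)
    fix \<epsilon> x assume \<epsilon>: "0 < \<epsilon>" "\<epsilon> < \<epsilon>0" and x: "x \<in> M"
    define h where "h = \<epsilon> ^ (2 * CARD('n))"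
    define \<rho> where "\<rho> = 1 - kappa CARD('n) \<epsilon> * h / C"
    have \<epsilon>e: "\<epsilon> \<le> exp (-1)" using \<epsilon> \<epsilon>0 by simp
    have "exp (-1) \<le> (1::real)" by simp
    then have \<epsilon>1: "\<epsilon> \<le> 1" using \<epsilon>e by linarith
    have h: "0 < h" "h \<le> 1" using \<epsilon> \<epsilon>1 by (auto simp: h_def power_le_one)
    note \<kappa> = kappa_bounds[OF dim \<epsilon>(1) \<epsilon>e]
    have "kappa CARD('n) \<epsilon> * h \<le> 1 * 1" using \<kappa> h by (intro mult_mono) auto
    then have \<rho>: "0 \<le> \<rho>" using C by (simp add: \<rho>_def divide_le_eq)
    obtain y r where yr: "0 < r" "ball y r \<subseteq> M \<inter> ball x \<epsilon>"
      and contr: "\<forall>f\<in>sqint N. (\<forall>z\<in>ball y r. f z = 0) \<longrightarrow> ip N (K h f) f \<le> \<rho> * ip N f f"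
      using hole \<epsilon> x unfolding h_def \<rho>_def by blast
    have D: "ball y r \<in> sets borel" by simp
    have "measure (P z) (avoid (ball y r) s h n) \<le> a * \<rho> ^ n" if z: "z \<in> M" for z n
    proof -
      have "measure (P z) (avoid (ball y r) s h n) \<le> a * (\<integral>y'. killed (M - ball y r) h n y' \<partial>N)"
        using emeasure_avoid_le[OF D h(1) z s a dom[rule_format, OF z], of n] .
      also have "\<dots> \<le> a * \<rho> ^ n"
      proof (rule mult_left_mono[OF killed_integral_le[OF h(1) N_set_diff[OF D] \<rho>] a])
        fix f assume f: "f \<in> sqint N" and f0: "\<And>x. x \<notin> M - ball y r \<Longrightarrow> f x = 0"
        show "ip N (K h f) f \<le> \<rho> * ip N f f" using contr f f0 by auto
      qed
      finally show ?thesis .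
    qed
    then show "\<exists>D. D \<in> sets borel \<and> D \<subseteq> ball x \<epsilon> \<and>
      (\<forall>z\<in>M. \<forall>n. measure (P z) (avoid D s (\<epsilon> ^ (2 * CARD('n))) n) \<le>
         a * (1 - kappa CARD('n) \<epsilon> * \<epsilon> ^ (2 * CARD('n)) / C) ^ n)"
      using yr unfolding h_def \<rho>_def by (intro exI[of _ "ball y r"]) auto
  qed
  with C \<epsilon>0 show ?thesis by blast
qed

end

section \<open>Intrinsic coverings\<close>

text \<open>The partition with the two end points alone bounds the length of a curve from below.\<close>

lemma dist_le_intrinsic_dist: "ennreal (dist x y) \<le> intrinsic_dist M x y"
  unfolding intrinsic_dist_def
proof (rule INF_greatest)
  fix \<gamma> assume "\<gamma> \<in> {\<gamma>. path \<gamma> \<and> path_image \<gamma> \<subseteq> M \<and> pathstart \<gamma> = x \<and> pathfinish \<gamma> = y}"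
  then have \<gamma>: "\<gamma> 0 = x" "\<gamma> 1 = y" by (auto simp: pathstart_def pathfinish_def)
  define t where "t = (\<lambda>i::nat. if i = 0 then 0 else (1::real))"
  have t: "mono t" "range t \<subseteq> {0..1}" by (auto simp: t_def mono_def)
  have "ennreal (dist x y) = (\<lambda>(n, t). ennreal (\<Sum>i<n::nat. dist (\<gamma> (t i)) (\<gamma> (t (Suc i))))) (1, t)"
    by (simp add: t_def \<gamma>)
  also have "\<dots> \<le> curve_length \<gamma>"
    unfolding curve_length_def by (rule SUP_upper) (use t in simp)
  finally show "ennreal (dist x y) \<le> curve_length \<gamma>" .
qed

lemma intrinsic_ball_subset_ball: "intrinsic_ball M x \<epsilon> \<subseteq> ball x \<epsilon>"
proof
  fix y assume "y \<in> intrinsic_ball M x \<epsilon>"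
  then have "ennreal (dist x y) < ennreal \<epsilon>"
    using dist_le_intrinsic_dist[of x y M] by (auto simp: intrinsic_ball_def)
  then show "y \<in> ball x \<epsilon>" using ennreal_less_iff[of "dist x y" \<epsilon>] by simp
qed

text \<open>By compactness finitely many Euclidean balls of a small radius cover \<open>M\<close>, and by the comparison of the two
  metrics they lie in intrinsic balls. Hence the minimum that defines the covering number is over a
  nonempty set.\<close>

lemma covering_number_attained:
  fixes M :: "'a::euclidean_space set"
  assumes M: "compact M" and c: "c \<ge> 1" "\<rho> > 0"
    and close: "\<forall>x\<in>M. \<forall>y\<in>M. dist x y < \<rho> \<longrightarrow> intrinsic_dist M x y \<le> ennreal (c * dist x y)"
    and \<epsilon>: "0 < \<epsilon>"
  shows "\<exists>S. finite S \<and> card S = covering_number M \<epsilon> \<and> S \<subseteq> M \<and> M \<subseteq> (\<Union>x\<in>S. intrinsic_ball M x \<epsilon>)"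
proof -
  define \<eta> where "\<eta> = min \<rho> (\<epsilon> / c)"
  have \<eta>: "0 < \<eta>" using c \<epsilon> by (simp add: \<eta>_def)
  have cover: "M \<subseteq> (\<Union>x\<in>M. ball x \<eta>)" using \<eta> by force
  obtain F where F: "F \<subseteq> M" "finite F" "M \<subseteq> (\<Union>x\<in>F. ball x \<eta>)"
    using compactE_image[OF M _ cover] by auto
  have "M \<subseteq> (\<Union>x\<in>F. intrinsic_ball M x \<epsilon>)"
  proof
    fix y assume y: "y \<in> M"
    then obtain x where x: "x \<in> F" "dist x y < \<eta>" using F(3) by auto
    then have "intrinsic_dist M x y \<le> ennreal (c * dist x y)" using close F(1) y by (auto simp: \<eta>_def)
    also have "\<dots> < ennreal \<epsilon>"
    proof (rule ennreal_lessI[OF \<epsilon>])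
      have "dist x y < \<epsilon> / c" using x by (simp add: \<eta>_def)
      then show "c * dist x y < \<epsilon>" using c by (simp add: less_divide_eq mult.commute)
    qed
    finally show "y \<in> (\<Union>x\<in>F. intrinsic_ball M x \<epsilon>)" using x(1) y by (auto simp: intrinsic_ball_def)
  qed
  then have "\<exists>n S. finite S \<and> card S = n \<and> S \<subseteq> M \<and> M \<subseteq> (\<Union>x\<in>S. intrinsic_ball M x \<epsilon>)"
    using F by blast
  from LeastI_ex[OF this] show ?thesis unfolding covering_number_def .
qed

text \<open>Two points at distance \<open>2 * \<epsilon>\<close> need different balls. This bounds \<open>ln\<close> of the covering number away from
  zero, which the waiting time relies on.\<close>

lemma covering_number_ge_2:
  assumes S: "finite S" "M \<subseteq> (\<Union>x\<in>S. intrinsic_ball M x \<epsilon>)" and ab: "a \<in> M" "b \<in> M" "2 * \<epsilon> \<le> dist a b"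
  shows "2 \<le> card S"
proof (rule ccontr)
  assume "\<not> 2 \<le> card S"
  then have "card S \<le> 1" by simp
  obtain x where x: "x \<in> S" "a \<in> intrinsic_ball M x \<epsilon>" using S(2) ab(1) by blast
  obtain x' where x': "x' \<in> S" "b \<in> intrinsic_ball M x' \<epsilon>" using S(2) ab(2) by blast
  have "x' = x" using \<open>card S \<le> 1\<close> S(1) x(1) x'(1) by (auto simp: card_le_Suc0_iff_eq)
  then have "dist x a < \<epsilon>" "dist x b < \<epsilon>"
    using x(2) x'(2) intrinsic_ball_subset_ball[of M x \<epsilon>] by auto
  then show False using ab(3) dist_triangle[of a b x] by (simp add: dist_commute)
qed

section \<open>Homology of the offset\<close>

lemma offset_homology:
  fixes M :: "'a::euclidean_space set"
  assumes M: "compact M" and S: "compact S" "S \<noteq> {}" "S \<subseteq> M"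
    and r: "0 < r" "ennreal r \<le> ennreal (1 / 16) * reach M" and reach: "0 < reach M"
    and dense: "\<And>y. y \<in> M \<Longrightarrow> infdist y S \<le> r / 2"
  shows "linearly_isomorphic (homology_space TYPE('k::field) q (top_of_set (offset r S)))
           (homology_space TYPE('k) q (top_of_set M))"
proof -
  \<comment> \<open>Room for \<open>\<tau>\<close> is left because \<open>r\<close> is at most a sixteenth of the reach.\<close>
  obtain \<tau> where \<tau>: "8 * r < \<tau>" "ennreal \<tau> < reach M"
  proof (cases "reach M")
    case (real R)
    have R: "0 < R" using reach real by simp
    have "ennreal r \<le> ennreal (1 / 16 * R)" using r(2) R unfolding real by (subst ennreal_mult) auto
    then have "r \<le> R / 16" using R by (subst (asm) ennreal_le_iff) auto
    then show ?thesis using that[of "3 / 4 * R"] R real by (simp add: ennreal_less_iff)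
  next
    case top
    then show ?thesis using that[of "8 * r + 1"] by simp
  qed
  have "M \<noteq> {}" using S by blast
  then have "top_of_set (offset r S) homotopy_equivalent_space top_of_set M"
    using offset_of_dense_sample_homotopy_equivalent[OF M _ unique_nearest_below_reach[OF \<tau>(2)] S r(1) \<tau>(1) dense] by blast
  then show ?thesis by (rule homotopy_equivalent_imp_homology_isomorphic)
qed

section \<open>The waiting time\<close>

text \<open>Since \<open>ln N \<ge> 1 / 2\<close>, the fixed losses \<open>s0 + 1\<close> (waiting and rounding) and \<open>C ln a\<close> (domination) are
  absorbed by multiplying \<open>ln N + ln (1 / \<delta>)\<close> with a larger constant. The step size \<open>h\<close> cancels.\<close>

lemma decay_time:
  fixes \<kappa> h C a N \<delta> s0 T :: real
  assumes \<kappa>: "0 < \<kappa>" "\<kappa> \<le> 1" and h: "0 < h" "h \<le> 1" and C: "1 \<le> C" and a: "1 \<le> a" and N: "2 \<le> N"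
    and \<delta>: "0 < \<delta>" "\<delta> < 1" and s0: "0 < s0"
    and T: "(C + 2 * (s0 + 1 + C * ln a)) * (s0 + inverse \<kappa> * (ln N + ln (1 / \<delta>))) \<le> T"
  shows "s0 \<le> T" "N * (a * (1 - \<kappa> * h / C) ^ nat \<lfloor>(T - s0) / h\<rfloor>) \<le> \<delta>"
proof -
  define l where "l = ln N + ln (1 / \<delta>)"
  define C' where "C' = C + 2 * (s0 + 1 + C * ln a)"
  have la: "0 \<le> ln a" using a by simp
  have l\<delta>: "0 \<le> ln (1 / \<delta>)" using \<delta> by simp
  have "exp (1 / 2) \<le> (2::real)" 
  proof -
    have "exp (1 / 2 :: real) \<le> 1 + 1 / 2 + (1 / 2)\<^sup>2" by (rule exp_bound) auto
    then show ?thesis by (simp add: power2_eq_square)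
  qed
  then have "exp (1 / 2) \<le> N" using N by simp
  then have "1 / 2 \<le> ln N" using N by (intro ln_ge_iff[THEN iffD2]) auto
  then have l: "1 / 2 \<le> l" using l\<delta> by (simp add: l_def)
  have C': "1 \<le> C'" using C s0 la by (simp add: C'_def)
  have il: "0 \<le> inverse \<kappa> * l" using \<kappa> l by simp
  have T': "C' * (s0 + inverse \<kappa> * l) \<le> T" using T by (simp add: C'_def l_def)
  show s0T: "s0 \<le> T"
  proof -
    have "s0 \<le> 1 * (s0 + inverse \<kappa> * l)" using il by simp
    also have "\<dots> \<le> C' * (s0 + inverse \<kappa> * l)" using C' s0 il by (intro mult_right_mono) auto
    finally show ?thesis using T' by simp
  qed
  define n where "n = nat \<lfloor>(T - s0) / h\<rfloor>"
  have n: "(T - s0) / h - 1 \<le> real n"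
  proof -
    have "0 \<le> (T - s0) / h" using s0T h by simp
    then have "real n = of_int \<lfloor>(T - s0) / h\<rfloor>" unfolding n_def by simp
    then show ?thesis by linarith
  qed
  have hn: "T - s0 - 1 \<le> h * real n"
  proof -
    have "h * ((T - s0) / h - 1) \<le> h * real n" using n h by (intro mult_left_mono) auto
    moreover have "h * ((T - s0) / h - 1) = T - s0 - h" using h by (simp add: field_simps)
    ultimately show ?thesis using h by linarith
  qed
  have "C' * l \<le> \<kappa> * T"
  proof -
    have "C' * (inverse \<kappa> * l) \<le> C' * (s0 + inverse \<kappa> * l)" using s0 C' by (intro mult_left_mono) auto
    then have "C' * (inverse \<kappa> * l) \<le> T" using T' by linarith
    then have "\<kappa> * (C' * (inverse \<kappa> * l)) \<le> \<kappa> * T" using \<kappa> by (intro mult_left_mono) simp_all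
    moreover have "\<kappa> * (C' * (inverse \<kappa> * l)) = C' * l" using \<kappa> by (simp add: field_simps)
    ultimately show ?thesis by linarith
  qed
  moreover have "C * l + (s0 + 1) + C * ln a \<le> C' * l"
  proof -
    have "1 * (s0 + 1 + C * ln a) \<le> (2 * l) * (s0 + 1 + C * ln a)"
      using l s0 C la by (intro mult_right_mono) auto
    then show ?thesis by (simp add: C'_def algebra_simps)
  qed
  moreover have "\<kappa> * (s0 + 1) \<le> s0 + 1" using \<kappa> s0 by (simp add: mult_left_le_one_le)
  ultimately have "C * (l + ln a) \<le> \<kappa> * (T - s0 - 1)" by (simp add: algebra_simps)
  also have "\<dots> \<le> \<kappa> * (h * real n)" using hn \<kappa> by (intro mult_left_mono) auto
  finally have "l + ln a \<le> \<kappa> * h / C * real n" using C by (simp add: le_divide_eq mult_ac)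
  then have ex: "exp (- (\<kappa> * h / C * real n)) \<le> exp (- (l + ln a))" by simp
  have "(1 - \<kappa> * h / C) ^ n \<le> exp (- (\<kappa> * h / C)) ^ n"
  proof (rule power_mono)
    show "1 - \<kappa> * h / C \<le> exp (- (\<kappa> * h / C))" using exp_ge_add_one_self[of "- (\<kappa> * h / C)"] by simp
    have "\<kappa> * h \<le> 1 * 1" using \<kappa> h by (intro mult_mono) auto
    then show "0 \<le> 1 - \<kappa> * h / C" using C by (simp add: divide_le_eq)
  qed
  also have "\<dots> = exp (- (\<kappa> * h / C * real n))" by (simp add: exp_of_nat_mult[symmetric] mult.commute)
  also have "\<dots> \<le> exp (- (l + ln a))" by (rule ex)
  also have "\<dots> = \<delta> / (N * a)"
    using N a \<delta> by (simp add: l_def exp_minus exp_add ln_div exp_diff field_simps)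
  finally have "N * (a * (1 - \<kappa> * h / C) ^ n) \<le> N * (a * (\<delta> / (N * a)))"
    using N a by (intro mult_left_mono) auto
  then show "N * (a * (1 - \<kappa> * h / C) ^ nat \<lfloor>(T - s0) / h\<rfloor>) \<le> \<delta>" using N a by (simp add: n_def)
qed

theorem theorem6p3:
  fixes G M :: "(real^'n::finite) set"
    and P :: "real^'n \<Rightarrow> (real \<Rightarrow> real^'n) measure"
    and p :: "real \<Rightarrow> real^'n \<Rightarrow> real^'n \<Rightarrow> real"
    and c_ie \<rho>_ie c_vol C_vol \<rho>_vol s0 a_hk :: real
  assumes dim: "CARD('n) \<ge> 2"
    and domain: "open G" "connected G" "bounded G" "G \<noteq> {}" "M = closure G"
    and positive_reach: "0 < reach M"
    and intrinsic_euclidean: "c_ie \<ge> 1" "\<rho>_ie > 0"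
      "\<forall>x\<in>M. \<forall>y\<in>M. dist x y < \<rho>_ie \<longrightarrow> intrinsic_dist M x y \<le> ennreal (c_ie * dist x y)"
    and volume: "c_vol > 0" "C_vol > 0" "\<rho>_vol > 0"
      "\<forall>x\<in>M. \<forall>\<epsilon>. 0 < \<epsilon> \<and> \<epsilon> < \<rho>_vol \<longrightarrow>
         c_vol * \<epsilon> ^ CARD('n) \<le> measure (norm_lebesgue M) (intrinsic_ball M x \<epsilon>) \<and>
         measure (norm_lebesgue M) (intrinsic_ball M x \<epsilon>) \<le> C_vol * \<epsilon> ^ CARD('n)"
    and admissible: "admissible_reflecting_domain M"
    and process: "reflected_brownian_motion M P" "neumann_heat_kernel M P p"
    and domination: "s0 > 0" "a_hk \<ge> 1" "\<forall>t\<ge>s0. \<forall>x\<in>M. \<forall>y\<in>M. p t x y \<le> a_hk"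
  shows "\<exists>C C_low C_up \<epsilon>0. 0 < C \<and> 0 < C_low \<and> 0 < C_up \<and> 0 < \<epsilon>0 \<and>
    (\<forall>\<epsilon> \<delta> z T. 0 < \<epsilon> \<and> \<epsilon> < \<epsilon>0 \<and> 0 < \<delta> \<and> \<delta> < 1 \<and> z \<in> M \<and>
       T \<ge> C * (s0 + inverse (kappa CARD('n) \<epsilon>) *
                      (ln (real (covering_number M \<epsilon>)) + ln (1 / \<delta>))) \<longrightarrow>
       (\<forall>r. C_low * \<epsilon> \<le> r \<and> ennreal r \<le> ennreal C_up * reach M \<longrightarrow>
         (\<exists>A \<in> sets (path_space M).
            A \<subseteq> {\<omega> \<in> space (path_space M). \<forall>q\<le>CARD('n).
                   linearly_isomorphic
                     (homology_space TYPE('k::field) q (top_of_set (offset r (\<omega> ` {0..T}))))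
                     (homology_space TYPE('k) q (top_of_set M))} \<and>
            measure (P z) A \<ge> 1 - \<delta>)))"
proof -
  have M: "compact M" using domain by (simp add: compact_closure)
  have "G \<subseteq> interior M" using domain closure_subset[of G] by (simp add: interior_maximal)
  then have int: "interior M \<noteq> {}" using domain(4) by blast
  have hunt: "hunt_process M P" and assoc: "dirichlet_associated M P"
    using process(1) by (auto simp: reflected_brownian_motion_def)
  have comp: "compact_semigroup M P" and charts: "uniform_charts M"
    and ground: "\<forall>f \<in> neumann_eigenspace M 0. \<exists>c. AE x in norm_lebesgue M. f x = c"
    using admissible process unfolding admissible_reflecting_domain_def neumann_spectral_gap_def by blast+
  interpret hunt_kernel M P p
    by unfold_locales (use M int hunt process(2) in auto)
  interpret reflected_brownian_body M p P
    by unfold_locales (use transition_op_kernel assoc comp ground in auto)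
  have dom: "\<forall>x\<in>M. \<forall>y\<in>M. p s0 x y \<le> a_hk" using domination(3) by blast
  have a0: "0 \<le> a_hk" using domination by simp
  from avoid_decay[OF dim charts domination(1) a0 dom] obtain C1 \<epsilon>1
    where C1: "1 \<le> C1" and \<epsilon>1: "0 < \<epsilon>1" "\<epsilon>1 \<le> exp (-1)"
    and decay: "\<forall>\<epsilon> x. 0 < \<epsilon> \<longrightarrow> \<epsilon> < \<epsilon>1 \<longrightarrow> x \<in> M \<longrightarrow>
    (\<exists>D. D \<in> sets borel \<and> D \<subseteq> ball x \<epsilon> \<and>
      (\<forall>z\<in>M. \<forall>n. measure (P z) (avoid D s0 (\<epsilon> ^ (2 * CARD('n))) n) \<le>
         a_hk * (1 - kappa CARD('n) \<epsilon> * \<epsilon> ^ (2 * CARD('n)) / C1) ^ n))"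
    by (elim exE conjE) (rule that)
  obtain a b where ab: "a \<in> M" "b \<in> M" "a \<noteq> b"
  proof -
    obtain x e where e: "0 < e" "ball x e \<subseteq> M"
      using int open_interior[of M] interior_subset[of M] by (metis all_not_in_conv open_contains_ball subset_trans)
    obtain v :: "real^'n" where v: "norm v = e / 2" using vector_choose_size[of "e / 2"] e by auto
    have "x + v \<in> M" using v e by (auto simp: dist_norm subset_iff)
    moreover have "x \<in> M" "x + v \<noteq> x" using v e by (auto simp: subset_iff)
    ultimately show ?thesis using that by blast
  qed
  \<comment> \<open>The second bound makes every covering consist of at least two balls.\<close>
  define \<epsilon>0 where "\<epsilon>0 = min \<epsilon>1 (dist a b / 2)"
  have \<epsilon>0: "0 < \<epsilon>0" using \<epsilon>1 ab by (simp add: \<epsilon>0_def)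
  define C where "C = C1 + 2 * (s0 + 1 + C1 * ln a_hk)"
  have C: "0 < C" using C1 domination by (auto simp: C_def intro!: add_pos_nonneg add_nonneg_nonneg)
  have main: "\<exists>A \<in> sets (path_space M).
            A \<subseteq> {\<omega> \<in> space (path_space M). \<forall>q\<le>CARD('n).
                   linearly_isomorphic
                     (homology_space TYPE('k::field) q (top_of_set (offset r (\<omega> ` {0..T}))))
                     (homology_space TYPE('k) q (top_of_set M))} \<and>
            measure (P z) A \<ge> 1 - \<delta>"
    if \<epsilon>: "0 < \<epsilon>" "\<epsilon> < \<epsilon>0" and \<delta>: "0 < \<delta>" "\<delta> < 1" and z: "z \<in> M"
      and T: "C * (s0 + inverse (kappa CARD('n) \<epsilon>) * (ln (real (covering_number M \<epsilon>)) + ln (1 / \<delta>))) \<le> T"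
      and r: "4 * \<epsilon> \<le> r" "ennreal r \<le> ennreal (1 / 16) * reach M" for \<epsilon> \<delta> z T r
  proof -
    have \<epsilon>e: "\<epsilon> \<le> exp (-1)" using \<epsilon> \<epsilon>1 by (simp add: \<epsilon>0_def)
    have "exp (-1) \<le> (1::real)" by simp
    then have \<epsilon>_le_1: "\<epsilon> \<le> 1" using \<epsilon>e by linarith
    define \<kappa> where "\<kappa> = kappa CARD('n) \<epsilon>"
    define h where "h = \<epsilon> ^ (2 * CARD('n))"
    have h: "0 < h" "h \<le> 1" using \<epsilon> \<epsilon>_le_1 by (auto simp: h_def power_le_one)
    have \<kappa>: "0 < \<kappa>" "\<kappa> \<le> 1" using kappa_bounds[OF dim \<epsilon>(1) \<epsilon>e] by (auto simp: \<kappa>_def)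
    obtain S where S: "finite S" "card S = covering_number M \<epsilon>" "S \<subseteq> M" "M \<subseteq> (\<Union>x\<in>S. intrinsic_ball M x \<epsilon>)"
      using covering_number_attained[OF M intrinsic_euclidean \<epsilon>(1)] by blast
    have card2: "2 \<le> card S"
      by (rule covering_number_ge_2[OF S(1,4) ab(1,2)]) (use \<epsilon>(2) in \<open>simp add: \<epsilon>0_def\<close>)
    define n where "n = nat \<lfloor>(T - s0) / h\<rfloor>"
    have T': "(C1 + 2 * (s0 + 1 + C1 * ln a_hk)) * (s0 + inverse \<kappa> * (ln (real (card S)) + ln (1 / \<delta>))) \<le> T"
      using T by (simp add: C_def \<kappa>_def S(2))
    have s0T: "s0 \<le> T" and small: "real (card S) * (a_hk * (1 - \<kappa> * h / C1) ^ n) \<le> \<delta>"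
      using decay_time[OF \<kappa> h C1 domination(2) _ \<delta> domination(1) T'] card2 by (auto simp: n_def)
    have "\<forall>x\<in>S. \<exists>D. D \<in> sets borel \<and> D \<subseteq> ball x \<epsilon> \<and>
        measure (P z) (avoid D s0 h n) \<le> a_hk * (1 - \<kappa> * h / C1) ^ n"
    proof
      fix x assume "x \<in> S"
      then have "x \<in> M" using S by blast
      moreover have "\<epsilon> < \<epsilon>1" using \<epsilon> by (simp add: \<epsilon>0_def)
      ultimately show "\<exists>D. D \<in> sets borel \<and> D \<subseteq> ball x \<epsilon> \<and>
        measure (P z) (avoid D s0 h n) \<le> a_hk * (1 - \<kappa> * h / C1) ^ n"
        using decay[rule_format, OF \<epsilon>(1), of x] z unfolding h_def \<kappa>_def by blast
    qed
    from bchoice[OF this] obtain D where D: "\<And>x. x \<in> S \<Longrightarrow> D x \<in> sets borel" "\<And>x. x \<in> S \<Longrightarrow> D x \<subseteq> ball x \<epsilon>"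
      "\<And>x. x \<in> S \<Longrightarrow> measure (P z) (avoid (D x) s0 h n) \<le> a_hk * (1 - \<kappa> * h / C1) ^ n" by blast
    define miss where "miss = (\<Union>x\<in>S. avoid (D x) s0 h n)"
    define A where "A = space (path_space M) - miss"
    have avoid_meas: "avoid (D x) s0 h n \<in> sets (path_space M)" if "x \<in> S" for x
      using avoid_sets[OF D(1)[OF that]] domination(1) h by simp
    have miss: "miss \<in> sets (path_space M)"
      unfolding miss_def using avoid_meas S(1) by (intro sets.finite_UN) auto
    have A: "A \<in> sets (path_space M)" unfolding A_def using miss by auto
    interpret Pz: prob_space "P z" using P_kernel(1)[OF z] .
    have "measure (P z) miss \<le> (\<Sum>x\<in>S. measure (P z) (avoid (D x) s0 h n))"
      unfolding miss_def using avoid_meas P_kernel(2)[OF z] S(1)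
      by (intro Pz.finite_measure_subadditive_finite) auto
    also have "\<dots> \<le> real (card S) * (a_hk * (1 - \<kappa> * h / C1) ^ n)"
      using D(3) by (intro sum_bounded_above) auto
    also note small
    finally have "measure (P z) miss \<le> \<delta>" .
    moreover have "measure (P z) A = 1 - measure (P z) miss"
      unfolding A_def using Pz.prob_compl[of miss] miss P_kernel(2,3)[OF z] by simp
    ultimately have PA: "1 - \<delta> \<le> measure (P z) A" by simp
    have good: "linearly_isomorphic (homology_space TYPE('k) q (top_of_set (offset r (\<omega> ` {0..T}))))
        (homology_space TYPE('k) q (top_of_set M))" if \<omega>: "\<omega> \<in> A" for \<omega> q
    proof (rule offset_homology[OF M _ _ _ _ r(2) positive_reach])
      have \<omega>s: "\<omega> \<in> space (path_space M)" using \<omega> by (simp add: A_def)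
      then have c: "continuous_on {0..} \<omega>" and im: "\<omega> ` {0..} \<subseteq> M" by (auto simp: space_path)
      show "compact (\<omega> ` {0..T})"
        by (rule compact_continuous_image[OF continuous_on_subset[OF c]]) auto
      show "\<omega> ` {0..T} \<noteq> {}" using s0T domination(1) by auto
      show "\<omega> ` {0..T} \<subseteq> M" using im by auto
      show "0 < r" using r(1) \<epsilon>(1) by linarith
      fix y assume "y \<in> M"
      then obtain x where x: "x \<in> S" "y \<in> intrinsic_ball M x \<epsilon>" using S(4) by blast
      have "\<omega> \<notin> avoid (D x) s0 h n" using \<omega> x(1) by (auto simp: A_def miss_def)
      then obtain k where k: "k \<le> n" "\<omega> (s0 + real k * h) \<in> D x" using \<omega>s by (auto simp: avoid_def)
      define t where "t = s0 + real k * h"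
      have "real k * h \<le> T - s0"
      proof -
        have "0 \<le> (T - s0) / h" using s0T h by simp
        then have "real n \<le> (T - s0) / h" unfolding n_def by linarith
        then have "real n * h \<le> T - s0" using h by (simp add: le_divide_eq)
        moreover have "real k * h \<le> real n * h" using k(1) h by (intro mult_right_mono) auto
        ultimately show ?thesis by linarith
      qed
      then have t: "t \<in> {0..T}" using domination(1) h by (simp add: t_def)
      \<comment> \<open>One \<open>\<epsilon>\<close> for the covering ball and one for the ball that is hit: this is the origin of the
        constant \<open>4\<close> in the lower bound for \<open>r\<close>.\<close>
      have "infdist y (\<omega> ` {0..T}) \<le> dist y (\<omega> t)" using t by (intro infdist_le) auto
      also have "\<dots> \<le> dist y x + dist x (\<omega> t)" by (rule dist_triangle)
      also have "\<dots> \<le> \<epsilon> + \<epsilon>"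
        using x(2) intrinsic_ball_subset_ball[of M x \<epsilon>] D(2)[OF x(1)] k(2)
        by (intro add_mono) (auto simp: t_def dist_commute subset_iff intro: less_imp_le)
      also have "\<dots> \<le> r / 2" using r(1) by simp
      finally show "infdist y (\<omega> ` {0..T}) \<le> r / 2" .
    qed
    have "A \<subseteq> space (path_space M)" by (auto simp: A_def)
    then show ?thesis using A PA good by (intro bexI[of _ A]) auto
  qed
  show ?thesis
    by (rule exI[of _ C], rule exI[of _ 4], rule exI[of _ "1 / 16"], rule exI[of _ \<epsilon>0]) (use C \<epsilon>0 main in auto)
qed

end
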